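(* Let $A=\sigma(R)\langle x_1,\dots,x_n\rangle$ be a skew PBW extension of a ring $R$ with associated graded ring $Gr(A)$, let $m\ge1$, let $\ge$ be a monomial order on $Mon(A^m)$, and let $\ge_{gr}$ be the monomial order on $Mon(Gr(A)^m)$ defined by $\eta(\mathbf X)\ge_{gr}\eta(\mathbf Y)\Leftrightarrow \mathbf X\ge\mathbf Y$. Let $M$ be a nonzero (left) submodule of $A^m$. Then: (i) If $\overline{\mathcal G}=\{\mathbf G_j\}_{j\in J}$ is a Gröbner basis of $Gr(M)$ with respect to $\ge_{gr}$ consisting of homogeneous elements, and for each $j\in J$ an element $\mathbf g_j\in M$ with $\eta(\mathbf g_j)=\mathbf G_j$ is chosen, then $\mathcal G:=\{\mathbf g_j\}_{j\in J}$ is a Gröbner basis of $M$ with respect to $\ge$. (ii) If $\mathcal G=\{\mathbf g_i\}_{i\in J}$ is a Gröbner basis of $M$ with respect to $\ge$, then $\overline{\mathcal G}=\{\eta(\mathbf g_i)\}_{i\in J}$ is a Gröbner basis of $Gr(M)$ with respect to $\ge_{gr}$, consisting of homogeneous elements.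
   Context: Rings are associative with $1$. A ring $A$ is a skew PBW extension of a ring $R$, written $A=\sigma(R)\langle x_1,\dots,x_n\rangle$, if: (i) $R\subseteq A$ (subring); (ii) $x_1,\dots,x_n\in A$ and $A$ is a free left $R$-module with basis $Mon(A)=\{x^\alpha=x_1^{\alpha_1}\cdots x_n^{\alpha_n}\mid \alpha\in\mathbb N^n\}$; (iii) for all $1\le i\le n$ and $r\in R\setminus\{0\}$ there is $c_{i,r}\in R\setminus\{0\}$ with $x_ir-c_{i,r}x_i\in R$; (iv) for all $1\le i,j\le n$ there is $c_{i,j}\in R\setminus\{0\}$ with $x_jx_i-c_{i,j}x_ix_j\in R+Rx_1+\cdots+Rx_n$. Put $\deg(x^\alpha)=|\alpha|=\alpha_1+\dots+\alpha_n$, and for $0\ne f\in A$ let $\deg(f)$ be the maximal degree of the monomials occurring in $f$. Known facts defining $\sigma^\alpha$ and $c_{\alpha,\beta}$: for $\alpha\in\mathbb N^n$, $0\ne r\in R$ there are unique $\sigma^\alpha(r)\in R\setminus\{0\}$ and $p_{\alpha,r}\in A$ with $x^\alpha r=\sigma^\alpha(r)x^\alpha+p_{\alpha,r}$ and $p_{\alpha,r}=0$ or $\deg(p_{\alpha,r})<|\alpha|$; for $\alpha,\beta\in\mathbb N^n$ there are unique $c_{\alpha,\beta}\in R$ (left invertible) and $p_{\alpha,\beta}\in A$ with $x^\alpha x^\beta=c_{\alpha,\beta}x^{\alpha+\beta}+p_{\alpha,\beta}$ and $p_{\alpha,\beta}=0$ or $\deg(p_{\alpha,\beta})<|\alpha+\beta|$.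 $A$ is filtered by $F_p(A)=0$ for $p\le -1$, $F_0(A)=R$, $F_p(A)=\{f\in A\mid f=0\text{ or }\deg(f)\le p\}$ for $p\ge1$; $Gr(A)=\bigoplus_{p\ge0}F_p(A)/F_{p-1}(A)$. For $0\neq f\in A$ of degree $p$, $\eta(f)=f+F_{p-1}(A)$. It is known that $Gr(A)$ is again a skew PBW extension of $R$ in the variables $\eta(x_1),\dots,\eta(x_n)$, with left $R$-basis $Mon(Gr(A))=\{\eta(x^\alpha)=\eta(x_1)^{\alpha_1}\cdots\eta(x_n)^{\alpha_n}\}$, so all the notions here apply to $Gr(A)$ as well. Modules: $A^m$ is the free left $A$-module with canonical basis $\mathbf e_1,\dots,\mathbf e_m$; $Mon(A^m)=\{x^\alpha\mathbf e_i\}$, $\deg(x^\alpha\mathbf e_i)=|\alpha|$, $\exp(x^\alpha\mathbf e_i)=\alpha$, and $\deg(\mathbf f)$ is the maximal degree of the monomials occurring in $\mathbf f\ne0$. For a submodule $M\subseteq A^m$: $F_p(M)=\{\mathbf f\in M\mid \mathbf f=0\text{ or }\deg(\mathbf f)\le p\}$ ($F_{-1}(M)=0$), $Gr(M)=\bigoplus_{p\ge0}F_p(M)/F_{p-1}(M)$, and $\eta(\mathbf f)=\mathbf f+F_{p-1}(M)$ if $\mathbf f\in F_p(M)\setminus F_{p-1}(M)$. $Gr(M)$ is a left $Gr(A)$-module via $\eta(r)\eta(\mathbf f)=\eta(r\mathbf f)$ if $r\mathbf f\notin F_{i+j-1}(M)$ and $0$ otherwise, for $r\in F_i(A)\setminus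 F_{i-1}(A)$, $\mathbf f\in F_j(M)\setminus F_{j-1}(M)$, extended by distributivity. $Gr(A^m)$ is identified with $Gr(A)^m$ and $Gr(M)$ with a submodule of it; the monomials of $Gr(A)^m$ are $\eta(x^\alpha\mathbf e_i)=\eta(x^\alpha)\overline{\mathbf e}_i$, with $\overline{\mathbf e}_i$ the canonical vectors of $Gr(A)^m$. On $Mon(A)$, $lm(x^\beta x^\alpha)=x^{\alpha+\beta}$ denotes the leading (top-degree) monomial of the product. A monomial order on $Mon(A^m)$ is a total order $\succeq$ such that: (i) $lm(x^\beta x^\alpha)\mathbf e_i\succeq x^\alpha\mathbf e_i$ for all $x^\alpha\mathbf e_i\in Mon(A^m)$, $x^\beta\in Mon(A)$; (ii) $x^\beta\mathbf e_j\succeq x^\alpha\mathbf e_i$ implies $lm(x^\gamma x^\beta)\mathbf e_j\succeq lm(x^\gamma x^\alpha)\mathbf e_i$ for all $x^\gamma\in Mon(A)$; (iii) $\deg(\mathbf X)>\deg(\mathbf Y)$ implies $\mathbf X\succ\mathbf Y$. For $\mathbf f\neq0$, $lm(\mathbf f)$ is the largest monomial occurring in $\mathbf f$ and $lc(\mathbf f)\in R\setminus\{0\}$ its coefficient. $x^\alpha\mathbf e_i$ divides $x^\beta\mathbf e_j$ if $i=j$ and $\beta-\alpha\in\mathbb N^n$. Gröbner basis: for a nonzero submodule $M\subseteq A^m$ and a nonempty finite set $G$ of nonzero elements of $M$, $G$ is a Gröbner basis of $M$ if every $0\neq\mathbf f\in M$ is reducible with respect to $G$, i.e. there exist $\mathbf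 g_1,\dots,\mathbf g_t\in G$ with $lm(\mathbf g_j)\mid lm(\mathbf f)$ for all $j$, such that, with $\alpha_j\in\mathbb N^n$ given by $\alpha_j+\exp(lm(\mathbf g_j))=\exp(lm(\mathbf f))$, $lc(\mathbf f)$ lies in the left ideal of $R$ generated by $\sigma^{\alpha_1}(lc(\mathbf g_1))c_{\alpha_1,\mathbf g_1},\dots,\sigma^{\alpha_t}(lc(\mathbf g_t))c_{\alpha_t,\mathbf g_t}$, where $c_{\alpha,\mathbf g}:=c_{\alpha,\exp(lm(\mathbf g))}$. *)

theory Defs
  imports "HOL-Algebra.Module" "HOL-Algebra.QuotRing" "HOL-Algebra.Subrings"
begin

section \<open>Monomials and exponents\<close>

text \<open>Variables are indexed by \<open>0, \<dots>, n - 1\<close>. An element of \<open>\<nat>\<^sup>n\<close> is a function on the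
  naturals that vanishes from \<open>n\<close> on.\<close>

definition exponents :: "nat \<Rightarrow> (nat \<Rightarrow> nat) set"
  where "exponents n = {\<alpha>. \<forall>i\<ge>n. \<alpha> i = 0}"

definition exp_add :: "(nat \<Rightarrow> nat) \<Rightarrow> (nat \<Rightarrow> nat) \<Rightarrow> nat \<Rightarrow> nat"
  where "exp_add \<alpha> \<beta> = (\<lambda>i. \<alpha> i + \<beta> i)"

definition exp_size :: "nat \<Rightarrow> (nat \<Rightarrow> nat) \<Rightarrow> nat"
  where "exp_size n \<alpha> = (\<Sum>i<n. \<alpha> i)"

text \<open>The free left module \<open>A\<^sup>m\<close>; its vectors are extensional functions on \<open>{..<m}\<close>. The
  locale \<^locale>\<open>module\<close> asks for a commutative ring of scalars and so cannot be used for it, but the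
  record type and the locale \<^locale>\<open>submodule\<close> (which is closure under left multiplication) can. The
  ring multiplication fields of the record have no meaning here.\<close>

definition free_module :: "('a, 'b) ring_scheme \<Rightarrow> nat \<Rightarrow> ('a, nat \<Rightarrow> 'a) module"
  where "free_module A m =
    \<lparr>carrier = {..<m} \<rightarrow>\<^sub>E carrier A,
     mult = (\<lambda>_ _. undefined),
     one = undefined,
     zero = (\<lambda>i\<in>{..<m}. \<zero>\<^bsub>A\<^esub>),
     add = (\<lambda>f g. \<lambda>i\<in>{..<m}. f i \<oplus>\<^bsub>A\<^esub> g i),
     smult = (\<lambda>a f. \<lambda>i\<in>{..<m}. a \<otimes>\<^bsub>A\<^esub> f i)\<rparr>"


section \<open>Notions attached to a ring with a subring and a family of elements\<close>

text \<open>The following locale has no assumptions. Its constants make sense for any ring \<open>A\<close>, subset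
  \<open>R\<close> and elements \<open>x 0, \<dots>, x (n - 1)\<close>, so they can be used both for a skew PBW extension
  and for its associated graded ring.\<close>

locale pbw_data =
  fixes A :: "('a, 'b) ring_scheme" (structure)
    and R :: "'a set"
    and n :: nat
    and x :: "nat \<Rightarrow> 'a"
begin

definition mon :: "(nat \<Rightarrow> nat) \<Rightarrow> 'a"
  where "mon \<alpha> = foldr (\<lambda>i b. (x i [^] \<alpha> i) \<otimes> b) [0..<n] \<one>"

definition coeff_families :: "((nat \<Rightarrow> nat) \<Rightarrow> 'a) set"
  where "coeff_families = {c. (\<forall>\<alpha>. c \<alpha> \<in> R) \<and> (\<forall>\<alpha>. \<alpha> \<notin> exponents n \<longrightarrow> c \<alpha> = \<zero>) \<and>
    finite {\<alpha>. c \<alpha> \<noteq> \<zero>}}"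

definition lincomb :: "((nat \<Rightarrow> nat) \<Rightarrow> 'a) \<Rightarrow> 'a"
  where "lincomb c = (\<Oplus>\<alpha>\<in>{\<alpha>. c \<alpha> \<noteq> \<zero>}. c \<alpha> \<otimes> mon \<alpha>)"

definition free_left_basis :: bool
  where "free_left_basis \<longleftrightarrow> (\<forall>f\<in>carrier A. \<exists>!c. c \<in> coeff_families \<and> f = lincomb c)"

definition coeff :: "'a \<Rightarrow> (nat \<Rightarrow> nat) \<Rightarrow> 'a"
  where "coeff f = (THE c. c \<in> coeff_families \<and> f = lincomb c)"

text \<open>Junk value for \<open>f = \<zero>\<close>.\<close>

definition deg :: "'a \<Rightarrow> nat"
  where "deg f = Max (exp_size n ` {\<alpha>. coeff f \<alpha> \<noteq> \<zero>})"

text \<open>The set \<open>R + R x\<^sub>0 + \<dots> + R x\<^bsub>n-1\<^esub>\<close>.\<close>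

definition affine_span :: "'a set"
  where "affine_span = {r \<oplus> (\<Oplus>k\<in>{..<n}. s k \<otimes> x k) | r s. r \<in> R \<and> s \<in> {..<n} \<rightarrow> R}"

text \<open>\<open>\<sigma>\<^sup>\<alpha>(r)\<close> (for \<open>r \<noteq> \<zero>\<close>) and \<open>c\<^bsub>\<alpha>,\<beta>\<^esub>\<close>; the descriptions determine them
  by uniqueness of the coefficient of the top monomial.\<close>

definition sigma :: "(nat \<Rightarrow> nat) \<Rightarrow> 'a \<Rightarrow> 'a"
  where "sigma \<alpha> r = (THE s. s \<in> R - {\<zero>} \<and>
    (\<exists>p\<in>carrier A. mon \<alpha> \<otimes> r = s \<otimes> mon \<alpha> \<oplus> p \<and> (p = \<zero> \<or> deg p < exp_size n \<alpha>)))"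

definition struct_const :: "(nat \<Rightarrow> nat) \<Rightarrow> (nat \<Rightarrow> nat) \<Rightarrow> 'a"
  where "struct_const \<alpha> \<beta> = (THE c. c \<in> R \<and>
    (\<exists>p\<in>carrier A. mon \<alpha> \<otimes> mon \<beta> = c \<otimes> mon (exp_add \<alpha> \<beta>) \<oplus> p \<and>
      (p = \<zero> \<or> deg p < exp_size n (exp_add \<alpha> \<beta>))))"

definition left_ideal_gen :: "'a set \<Rightarrow> 'a set"
  where "left_ideal_gen S = \<Inter>{I. additive_subgroup I (A\<lparr>carrier := R\<rparr>) \<and>
    (\<forall>r\<in>R. \<forall>a\<in>I. r \<otimes> a \<in> I) \<and> S \<subseteq> I}"


subsection \<open>Monomials and leading data in \<open>A\<^sup>m\<close>\<close>

text \<open>The monomial \<open>x\<^sup>\<alpha> e\<^sub>i\<close>, as an element of \<open>A\<^sup>m\<close>.\<close>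

definition vmon :: "nat \<Rightarrow> (nat \<Rightarrow> nat) \<Rightarrow> nat \<Rightarrow> nat \<Rightarrow> 'a"
  where "vmon m \<alpha> i = (\<lambda>j\<in>{..<m}. if j = i then mon \<alpha> else \<zero>)"

definition Mon :: "nat \<Rightarrow> (nat \<Rightarrow> 'a) set"
  where "Mon m = {vmon m \<alpha> i | \<alpha> i. \<alpha> \<in> exponents n \<and> i < m}"

definition vexp :: "nat \<Rightarrow> (nat \<Rightarrow> 'a) \<Rightarrow> nat \<Rightarrow> nat"
  where "vexp m X = (THE \<alpha>. \<alpha> \<in> exponents n \<and> (\<exists>i<m. X = vmon m \<alpha> i))"

definition vpos :: "nat \<Rightarrow> (nat \<Rightarrow> 'a) \<Rightarrow> nat"
  where "vpos m X = (THE i. i < m \<and> (\<exists>\<alpha>\<in>exponents n. X = vmon m \<alpha> i))"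

definition vcoeff :: "nat \<Rightarrow> (nat \<Rightarrow> 'a) \<Rightarrow> (nat \<Rightarrow> 'a) \<Rightarrow> 'a"
  where "vcoeff m f X = coeff (f (vpos m X)) (vexp m X)"

definition vmonomials :: "nat \<Rightarrow> (nat \<Rightarrow> 'a) \<Rightarrow> (nat \<Rightarrow> 'a) set"
  where "vmonomials m f = {X \<in> Mon m. vcoeff m f X \<noteq> \<zero>}"

definition mdeg :: "nat \<Rightarrow> (nat \<Rightarrow> 'a) \<Rightarrow> nat"
  where "mdeg m X = exp_size n (vexp m X)"

definition vdeg :: "nat \<Rightarrow> (nat \<Rightarrow> 'a) \<Rightarrow> nat"
  where "vdeg m f = Max (mdeg m ` vmonomials m f)"

definition mdvd :: "nat \<Rightarrow> (nat \<Rightarrow> 'a) \<Rightarrow> (nat \<Rightarrow> 'a) \<Rightarrow> bool"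
  where "mdvd m X Y \<longleftrightarrow> vpos m X = vpos m Y \<and> (\<forall>k. vexp m X k \<le> vexp m Y k)"

text \<open>An order is given by the set of pairs \<open>(Y, X)\<close> with \<open>X \<succeq> Y\<close>.
  The leading monomial of \<open>x\<^sup>\<beta> x\<^sup>\<alpha>\<close> is \<open>x\<close> to the power \<open>\<alpha> + \<beta>\<close>.\<close>

definition monomial_order :: "nat \<Rightarrow> ((nat \<Rightarrow> 'a) \<times> (nat \<Rightarrow> 'a)) set \<Rightarrow> bool"
  where "monomial_order m ord \<longleftrightarrow>
    linear_order_on (Mon m) ord \<and>
    (\<forall>\<alpha>\<in>exponents n. \<forall>\<beta>\<in>exponents n. \<forall>i<m.
      (vmon m \<alpha> i, vmon m (exp_add \<beta> \<alpha>) i) \<in> ord) \<and>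
    (\<forall>\<alpha>\<in>exponents n. \<forall>\<beta>\<in>exponents n. \<forall>\<gamma>\<in>exponents n. \<forall>i<m. \<forall>j<m.
      (vmon m \<alpha> i, vmon m \<beta> j) \<in> ord \<longrightarrow>
      (vmon m (exp_add \<gamma> \<alpha>) i, vmon m (exp_add \<gamma> \<beta>) j) \<in> ord) \<and>
    (\<forall>X\<in>Mon m. \<forall>Y\<in>Mon m. mdeg m X > mdeg m Y \<longrightarrow> (Y, X) \<in> ord \<and> Y \<noteq> X)"

definition lm :: "nat \<Rightarrow> ((nat \<Rightarrow> 'a) \<times> (nat \<Rightarrow> 'a)) set \<Rightarrow> (nat \<Rightarrow> 'a) \<Rightarrow> nat \<Rightarrow> 'a"
  where "lm m ord f = (THE X. X \<in> vmonomials m f \<and> (\<forall>Y\<in>vmonomials m f. (Y, X) \<in> ord))"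

definition lc :: "nat \<Rightarrow> ((nat \<Rightarrow> 'a) \<times> (nat \<Rightarrow> 'a)) set \<Rightarrow> (nat \<Rightarrow> 'a) \<Rightarrow> 'a"
  where "lc m ord f = vcoeff m f (lm m ord f)"

definition reducible ::
    "nat \<Rightarrow> ((nat \<Rightarrow> 'a) \<times> (nat \<Rightarrow> 'a)) set \<Rightarrow> (nat \<Rightarrow> 'a) set \<Rightarrow> (nat \<Rightarrow> 'a) \<Rightarrow> bool"
  where "reducible m ord G f \<longleftrightarrow>
    (\<exists>H\<subseteq>G. (\<forall>g\<in>H. mdvd m (lm m ord g) (lm m ord f)) \<and>
      lc m ord f \<in> left_ideal_gen
        {sigma \<alpha> (lc m ord g) \<otimes> struct_const \<alpha> (vexp m (lm m ord g)) | \<alpha> g.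
          g \<in> H \<and> \<alpha> \<in> exponents n \<and>
          exp_add \<alpha> (vexp m (lm m ord g)) = vexp m (lm m ord f)})"

definition groebner_basis ::
    "nat \<Rightarrow> ((nat \<Rightarrow> 'a) \<times> (nat \<Rightarrow> 'a)) set \<Rightarrow> (nat \<Rightarrow> 'a) set \<Rightarrow> (nat \<Rightarrow> 'a) set \<Rightarrow> bool"
  where "groebner_basis m ord M G \<longleftrightarrow>
    monomial_order m ord \<and>
    submodule M A (free_module A m) \<and> M \<noteq> {\<zero>\<^bsub>free_module A m\<^esub>} \<and>
    finite G \<and> G \<noteq> {} \<and> G \<subseteq> M - {\<zero>\<^bsub>free_module A m\<^esub>} \<and>
    (\<forall>f\<in>M - {\<zero>\<^bsub>free_module A m\<^esub>}. reducible m ord G f)"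


subsection \<open>The filtration and the associated graded ring\<close>

definition Fil :: "int \<Rightarrow> 'a set"
  where "Fil p = (if p < 0 then {\<zero>} else if p = 0 then R
    else {f \<in> carrier A. f = \<zero> \<or> int (deg f) \<le> p})"

text \<open>An element of the direct sum of the \<open>Fil p / Fil (p - 1)\<close> is the sequence of its
  homogeneous components, which are cosets. The product of two sequences is formed with all
  representatives, as in \<^const>\<open>rcoset_mult\<close>.\<close>

definition Gr :: "(nat \<Rightarrow> 'a set) ring"
  where "Gr =
    \<lparr>carrier = {u. (\<forall>p. \<exists>f\<in>Fil (int p). u p = Fil (int p - 1) +> f) \<and>
                   finite {p. u p \<noteq> Fil (int p - 1)}},
     mult = (\<lambda>u v k. \<Union>f\<in>{f. \<forall>p. f p \<in> u p}. \<Union>g\<in>{g. \<forall>p. g p \<in> v p}.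
               Fil (int k - 1) +> (\<Oplus>p\<in>{..k}. f p \<otimes> g (k - p))),
     one = (\<lambda>p. if p = 0 then Fil (- 1) +> \<one> else Fil (int p - 1)),
     zero = (\<lambda>p. Fil (int p - 1)),
     add = (\<lambda>u v p. u p <+> v p)\<rparr>"

text \<open>The image of \<open>f \<in> Fil p\<close> in the homogeneous component of degree \<open>p\<close>.\<close>

definition gr_class :: "nat \<Rightarrow> 'a \<Rightarrow> nat \<Rightarrow> 'a set"
  where "gr_class p f = (\<lambda>q. if q = p then Fil (int p - 1) +> f else Fil (int q - 1))"

definition eta :: "'a \<Rightarrow> nat \<Rightarrow> 'a set"
  where "eta f = gr_class (deg f) f"

text \<open>\<open>R\<close> as a subring of \<open>Gr\<close>, through \<open>R = Fil 0 / Fil (-1)\<close>.\<close>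

definition gr_base :: "(nat \<Rightarrow> 'a set) set"
  where "gr_base = gr_class 0 ` R"

definition gr_vars :: "nat \<Rightarrow> nat \<Rightarrow> 'a set"
  where "gr_vars i = eta (x i)"


subsection \<open>The associated graded module\<close>

definition vFil :: "nat \<Rightarrow> (nat \<Rightarrow> 'a) set \<Rightarrow> int \<Rightarrow> (nat \<Rightarrow> 'a) set"
  where "vFil m M p = (if p < 0 then {\<zero>\<^bsub>free_module A m\<^esub>}
    else {f \<in> M. f = \<zero>\<^bsub>free_module A m\<^esub> \<or> int (vdeg m f) \<le> p})"

definition gr_sequences :: "nat \<Rightarrow> (nat \<Rightarrow> 'a) set \<Rightarrow> (nat \<Rightarrow> (nat \<Rightarrow> 'a) set) set"
  where "gr_sequences m M =
    {u. (\<forall>p. \<exists>f\<in>vFil m M (int p). u p = vFil m M (int p - 1) +>\<^bsub>free_module A m\<^esub> f) \<and>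
        finite {p. u p \<noteq> vFil m M (int p - 1)}}"

text \<open>The identification of \<open>Gr M\<close>, a direct sum of quotients of the \<open>F\<^sub>p(M)\<close>, with a submodule of
  \<open>Gr(A)\<^sup>m\<close>: the class of a vector \<open>f\<close> modulo \<open>F\<^bsub>p-1\<^esub>(M)\<close> is sent to the vector of the classes
  of the entries of \<open>f\<close> modulo \<open>F\<^bsub>p-1\<^esub>(A)\<close>.\<close>

definition gr_embed :: "nat \<Rightarrow> (nat \<Rightarrow> (nat \<Rightarrow> 'a) set) \<Rightarrow> nat \<Rightarrow> nat \<Rightarrow> 'a set"
  where "gr_embed m u = (\<lambda>i\<in>{..<m}. \<lambda>p. (\<lambda>f. f i) ` u p <+> Fil (int p - 1))"

definition GrM :: "nat \<Rightarrow> (nat \<Rightarrow> 'a) set \<Rightarrow> (nat \<Rightarrow> nat \<Rightarrow> 'a set) set"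
  where "GrM m M = gr_embed m ` gr_sequences m M"

definition veta :: "nat \<Rightarrow> (nat \<Rightarrow> 'a) set \<Rightarrow> (nat \<Rightarrow> 'a) \<Rightarrow> nat \<Rightarrow> nat \<Rightarrow> 'a set"
  where "veta m M f = gr_embed m (\<lambda>q. if q = vdeg m f
    then vFil m M (int q - 1) +>\<^bsub>free_module A m\<^esub> f else vFil m M (int q - 1))"

definition homogeneous :: "nat \<Rightarrow> (nat \<Rightarrow> nat \<Rightarrow> 'a set) \<Rightarrow> bool"
  where "homogeneous m u \<longleftrightarrow> (\<exists>p. \<forall>i<m. \<forall>q. q \<noteq> p \<longrightarrow> u i q = Fil (int q - 1))"

text \<open>The order with \<open>\<eta>(X) \<ge> \<eta>(Y)\<close> if and only if \<open>X \<ge> Y\<close>, for monomials \<open>X\<close>, \<open>Y\<close>.\<close>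

definition gr_order :: "nat \<Rightarrow> ((nat \<Rightarrow> 'a) \<times> (nat \<Rightarrow> 'a)) set \<Rightarrow>
    ((nat \<Rightarrow> nat \<Rightarrow> 'a set) \<times> (nat \<Rightarrow> nat \<Rightarrow> 'a set)) set"
  where "gr_order m ord =
    {(veta m (carrier (free_module A m)) Y, veta m (carrier (free_module A m)) X) | X Y.
      X \<in> Mon m \<and> Y \<in> Mon m \<and> (Y, X) \<in> ord}"

text \<open>\<^const>\<open>groebner_basis\<close> for \<open>Gr\<close>, viewed as an extension of \<open>R\<close> in the
  variables \<open>\<eta>(x\<^sub>i)\<close>.\<close>

abbreviation gr_groebner_basis :: "nat \<Rightarrow>
    ((nat \<Rightarrow> nat \<Rightarrow> 'a set) \<times> (nat \<Rightarrow> nat \<Rightarrow> 'a set)) set \<Rightarrow>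
    (nat \<Rightarrow> nat \<Rightarrow> 'a set) set \<Rightarrow> (nat \<Rightarrow> nat \<Rightarrow> 'a set) set \<Rightarrow> bool"
  where "gr_groebner_basis \<equiv> pbw_data.groebner_basis Gr gr_base n gr_vars"

end


section \<open>Skew PBW extensions\<close>

locale skew_PBW_extension = pbw_data A R n x + ring A
  for A :: "('a, 'b) ring_scheme" (structure) and R n x +
  assumes base_subring: "subring R A"
    and vars_closed: "i < n \<Longrightarrow> x i \<in> carrier A"
    and free_basis: "free_left_basis"
    and var_scalar: "\<lbrakk>i < n; r \<in> R - {\<zero>}\<rbrakk> \<Longrightarrow>
      \<exists>c\<in>R - {\<zero>}. x i \<otimes> r \<ominus> c \<otimes> x i \<in> R"
    and var_var: "\<lbrakk>i < n; j < n\<rbrakk> \<Longrightarrow>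
      \<exists>c\<in>R - {\<zero>}. x j \<otimes> x i \<ominus> c \<otimes> (x i \<otimes> x j) \<in> affine_span"

end

theory Submission
  imports Defs "HOL-Algebra.UnivPoly"
begin

text \<open>
  Both notions of reducibility only see leading data, so the theorem reduces to comparing leading data
  in \<open>A\<^sup>m\<close> and in \<open>Gr(A)\<^sup>m\<close>. Since the order refines the degree, the leading monomial of a vector
  \<open>f\<close> lies in its top-degree part, so passing from \<open>f\<close> to \<open>\<eta>(f)\<close> keeps the leading exponent and
  position and replaces the leading coefficient by its image under the isomorphism
  \<open>R \<cong> F\<^sub>0/F\<^bsub>-1\<^esub>\<close>. Conversely, a nonzero, not necessarily homogeneous, element of \<open>Gr(M)\<close>
  has the same leading data as \<open>\<eta>(f)\<close>, where \<open>f \<in> M\<close> represents the component in which its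
  leading monomial lies. The isomorphism also carries \<open>\<sigma>\<^sup>\<alpha>\<close> and \<open>c\<^bsub>\<alpha>,\<beta>\<^esub>\<close> of \<open>A\<close> to those of
  \<open>Gr(A)\<close>, because both are top coefficients: of \<open>x\<^sup>\<alpha> r\<close> and of \<open>x\<^sup>\<alpha> x\<^sup>\<beta>\<close> respectively.
\<close>


section \<open>Coefficients and the filtration\<close>

context skew_PBW_extension
begin

text \<open>Parts (i) and (ii) are the two halves of one equivalence: for a finite
  \<open>G \<subseteq> M\<close>, the set \<open>G\<close> is a Groebner basis of \<open>M\<close>
  exactly when its image under \<open>veta m M\<close> is one of \<open>GrM m M\<close>.

  Two obstacles shape the proof. Statements about top coefficients rest on the filtration being
  multiplicative, but the axioms only tell how one variable passes a scalar or another variable;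
  whole monomials need an induction on degree. Moreover, \<open>Gr\<close> consists of sequences of
  cosets, multiplied through all representatives. Its ring laws are not checked on cosets but
  inherited from the Rees ring, a subring of the polynomials over \<open>A\<close> of which
  \<open>Gr\<close> is a homomorphic image. Once \<open>Gr\<close> is known to be a skew PBW
  extension of \<open>gr_base\<close>, the lemmas on coefficients and leading monomials can be used
  a second time, for \<open>Gr\<close>. Leading data are compared through pairs of an exponent and a
  position, which mean the same on both sides, whereas the monomial vectors have different
  types.\<close>

lemma base_carrier [simp]: "r \<in> R \<Longrightarrow> r \<in> carrier A"
  using subringE(1)[OF base_subring] by auto

lemma zero_base [simp]: "\<zero> \<in> R"
  using subringE(2)[OF base_subring] .

lemma one_base [simp]: "\<one> \<in> R"
  using subringE(3)[OF base_subring] .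

lemma uminus_base [simp]: "r \<in> R \<Longrightarrow> \<ominus> r \<in> R"
  using subringE(5)[OF base_subring] .

lemma mult_base [simp]: "r \<in> R \<Longrightarrow> s \<in> R \<Longrightarrow> r \<otimes> s \<in> R"
  using subringE(6)[OF base_subring] .

lemma add_base [simp]: "r \<in> R \<Longrightarrow> s \<in> R \<Longrightarrow> r \<oplus> s \<in> R"
  using subringE(7)[OF base_subring] .

lemma foldr_vars_closed:
  "set is \<subseteq> {..<n} \<Longrightarrow> foldr (\<lambda>i b. (x i [^] (\<alpha> i :: nat)) \<otimes> b) is \<one> \<in> carrier A"
  by (induction "is") (auto intro: vars_closed)

lemma mon_closed [simp]: "mon \<alpha> \<in> carrier A"
  unfolding mon_def by (rule foldr_vars_closed) auto

section \<open>Linear combinations of monomials and coordinates in the left basis\<close>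

lemma coeff_familiesI:
  assumes "\<And>\<alpha>. c \<alpha> \<in> R" "\<And>\<alpha>. \<alpha> \<notin> exponents n \<Longrightarrow> c \<alpha> = \<zero>" "finite {\<alpha>. c \<alpha> \<noteq> \<zero>}"
  shows "c \<in> coeff_families"
  using assms unfolding coeff_families_def by blast

lemma coeff_familiesD:
  assumes "c \<in> coeff_families"
  shows "c \<alpha> \<in> R" "\<alpha> \<notin> exponents n \<Longrightarrow> c \<alpha> = \<zero>" "finite {\<alpha>. c \<alpha> \<noteq> \<zero>}"
  using assms unfolding coeff_families_def by blast+

text \<open>Extra indices contribute \<open>\<zero>\<close>. The definition sums over the exact
  support, which changes under addition and scaling; padding to a common finite set lets such sums
  be compared term by term.\<close>

lemma lincomb_superset:
  assumes c: "c \<in> coeff_families" and S: "finite S" "{\<alpha>. c \<alpha> \<noteq> \<zero>} \<subseteq> S"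
  shows "lincomb c = (\<Oplus>\<alpha>\<in>S. c \<alpha> \<otimes> mon \<alpha>)"
  unfolding lincomb_def
  using S coeff_familiesD(1)[OF c]
  by (intro add.finprod_mono_neutral_cong_left) auto

lemma lincomb_closed: "c \<in> coeff_families \<Longrightarrow> lincomb c \<in> carrier A"
  unfolding lincomb_def by (intro finsum_closed) (auto simp: coeff_familiesD(1))

lemma coeff_families_add:
  assumes "c \<in> coeff_families" "d \<in> coeff_families"
  shows "(\<lambda>\<alpha>. c \<alpha> \<oplus> d \<alpha>) \<in> coeff_families"
proof (rule coeff_familiesI)
  show "finite {\<alpha>. c \<alpha> \<oplus> d \<alpha> \<noteq> \<zero>}"
    by (rule finite_subset[of _ "{\<alpha>. c \<alpha> \<noteq> \<zero>} \<union> {\<alpha>. d \<alpha> \<noteq> \<zero>}"])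
      (use assms in \<open>auto dest: coeff_familiesD(3)\<close>)
qed (use assms in \<open>simp_all add: coeff_familiesD\<close>)

lemma lincomb_add:
  assumes c: "c \<in> coeff_families" and d: "d \<in> coeff_families"
  shows "lincomb (\<lambda>\<alpha>. c \<alpha> \<oplus> d \<alpha>) = lincomb c \<oplus> lincomb d"
proof -
  let ?S = "{\<alpha>. c \<alpha> \<noteq> \<zero>} \<union> {\<alpha>. d \<alpha> \<noteq> \<zero>}"
  have S: "finite ?S"
    using coeff_familiesD(3)[OF c] coeff_familiesD(3)[OF d] by simp
  have R: "c \<alpha> \<in> carrier A" "d \<alpha> \<in> carrier A" for \<alpha>
    using coeff_familiesD(1)[OF c] coeff_familiesD(1)[OF d] by auto
  have "lincomb (\<lambda>\<alpha>. c \<alpha> \<oplus> d \<alpha>) = (\<Oplus>\<alpha>\<in>?S. (c \<alpha> \<oplus> d \<alpha>) \<otimes> mon \<alpha>)"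
    by (rule lincomb_superset[OF coeff_families_add[OF c d] S]) auto
  also have "\<dots> = (\<Oplus>\<alpha>\<in>?S. c \<alpha> \<otimes> mon \<alpha> \<oplus> d \<alpha> \<otimes> mon \<alpha>)"
    by (rule finsum_cong') (auto simp: l_distr R)
  also have "\<dots> = (\<Oplus>\<alpha>\<in>?S. c \<alpha> \<otimes> mon \<alpha>) \<oplus> (\<Oplus>\<alpha>\<in>?S. d \<alpha> \<otimes> mon \<alpha>)"
    by (rule finsum_addf) (auto simp: R)
  also have "\<dots> = lincomb c \<oplus> lincomb d"
    using lincomb_superset[OF c S] lincomb_superset[OF d S] by auto
  finally show ?thesis .
qed

lemma coeff_families_smult:
  assumes "r \<in> R" "c \<in> coeff_families"
  shows "(\<lambda>\<alpha>. r \<otimes> c \<alpha>) \<in> coeff_families"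
proof (rule coeff_familiesI)
  show "finite {\<alpha>. r \<otimes> c \<alpha> \<noteq> \<zero>}"
    by (rule finite_subset[OF _ coeff_familiesD(3)[OF assms(2)]]) (use assms in auto)
qed (use assms in \<open>simp_all add: coeff_familiesD\<close>)

lemma lincomb_smult:
  assumes r: "r \<in> R" and c: "c \<in> coeff_families"
  shows "lincomb (\<lambda>\<alpha>. r \<otimes> c \<alpha>) = r \<otimes> lincomb c"
proof -
  have R: "c \<alpha> \<in> carrier A" for \<alpha>
    using coeff_familiesD(1)[OF c] by auto
  have "lincomb (\<lambda>\<alpha>. r \<otimes> c \<alpha>) = (\<Oplus>\<alpha>\<in>{\<alpha>. c \<alpha> \<noteq> \<zero>}. (r \<otimes> c \<alpha>) \<otimes> mon \<alpha>)"
    by (rule lincomb_superset[OF coeff_families_smult[OF r c] coeff_familiesD(3)[OF c]])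
      (use r in auto)
  also have "\<dots> = (\<Oplus>\<alpha>\<in>{\<alpha>. c \<alpha> \<noteq> \<zero>}. r \<otimes> (c \<alpha> \<otimes> mon \<alpha>))"
    by (rule finsum_cong') (auto simp: m_assoc R r)
  also have "\<dots> = r \<otimes> lincomb c"
    unfolding lincomb_def
    by (rule finsum_rdistr[symmetric]) (auto simp: R r coeff_familiesD(3)[OF c])
  finally show ?thesis .
qed

lemma coeff_unique:
  assumes "f \<in> carrier A"
  shows "coeff f \<in> coeff_families \<and> f = lincomb (coeff f)"
proof -
  have "\<exists>!c. c \<in> coeff_families \<and> f = lincomb c"
    using assms free_basis unfolding free_left_basis_def by blast
  then show ?thesis unfolding coeff_def by (rule theI')
qed

lemma coeff_lincomb:
  assumes "c \<in> coeff_families"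
  shows "coeff (lincomb c) = c"
proof -
  have "\<exists>!d. d \<in> coeff_families \<and> lincomb c = lincomb d"
    using lincomb_closed[OF assms] free_basis unfolding free_left_basis_def by blast
  then show ?thesis
    using assms coeff_unique[OF lincomb_closed[OF assms]] by blast
qed

lemma lincomb_coeff: "f \<in> carrier A \<Longrightarrow> lincomb (coeff f) = f"
  using coeff_unique by simp

lemma coeff_in_families [simp]: "f \<in> carrier A \<Longrightarrow> coeff f \<in> coeff_families"
  using coeff_unique by blast

lemma coeff_base [simp]: "f \<in> carrier A \<Longrightarrow> coeff f \<alpha> \<in> R"
  using coeff_familiesD(1) by simp

lemma coeff_carrier [simp]: "f \<in> carrier A \<Longrightarrow> coeff f \<alpha> \<in> carrier A"
  by simp

lemma coeff_outside: "f \<in> carrier A \<Longrightarrow> \<alpha> \<notin> exponents n \<Longrightarrow> coeff f \<alpha> = \<zero>"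
  using coeff_familiesD(2) by simp

lemma coeff_support_finite: "f \<in> carrier A \<Longrightarrow> finite {\<alpha>. coeff f \<alpha> \<noteq> \<zero>}"
  using coeff_familiesD(3) by simp

lemma coeff_add:
  "f \<in> carrier A \<Longrightarrow> g \<in> carrier A \<Longrightarrow> coeff (f \<oplus> g) \<alpha> = coeff f \<alpha> \<oplus> coeff g \<alpha>"
  using coeff_lincomb[OF coeff_families_add, of "coeff f" "coeff g"]
  by (simp add: lincomb_add lincomb_coeff)

lemma coeff_smult: "r \<in> R \<Longrightarrow> f \<in> carrier A \<Longrightarrow> coeff (r \<otimes> f) \<alpha> = r \<otimes> coeff f \<alpha>"
  using coeff_lincomb[OF coeff_families_smult, of r "coeff f"]
  by (simp add: lincomb_smult lincomb_coeff)

lemma coeff_zero [simp]: "coeff \<zero> \<alpha> = \<zero>"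
  using coeff_smult[of \<zero> \<zero> \<alpha>] by simp

lemma coeff_uminus: "f \<in> carrier A \<Longrightarrow> coeff (\<ominus> f) \<alpha> = \<ominus> coeff f \<alpha>"
  using coeff_add[of "\<ominus> f" f \<alpha>] by (simp add: l_neg minus_equality)

lemma coeff_minus:
  "f \<in> carrier A \<Longrightarrow> g \<in> carrier A \<Longrightarrow> coeff (f \<ominus> g) \<alpha> = coeff f \<alpha> \<ominus> coeff g \<alpha>"
  by (simp add: a_minus_def coeff_add coeff_uminus)

lemma coeff_eqI:
  "f \<in> carrier A \<Longrightarrow> g \<in> carrier A \<Longrightarrow> (\<And>\<alpha>. coeff f \<alpha> = coeff g \<alpha>) \<Longrightarrow> f = g"
  using lincomb_coeff[of f] lincomb_coeff[of g] by presburger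

lemma coeff_nonzero: "f \<in> carrier A \<Longrightarrow> f \<noteq> \<zero> \<Longrightarrow> \<exists>\<alpha>. coeff f \<alpha> \<noteq> \<zero>"
  using coeff_eqI[of f \<zero>] by auto

lemma coeff_term:
  assumes r: "r \<in> R" and \<alpha>: "\<alpha> \<in> exponents n"
  shows "coeff (r \<otimes> mon \<alpha>) \<beta> = (if \<beta> = \<alpha> then r else \<zero>)"
proof -
  let ?c = "\<lambda>\<beta>. if \<beta> = \<alpha> then r else \<zero>"
  have "?c \<in> coeff_families"
    by (rule coeff_familiesI) (use r \<alpha> in auto)
  moreover from this have "lincomb ?c = (\<Oplus>\<beta>\<in>{\<alpha>}. ?c \<beta> \<otimes> mon \<beta>)"
    by (rule lincomb_superset) auto
  ultimately show ?thesis
    using coeff_lincomb[of ?c] r by simp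
qed

lemma coeff_mon:
  "\<alpha> \<in> exponents n \<Longrightarrow> coeff (mon \<alpha>) \<beta> = (if \<beta> = \<alpha> then \<one> else \<zero>)"
  using coeff_term[of \<one> \<alpha>] by simp

lemma mon_zero: "mon (\<lambda>_. 0) = \<one>"
proof -
  have "foldr (\<lambda>i b. (x i [^] (0 :: nat)) \<otimes> b) is \<one> = \<one>" for "is"
    by (induction "is") auto
  then show ?thesis unfolding mon_def .
qed

lemma zero_exponents [simp]: "(\<lambda>_. 0) \<in> exponents n"
  by (simp add: exponents_def)

lemma exp_add_exponents [simp]:
  "\<alpha> \<in> exponents n \<Longrightarrow> \<beta> \<in> exponents n \<Longrightarrow> exp_add \<alpha> \<beta> \<in> exponents n"
  by (simp add: exponents_def exp_add_def)

lemma coeff_scalar: "r \<in> R \<Longrightarrow> coeff r \<beta> = (if \<beta> = (\<lambda>_. 0) then r else \<zero>)"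
  using coeff_term[of r "\<lambda>_. 0"] by (simp add: mon_zero)

lemma exp_size_zero_iff: "\<alpha> \<in> exponents n \<Longrightarrow> exp_size n \<alpha> = 0 \<longleftrightarrow> \<alpha> = (\<lambda>_. 0)"
  unfolding exponents_def exp_size_def by (auto simp: fun_eq_iff) (metis lessThan_iff not_less)

section \<open>Coefficientwise description of the filtration\<close>

lemma deg_le_iff:
  assumes "f \<in> carrier A" "f \<noteq> \<zero>"
  shows "deg f \<le> k \<longleftrightarrow> (\<forall>\<alpha>. coeff f \<alpha> \<noteq> \<zero> \<longrightarrow> exp_size n \<alpha> \<le> k)"
  unfolding deg_def
  using coeff_support_finite[OF assms(1)] coeff_nonzero[OF assms] by (subst Max_le_iff) auto

text \<open>Replaces the three cases in the definition of \<open>Fil\<close>, and with them the junk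
  value of \<open>deg\<close> at \<open>\<zero>\<close>, by one condition on the support that is
  also right for \<open>p < 0\<close> and \<open>p = 0\<close>. Closure under sums, negation and
  left scalars then follows coefficient by coefficient.\<close>

lemma Fil_iff:
  "f \<in> Fil p \<longleftrightarrow> f \<in> carrier A \<and> (\<forall>\<alpha>. coeff f \<alpha> \<noteq> \<zero> \<longrightarrow> int (exp_size n \<alpha>) \<le> p)"
proof -
  consider "p < 0" | "p = 0" | "p > 0" by linarith
  then show ?thesis
  proof cases
    case 1
    then show ?thesis
      using coeff_nonzero[of f] by (cases "f = \<zero>") (auto simp: Fil_def intro!: exI)
  next
    case 2
    \<comment> \<open>Zero is the only exponent of size 0, so such an \<open>f\<close> has the same
      coefficients as its constant coefficient and equals it.\<close>
    have "f \<in> R" if f: "f \<in> carrier A" and c: "\<And>\<alpha>. coeff f \<alpha> \<noteq> \<zero> \<Longrightarrow> exp_size n \<alpha> = 0"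
    proof -
      have "coeff (coeff f (\<lambda>_. 0)) \<alpha> = coeff f \<alpha>" for \<alpha>
      proof (cases "\<alpha> = (\<lambda>_. 0)")
        case False
        then have "coeff f \<alpha> = \<zero>"
          using c exp_size_zero_iff coeff_outside[OF f] by metis
        then show ?thesis using False f by (simp add: coeff_scalar)
      qed (simp add: coeff_scalar f)
      then have "coeff f (\<lambda>_. 0) = f"
        by (rule coeff_eqI[OF coeff_carrier[OF f] f])
      then show ?thesis using coeff_base[OF f, of "\<lambda>_. 0"] by simp
    qed
    moreover have "exp_size n (\<lambda>_. 0) = 0"
      by (simp add: exp_size_def)
    ultimately show ?thesis
      using 2 unfolding Fil_def by (auto simp: coeff_scalar split: if_splits)
  next
    case 3
    then have "deg f \<le> nat p \<longleftrightarrow> (\<forall>\<alpha>. coeff f \<alpha> \<noteq> \<zero> \<longrightarrow> exp_size n \<alpha> \<le> nat p)"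
      if "f \<in> carrier A" "f \<noteq> \<zero>"
      using deg_le_iff[OF that] by blast
    then show ?thesis
      using 3 unfolding Fil_def by (cases "f = \<zero>") (auto simp: nat_le_iff le_nat_iff)
  qed
qed

text \<open>Translates the remainder condition in \<open>sigma\<close> and
  \<open>struct_const\<close> into the filtration. For \<open>k = 0\<close> both sides say
  \<open>f = \<zero>\<close>, since \<open>Fil (- 1)\<close> is zero.\<close>

lemma low_iff:
  assumes "f \<in> carrier A"
  shows "f = \<zero> \<or> deg f < k \<longleftrightarrow> f \<in> Fil (int k - 1)"
proof (cases "f = \<zero> \<or> k = 0")
  case True
  then show ?thesis using assms coeff_nonzero[OF assms] by (fastforce simp: Fil_iff)
next
  case False
  then have "deg f < k \<longleftrightarrow> deg f \<le> k - 1" by auto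
  also have "\<dots> \<longleftrightarrow> (\<forall>\<alpha>. coeff f \<alpha> \<noteq> \<zero> \<longrightarrow> exp_size n \<alpha> \<le> k - 1)"
    using deg_le_iff assms False by blast
  also have "\<dots> \<longleftrightarrow> f \<in> Fil (int k - 1)"
    using False assms by (simp add: Fil_iff)
      (metis One_nat_def Suc_pred int_ops(2) less_Suc_eq_le not_gr_zero
        of_nat_less_iff zle_diff1_eq of_nat_Suc)
  finally show ?thesis using False by simp
qed

lemma Fil_carrier: "f \<in> Fil p \<Longrightarrow> f \<in> carrier A"
  by (simp add: Fil_iff)

lemma Fil_mono: "f \<in> Fil p \<Longrightarrow> p \<le> q \<Longrightarrow> f \<in> Fil q"
  by (fastforce simp: Fil_iff)

lemma Fil_coeff_zero: "f \<in> Fil p \<Longrightarrow> p < int (exp_size n \<alpha>) \<Longrightarrow> coeff f \<alpha> = \<zero>"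
  by (fastforce simp: Fil_iff)

lemma zero_Fil [simp]: "\<zero> \<in> Fil p"
  by (simp add: Fil_iff)

lemma Fil_add: "f \<in> Fil p \<Longrightarrow> g \<in> Fil p \<Longrightarrow> f \<oplus> g \<in> Fil p"
  unfolding Fil_iff by (auto simp: coeff_add) (metis r_zero zero_closed)

lemma Fil_uminus: "f \<in> Fil p \<Longrightarrow> \<ominus> f \<in> Fil p"
  unfolding Fil_iff by (auto simp: coeff_uminus)

lemma Fil_smult: "r \<in> R \<Longrightarrow> f \<in> Fil p \<Longrightarrow> r \<otimes> f \<in> Fil p"
  unfolding Fil_iff by (auto simp: coeff_smult) (metis base_carrier r_null)

lemma Fil_finsum: "(\<And>i. i \<in> I \<Longrightarrow> f i \<in> Fil p) \<Longrightarrow> (\<Oplus>i\<in>I. f i) \<in> Fil p"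
proof (induction I rule: infinite_finite_induct)
  case (insert i I)
  then have "(\<Oplus>j\<in>insert i I. f j) = f i \<oplus> (\<Oplus>j\<in>I. f j)"
    using Fil_carrier by (intro finsum_insert) auto
  then show ?case using insert by (simp add: Fil_add)
qed simp_all

lemma term_Fil: "r \<in> R \<Longrightarrow> \<alpha> \<in> exponents n \<Longrightarrow> int (exp_size n \<alpha>) \<le> p \<Longrightarrow> r \<otimes> mon \<alpha> \<in> Fil p"
  by (simp add: Fil_iff coeff_term)

lemma mon_Fil: "\<alpha> \<in> exponents n \<Longrightarrow> int (exp_size n \<alpha>) \<le> p \<Longrightarrow> mon \<alpha> \<in> Fil p"
  using term_Fil[of \<one> \<alpha> p] by simp

lemma base_Fil: "r \<in> R \<Longrightarrow> 0 \<le> p \<Longrightarrow> r \<in> Fil p"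
  by (simp add: Fil_iff coeff_scalar exp_size_def)

lemma Fil_0 [simp]: "Fil 0 = R"
  by (simp add: Fil_def)

lemma Fil_neg [simp]: "p < 0 \<Longrightarrow> Fil p = {\<zero>}"
  by (simp add: Fil_def)

end


section \<open>Products of monomials\<close>

lemma exp_size_upd: "j < n \<Longrightarrow> exp_size n (\<beta>(j := Suc (\<beta> j))) = Suc (exp_size n \<beta>)"
proof -
  assume j: "j < n"
  have "(\<Sum>i<n. (\<beta>(j := Suc (\<beta> j))) i) = (\<Sum>i<n. \<beta> i + (if i = j then 1 else 0))"
    by (rule sum.cong) auto
  also have "\<dots> = (\<Sum>i<n. \<beta> i) + 1"
    using j by (simp add: sum.distrib)
  finally show ?thesis by (simp add: exp_size_def)
qed

lemma exp_size_add: "exp_size n (exp_add \<alpha> \<beta>) = exp_size n \<alpha> + exp_size n \<beta>"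
  by (simp add: exp_size_def exp_add_def sum.distrib)

lemma exponents_upd: "\<beta> \<in> exponents n \<Longrightarrow> j < n \<Longrightarrow> \<beta>(j := k) \<in> exponents n"
  by (simp add: exponents_def)

text \<open>\<open>j\<close> is the least index with nonzero exponent, so the variable split off
  stands leftmost in the monomial. The bound \<open>j \<le> i\<close> places it no later than a
  given nonzero position.\<close>

lemma exponents_split:
  assumes \<beta>: "\<beta> \<in> exponents n" and i: "\<beta> i \<noteq> 0"
  obtains j \<gamma> where "j < n" "j \<le> i" "\<gamma> \<in> exponents n" "\<forall>k<j. \<gamma> k = 0" "\<beta> = \<gamma>(j := Suc (\<gamma> j))"
proof -
  define j where "j = (LEAST k. \<beta> k \<noteq> 0)"
  have j: "\<beta> j \<noteq> 0" "\<forall>k<j. \<beta> k = 0" "j \<le> i"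
    unfolding j_def
    using LeastI[of "\<lambda>k. \<beta> k \<noteq> 0", OF i] not_less_Least[of _ "\<lambda>k. \<beta> k \<noteq> 0"]
      Least_le[of "\<lambda>k. \<beta> k \<noteq> 0", OF i] by blast+
  have "j < n"
    using j(1) \<beta> leI[of j n] unfolding exponents_def mem_Collect_eq by metis
  show thesis
  proof (rule that[of j "\<beta>(j := \<beta> j - 1)"])
    show "\<beta> = (\<beta>(j := \<beta> j - 1))(j := Suc ((\<beta>(j := \<beta> j - 1)) j))"
      using j(1) by auto
  qed (use j \<open>j < n\<close> \<beta> in \<open>auto simp: exponents_upd\<close>)
qed

text \<open>Builds a monomial by multiplying on the left with a variable that may stand first, so
  that each step is an exact product, by \<open>var_mon_first\<close>, instead of one up to lower
  terms.\<close>

lemma exponents_induct [consumes 1, case_names zero step]: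
  assumes "\<beta> \<in> exponents n"
    and zero: "P (\<lambda>_. 0)"
    and step: "\<And>j \<gamma>. \<lbrakk>j < n; \<gamma> \<in> exponents n; \<forall>k<j. \<gamma> k = 0; P \<gamma>\<rbrakk> \<Longrightarrow> P (\<gamma>(j := Suc (\<gamma> j)))"
  shows "P \<beta>"
  using assms(1)
proof (induction "exp_size n \<beta>" arbitrary: \<beta> rule: less_induct)
  case less
  show ?case
  proof (cases "\<exists>i. \<beta> i \<noteq> 0")
    case True
    then obtain j \<gamma> where "j < n" "\<gamma> \<in> exponents n" "\<forall>k<j. \<gamma> k = 0" "\<beta> = \<gamma>(j := Suc (\<gamma> j))"
      using exponents_split[OF less.prems] by metis
    then show ?thesis
      using less.hyps[of \<gamma>] step by (simp add: exp_size_upd)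
  next
    case False
    then have "\<beta> = (\<lambda>_. 0)" by auto
    then show ?thesis using zero by simp
  qed
qed

context skew_PBW_extension
begin

text \<open>An element of \<open>Fil p\<close> is the finite sum of its terms, each again in
  \<open>Fil p\<close>, so additive statements need only be checked on scalar multiples of monomials
  of size at most \<open>p\<close>.\<close>

lemma Fil_induct [consumes 1, case_names zero add scaled]:
  assumes f: "f \<in> Fil p"
    and zero: "P \<zero>"
    and add: "\<And>f g. \<lbrakk>f \<in> carrier A; g \<in> carrier A; P f; P g\<rbrakk> \<Longrightarrow> P (f \<oplus> g)"
    and scaled: "\<And>r \<alpha>. \<lbrakk>r \<in> R; \<alpha> \<in> exponents n; int (exp_size n \<alpha>) \<le> p\<rbrakk> \<Longrightarrow> P (r \<otimes> mon \<alpha>)"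
  shows "P f"
proof -
  have fA: "f \<in> carrier A" using f by (rule Fil_carrier)
  have "P (\<Oplus>\<alpha>\<in>S. coeff f \<alpha> \<otimes> mon \<alpha>)" if "finite S" "S \<subseteq> {\<alpha>. coeff f \<alpha> \<noteq> \<zero>}" for S
    using that
  proof (induction S rule: finite_induct)
    case (insert \<alpha> S)
    have "P (coeff f \<alpha> \<otimes> mon \<alpha>)"
      using insert.prems f fA coeff_outside[OF fA, of \<alpha>]
      by (intro scaled) (auto simp: Fil_iff)
    moreover have "P (\<Oplus>\<alpha>\<in>S. coeff f \<alpha> \<otimes> mon \<alpha>)"
      using insert by simp
    ultimately have "P (coeff f \<alpha> \<otimes> mon \<alpha> \<oplus> (\<Oplus>\<alpha>\<in>S. coeff f \<alpha> \<otimes> mon \<alpha>))"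
      using fA by (intro add finsum_closed) auto
    then show ?case
      using insert.hyps fA by (subst finsum_insert) auto
  qed (simp add: zero)
  from this[OF coeff_support_finite[OF fA] subset_refl] show ?thesis
    using lincomb_coeff[OF fA] unfolding lincomb_def by simp
qed

lemma foldr_skip:
  "\<lbrakk>\<And>i. i \<in> set is \<Longrightarrow> i < n \<and> \<gamma> i = 0; b \<in> carrier A\<rbrakk>
    \<Longrightarrow> foldr (\<lambda>i b. (x i [^] (\<gamma> i :: nat)) \<otimes> b) is b = b"
  by (induction "is") auto

text \<open>No variable before \<open>x j\<close> occurs, so the product is already in normal order:
  the factors before \<open>j\<close> are \<open>\<one>\<close>, and \<open>x j\<close> merges with
  its own power.\<close>

lemma var_mon_first:
  assumes j: "j < n" and \<gamma>: "\<forall>k<j. \<gamma> k = 0"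
  shows "x j \<otimes> mon \<gamma> = mon (\<gamma>(j := Suc (\<gamma> j)))"
proof -
  have split: "[0..<n] = [0..<j] @ j # [Suc j..<n]"
    using j by (metis le0 less_imp_le upt_add_eq_append upt_conv_Cons le_add_diff_inverse)
  define b where "b = foldr (\<lambda>i b. (x i [^] \<gamma> i) \<otimes> b) [Suc j..<n] \<one>"
  have b: "b \<in> carrier A" "x j \<in> carrier A"
    unfolding b_def by (rule foldr_vars_closed) (auto intro: vars_closed j)
  have b': "foldr (\<lambda>i b. (x i [^] (\<gamma>(j := Suc (\<gamma> j))) i) \<otimes> b) [Suc j..<n] \<one> = b"
    unfolding b_def by (rule foldr_cong) auto
  have "mon \<gamma> = x j [^] \<gamma> j \<otimes> b"
  proof -
    have "mon \<gamma> = foldr (\<lambda>i b. (x i [^] \<gamma> i) \<otimes> b) [0..<j] (x j [^] \<gamma> j \<otimes> b)"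
      unfolding mon_def split foldr_append foldr_Cons o_def b_def by simp
    also have "\<dots> = x j [^] \<gamma> j \<otimes> b"
      using b \<gamma> j by (intro foldr_skip) auto
    finally show ?thesis .
  qed
  moreover have "mon (\<gamma>(j := Suc (\<gamma> j))) = x j [^] Suc (\<gamma> j) \<otimes> b"
  proof -
    have "mon (\<gamma>(j := Suc (\<gamma> j))) =
        foldr (\<lambda>i b. (x i [^] (\<gamma>(j := Suc (\<gamma> j))) i) \<otimes> b) [0..<j] (x j [^] Suc (\<gamma> j) \<otimes> b)"
      unfolding mon_def split foldr_append foldr_Cons o_def b' by simp
    also have "\<dots> = x j [^] Suc (\<gamma> j) \<otimes> b"
      using b \<gamma> j by (intro foldr_skip) auto
    finally show ?thesis .
  qed
  moreover have "x j [^] Suc (\<gamma> j) = x j \<otimes> x j [^] \<gamma> j"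
    using b by (metis nat_pow_Suc2)
  ultimately show ?thesis
    using b by (metis m_assoc nat_pow_closed)
qed

section \<open>Moving a variable past scalars and monomials\<close>

lemma add_minus_cancel: "a \<in> carrier A \<Longrightarrow> b \<in> carrier A \<Longrightarrow> b \<oplus> (a \<ominus> b) = a"
  by (simp add: a_minus_def a_lcomm[of b a] r_neg)

text \<open>Solved form of the commutation rule, extended to \<open>r = \<zero>\<close> by
  \<open>c = d = \<zero>\<close>, so that coefficients arising in an induction need not be known to
  be nonzero.\<close>

lemma var_scalarE:
  assumes "i < n" "r \<in> R"
  obtains c d where "c \<in> R" "d \<in> R" "x i \<otimes> r = c \<otimes> x i \<oplus> d" "r \<noteq> \<zero> \<longrightarrow> c \<noteq> \<zero>"
proof (cases "r = \<zero>")
  case True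
  then show ?thesis
    using that[of \<zero> \<zero>] assms vars_closed by simp
next
  case False
  then obtain c where c: "c \<in> R" "c \<noteq> \<zero>" "x i \<otimes> r \<ominus> c \<otimes> x i \<in> R"
    using var_scalar[of i r] assms by auto
  have "x i \<otimes> r = c \<otimes> x i \<oplus> (x i \<otimes> r \<ominus> c \<otimes> x i)"
    using c(1) assms vars_closed[OF assms(1)] by (simp add: add_minus_cancel)
  then show ?thesis using that[OF c(1,3)] c(2) by simp
qed

lemma var_varE:
  assumes "i < n" "j < n"
  obtains c r s where "c \<in> R" "r \<in> R" "s \<in> {..<n} \<rightarrow> R"
    "x j \<otimes> x i = c \<otimes> (x i \<otimes> x j) \<oplus> (r \<oplus> (\<Oplus>k\<in>{..<n}. s k \<otimes> x k))"
proof -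
  obtain c where c: "c \<in> R" "x j \<otimes> x i \<ominus> c \<otimes> (x i \<otimes> x j) \<in> affine_span"
    using var_var[OF assms] by auto
  then obtain r s where rs: "r \<in> R" "s \<in> {..<n} \<rightarrow> R"
      "x j \<otimes> x i \<ominus> c \<otimes> (x i \<otimes> x j) = r \<oplus> (\<Oplus>k\<in>{..<n}. s k \<otimes> x k)"
    unfolding affine_span_def by auto
  have "x j \<otimes> x i = c \<otimes> (x i \<otimes> x j) \<oplus> (x j \<otimes> x i \<ominus> c \<otimes> (x i \<otimes> x j))"
    using c(1) vars_closed[OF assms(1)] vars_closed[OF assms(2)]
    by (simp add: add_minus_cancel)
  then show ?thesis using that[OF c(1) rs(1,2)] rs(3) by simp
qed

text \<open>Conditional on monomials up to size \<open>p\<close>, because it is first needed inside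
  the degree induction of \<open>var_mon\<close>, where only those are available. In a term,
  \<open>x i\<close> passes the scalar \<open>r\<close> and leaves \<open>c \<otimes> x i\<close>
  and a scalar \<open>d\<close>; both raise the degree by at most one.\<close>

lemma var_Fil_if:
  assumes mon: "\<And>\<beta>. \<lbrakk>\<beta> \<in> exponents n; int (exp_size n \<beta>) \<le> p\<rbrakk>
      \<Longrightarrow> x i \<otimes> mon \<beta> \<in> Fil (int (exp_size n \<beta>) + 1)"
    and i: "i < n" and f: "f \<in> Fil p"
  shows "x i \<otimes> f \<in> Fil (p + 1)"
  using f
proof (induction rule: Fil_induct)
  case zero
  then show ?case using vars_closed[OF i] by simp
next
  case (add f g)
  then show ?case using vars_closed[OF i] by (simp add: r_distr Fil_add)
next
  case (scaled r \<alpha>)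
  from i \<open>r \<in> R\<close> obtain c d where cd: "c \<in> R" "d \<in> R" "x i \<otimes> r = c \<otimes> x i \<oplus> d"
    by (rule var_scalarE)
  have "x i \<otimes> (r \<otimes> mon \<alpha>) = (x i \<otimes> r) \<otimes> mon \<alpha>"
    using vars_closed[OF i] scaled by (simp add: m_assoc)
  also have "\<dots> = c \<otimes> (x i \<otimes> mon \<alpha>) \<oplus> d \<otimes> mon \<alpha>"
    using vars_closed[OF i] cd by (simp add: m_assoc l_distr)
  also have "\<dots> \<in> Fil (p + 1)"
    using cd scaled Fil_mono[OF mon[of \<alpha>], of "p + 1"] by (simp add: Fil_add Fil_smult mon_Fil)
  finally show ?case .
qed

text \<open>If \<open>x i\<close> may stand first, the product is exact. Otherwise
  \<open>x i\<close> is exchanged with the leading variable \<open>x j\<close> of the monomial; the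
  induction hypothesis treats \<open>x i \<otimes> mon \<gamma>\<close>, after which
  \<open>x j\<close> can stand first again. All other terms have size at most that of
  \<open>\<beta>\<close>, one below the top.\<close>

lemma var_mon:
  assumes "\<beta> \<in> exponents n" "i < n"
  shows "\<exists>c\<in>R. \<exists>p\<in>Fil (int (exp_size n \<beta>)). x i \<otimes> mon \<beta> = c \<otimes> mon (\<beta>(i := Suc (\<beta> i))) \<oplus> p"
  using assms
proof (induction "exp_size n \<beta>" arbitrary: \<beta> i rule: less_induct)
  case less
  note \<beta> = less.prems(1) and i = less.prems(2)
  show ?case
  proof (cases "\<forall>k<i. \<beta> k = 0")
    case True
    then have "x i \<otimes> mon \<beta> = \<one> \<otimes> mon (\<beta>(i := Suc (\<beta> i))) \<oplus> \<zero>"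
      using var_mon_first[OF i] by simp
    then show ?thesis by (meson one_base zero_Fil)
  next
    case False
    then obtain l where l: "l < i" "\<beta> l \<noteq> 0" by auto
    obtain j \<gamma> where j: "j < n" "j \<le> l" and \<gamma>: "\<gamma> \<in> exponents n" "\<forall>k<j. \<gamma> k = 0"
        and \<beta>_eq: "\<beta> = \<gamma>(j := Suc (\<gamma> j))"
      using exponents_split[OF \<beta> l(2)] .
    have ji: "j < i" using j(2) l(1) by simp
    have size: "exp_size n \<beta> = Suc (exp_size n \<gamma>)"
      using \<beta>_eq exp_size_upd[OF j(1)] by simp
    \<comment> \<open>Multiplication by a variable raises the degree by at most one; so far this is
      known only for monomials no larger than \<open>\<gamma>\<close>, which the induction
      hypothesis covers.\<close>
    have var_Fil: "x k \<otimes> mon \<alpha> \<in> Fil (int (exp_size n \<alpha>) + 1)"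
      if k: "\<alpha> \<in> exponents n" "int (exp_size n \<alpha>) \<le> int (exp_size n \<gamma>)" "k < n" for k \<alpha>
    proof -
      obtain c p where c: "c \<in> R" "p \<in> Fil (int (exp_size n \<alpha>))"
          "x k \<otimes> mon \<alpha> = c \<otimes> mon (\<alpha>(k := Suc (\<alpha> k))) \<oplus> p"
        using less.hyps[of \<alpha> k, OF _ k(1,3)] k(2) size by auto
      then show ?thesis
        using k by (auto intro!: Fil_add term_Fil exponents_upd simp: exp_size_upd elim: Fil_mono)
    qed
    let ?\<delta> = "\<gamma>(i := Suc (\<gamma> i))"
    obtain c1 p where c1: "c1 \<in> R" "p \<in> Fil (int (exp_size n \<gamma>))"
        "x i \<otimes> mon \<gamma> = c1 \<otimes> mon ?\<delta> \<oplus> p"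
      using less.hyps[of \<gamma> i] \<gamma> i size by auto
    obtain c2 r s where c2: "c2 \<in> R" "r \<in> R" "s \<in> {..<n} \<rightarrow> R"
        "x i \<otimes> x j = c2 \<otimes> (x j \<otimes> x i) \<oplus> (r \<oplus> (\<Oplus>k\<in>{..<n}. s k \<otimes> x k))"
      using j(1) i by (rule var_varE)
    obtain c3 d where c3: "c3 \<in> R" "d \<in> R" "x j \<otimes> c1 = c3 \<otimes> x j \<oplus> d"
      using j(1) c1(1) by (rule var_scalarE)
    have X: "x i \<in> carrier A" "x j \<in> carrier A"
      using vars_closed i j by auto
    have pA: "p \<in> carrier A" using c1(2) by (rule Fil_carrier)
    have sX: "(\<lambda>k. s k \<otimes> x k) \<in> {..<n} \<rightarrow> carrier A"
      using c2(3) vars_closed by (simp add: Pi_iff)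
    have \<delta>: "?\<delta> \<in> exponents n" "exp_size n ?\<delta> = exp_size n \<beta>"
      using \<gamma> i size exp_size_upd[OF i] by (auto intro: exponents_upd)
    \<comment> \<open>\<open>?\<delta>\<close> raises \<open>\<gamma>\<close> only at
      \<open>i > j\<close>, so it still vanishes below \<open>j\<close> and \<open>x j\<close> goes
      in front exactly.\<close>
    have "x j \<otimes> mon ?\<delta> = mon (?\<delta>(j := Suc (?\<delta> j)))"
      using \<gamma>(2) ji by (intro var_mon_first[OF j(1)]) auto
    also have "?\<delta>(j := Suc (?\<delta> j)) = \<beta>(i := Suc (\<beta> i))"
      using ji \<beta>_eq by auto
    finally have top: "x j \<otimes> mon ?\<delta> = mon (\<beta>(i := Suc (\<beta> i)))" .
    have xj: "x j \<otimes> (x i \<otimes> mon \<gamma>) = c3 \<otimes> mon (\<beta>(i := Suc (\<beta> i))) \<oplus> (d \<otimes> mon ?\<delta> \<oplus> x j \<otimes> p)"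
    proof -
      have "x j \<otimes> (x i \<otimes> mon \<gamma>) = (x j \<otimes> c1) \<otimes> mon ?\<delta> \<oplus> x j \<otimes> p"
        using c1 X pA by (simp add: r_distr m_assoc)
      also have "\<dots> = c3 \<otimes> (x j \<otimes> mon ?\<delta>) \<oplus> d \<otimes> mon ?\<delta> \<oplus> x j \<otimes> p"
        unfolding c3(3) using c3(1,2) X pA by (simp add: l_distr m_assoc)
      finally show ?thesis
        using c3 X pA by (simp add: top a_assoc)
    qed
    \<comment> \<open>\<open>w\<close> is the product of the linear part of the relation for
      \<open>x i \<otimes> x j\<close> with \<open>mon \<gamma>\<close>. It reaches at most one more
      than the size of \<open>\<gamma>\<close>, which is the size of \<open>\<beta>\<close>.\<close>
    define w where "w = (\<Oplus>k\<in>{..<n}. s k \<otimes> x k \<otimes> mon \<gamma>)"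
    have "s k \<otimes> x k \<otimes> mon \<gamma> \<in> Fil (int (exp_size n \<gamma>) + 1)" if "k \<in> {..<n}" for k
    proof -
      have "s k \<otimes> (x k \<otimes> mon \<gamma>) \<in> Fil (int (exp_size n \<gamma>) + 1)"
        using that c2(3) \<gamma>(1) var_Fil[of \<gamma> k] by (simp add: Fil_smult Pi_iff)
      then show ?thesis using that c2(3) vars_closed by (simp add: m_assoc Pi_iff)
    qed
    then have w: "w \<in> Fil (int (exp_size n \<gamma>) + 1)"
      unfolding w_def by (rule Fil_finsum)
    have "x i \<otimes> mon \<beta> = (x i \<otimes> x j) \<otimes> mon \<gamma>"
      using X \<beta>_eq var_mon_first[OF j(1) \<gamma>(2)] by (simp add: m_assoc)
    also have "\<dots> = c2 \<otimes> (x j \<otimes> (x i \<otimes> mon \<gamma>)) \<oplus>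
        (r \<otimes> mon \<gamma> \<oplus> (\<Oplus>k\<in>{..<n}. s k \<otimes> x k) \<otimes> mon \<gamma>)"
      unfolding c2(4) using c2(1,2) X sX by (simp add: l_distr m_assoc)
    also have "(\<Oplus>k\<in>{..<n}. s k \<otimes> x k) \<otimes> mon \<gamma> = w"
      unfolding w_def using sX by (intro finsum_ldistr) auto
    also have "c2 \<otimes> (x j \<otimes> (x i \<otimes> mon \<gamma>)) = (c2 \<otimes> c3) \<otimes> mon (\<beta>(i := Suc (\<beta> i))) \<oplus>
        c2 \<otimes> (d \<otimes> mon ?\<delta> \<oplus> x j \<otimes> p)"
      unfolding xj using c2(1) c3(1,2) X pA by (simp add: r_distr m_assoc)
    finally have eq: "x i \<otimes> mon \<beta> = (c2 \<otimes> c3) \<otimes> mon (\<beta>(i := Suc (\<beta> i))) \<oplus>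
        (c2 \<otimes> (d \<otimes> mon ?\<delta> \<oplus> x j \<otimes> p) \<oplus>
          (r \<otimes> mon \<gamma> \<oplus> w))" (is "_ = _ \<oplus> ?q")
      using c2(1,2) c3(1,2) X pA Fil_carrier[OF w] by (simp add: a_assoc)
    have N: "int (exp_size n \<gamma>) + 1 = int (exp_size n \<beta>)"
      by (simp add: size)
    have "x j \<otimes> p \<in> Fil (int (exp_size n \<beta>))"
      using var_Fil_if[of "int (exp_size n \<gamma>)" j p] var_Fil j(1) c1(2) unfolding N by blast
    moreover have "d \<otimes> mon ?\<delta> \<in> Fil (int (exp_size n \<beta>))" "r \<otimes> mon \<gamma> \<in> Fil (int (exp_size n \<beta>))"
      using \<delta> \<gamma>(1) size c2(2) c3(2) by (auto intro: term_Fil simp del: fun_upd_apply)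
    ultimately have "?q \<in> Fil (int (exp_size n \<beta>))"
      using c2(1) w unfolding N by (blast intro: Fil_add Fil_smult)
    then show ?thesis using eq c2(1) c3(1) by (meson mult_base)
  qed
qed

section \<open>Multiplicativity of the filtration and the top coefficients of products\<close>

lemma var_Fil: "i < n \<Longrightarrow> f \<in> Fil p \<Longrightarrow> x i \<otimes> f \<in> Fil (p + 1)"
proof (rule var_Fil_if)
  fix \<beta> assume "i < n" and \<beta>: "\<beta> \<in> exponents n"
  then obtain c q where "c \<in> R" "q \<in> Fil (int (exp_size n \<beta>))"
      "x i \<otimes> mon \<beta> = c \<otimes> mon (\<beta>(i := Suc (\<beta> i))) \<oplus> q"
    using var_mon by metis
  then show "x i \<otimes> mon \<beta> \<in> Fil (int (exp_size n \<beta>) + 1)"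
    using \<beta> \<open>i < n\<close>
    by (auto intro!: Fil_add term_Fil exponents_upd simp: exp_size_upd elim: Fil_mono)
qed

lemma mon_mult_Fil:
  assumes "\<alpha> \<in> exponents n" "f \<in> Fil p"
  shows "mon \<alpha> \<otimes> f \<in> Fil (int (exp_size n \<alpha>) + p)"
  using assms(1)
proof (induction rule: exponents_induct)
  case zero
  then show ?case using assms(2) Fil_carrier[OF assms(2)] by (simp add: mon_zero exp_size_def)
next
  case (step j \<gamma>)
  have "x j \<otimes> (mon \<gamma> \<otimes> f) \<in> Fil (int (exp_size n \<gamma>) + p + 1)"
    using step by (intro var_Fil)
  also have "x j \<otimes> (mon \<gamma> \<otimes> f) = mon (\<gamma>(j := Suc (\<gamma> j))) \<otimes> f"
    using step Fil_carrier[OF assms(2)] vars_closed by (simp add: m_assoc flip: var_mon_first)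
  finally show ?case using step by (simp add: exp_size_upd add_ac del: fun_upd_apply)
qed

text \<open>By additivity in \<open>f\<close> only terms \<open>r \<otimes> mon \<alpha>\<close>
  matter; the monomial shifts the degree by its size, and left multiplication by \<open>r\<close>
  preserves each \<open>Fil\<close>. The product of \<open>Gr\<close> is well defined because of
  this.\<close>

lemma Fil_mult:
  assumes f: "f \<in> Fil p" and g: "g \<in> Fil q"
  shows "f \<otimes> g \<in> Fil (p + q)"
  using f
proof (induction rule: Fil_induct)
  case zero
  then show ?case using Fil_carrier[OF g] by simp
next
  case (add f g')
  then show ?case using Fil_carrier[OF g] by (simp add: l_distr Fil_add)
next
  case (scaled r \<alpha>)
  have "r \<otimes> (mon \<alpha> \<otimes> g) \<in> Fil (p + q)"
    using scaled g by (intro Fil_smult Fil_mono[OF mon_mult_Fil]) auto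
  then show ?case using scaled Fil_carrier[OF g] by (simp add: m_assoc)
qed

text \<open>Existence of \<open>\<sigma>\<^sup>\<alpha>(r)\<close>: the scalar passes the variables
  one by one from the right, each turning a nonzero \<open>s\<close> into a nonzero
  \<open>c\<close>, while the extra terms stay below the size of \<open>\<alpha>\<close>.\<close>

lemma mon_scalar:
  assumes "\<alpha> \<in> exponents n" "r \<in> R"
  shows "\<exists>s\<in>R. \<exists>p\<in>Fil (int (exp_size n \<alpha>) - 1).
    mon \<alpha> \<otimes> r = s \<otimes> mon \<alpha> \<oplus> p \<and> (r \<noteq> \<zero> \<longrightarrow> s \<noteq> \<zero>)"
  using assms(1)
proof (induction rule: exponents_induct)
  case zero
  have "mon (\<lambda>_. 0) \<otimes> r = r \<otimes> mon (\<lambda>_. 0) \<oplus> \<zero>"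
    using assms(2) by (simp add: mon_zero)
  then show ?case using assms(2) zero_Fil by blast
next
  case (step j \<gamma>)
  then obtain s p where s: "s \<in> R" "p \<in> Fil (int (exp_size n \<gamma>) - 1)"
      "mon \<gamma> \<otimes> r = s \<otimes> mon \<gamma> \<oplus> p" "r \<noteq> \<zero> \<longrightarrow> s \<noteq> \<zero>"
    by auto
  obtain c d where c: "c \<in> R" "d \<in> R" "x j \<otimes> s = c \<otimes> x j \<oplus> d" "s \<noteq> \<zero> \<longrightarrow> c \<noteq> \<zero>"
    using step(1) s(1) by (rule var_scalarE)
  have X: "x j \<in> carrier A" "p \<in> carrier A"
    using vars_closed[OF step(1)] Fil_carrier[OF s(2)] by auto
  have "mon (\<gamma>(j := Suc (\<gamma> j))) \<otimes> r = x j \<otimes> (mon \<gamma> \<otimes> r)"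
    using X assms(2) by (simp add: m_assoc flip: var_mon_first[OF step(1,3)])
  also have "\<dots> = (x j \<otimes> s) \<otimes> mon \<gamma> \<oplus> x j \<otimes> p"
    using s X by (simp add: r_distr m_assoc)
  also have "\<dots> = c \<otimes> (x j \<otimes> mon \<gamma>) \<oplus> (d \<otimes> mon \<gamma> \<oplus> x j \<otimes> p)"
    unfolding c(3) using c(1,2) X by (simp add: l_distr m_assoc a_assoc)
  finally have "mon (\<gamma>(j := Suc (\<gamma> j))) \<otimes> r =
      c \<otimes> mon (\<gamma>(j := Suc (\<gamma> j))) \<oplus> (d \<otimes> mon \<gamma> \<oplus> x j \<otimes> p)"
    using var_mon_first[OF step(1,3)] by simp
  moreover have "d \<otimes> mon \<gamma> \<oplus> x j \<otimes> p \<in> Fil (int (exp_size n (\<gamma>(j := Suc (\<gamma> j)))) - 1)"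
    using c(2) step(1,2) var_Fil[OF step(1) s(2)]
    by (intro Fil_add term_Fil) (auto simp: exp_size_upd)
  ultimately show ?case using c(1,4) s(4) by blast
qed

text \<open>Existence of the constants behind \<open>struct_const\<close>. The first factor is
  peeled off variable by variable; \<open>var_mon\<close> inserts each variable into the product
  formed so far, and its scalar \<open>e\<close> is multiplied by the \<open>c\<close> that comes
  from passing \<open>s\<close>.\<close>

lemma mon_mult_mon:
  assumes "\<alpha> \<in> exponents n" "\<beta> \<in> exponents n"
  shows "\<exists>c\<in>R. \<exists>p\<in>Fil (int (exp_size n \<alpha> + exp_size n \<beta>) - 1).
    mon \<alpha> \<otimes> mon \<beta> = c \<otimes> mon (exp_add \<alpha> \<beta>) \<oplus> p"
  using assms(1)
proof (induction rule: exponents_induct)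
  case zero
  have "mon (\<lambda>_. 0) \<otimes> mon \<beta> = \<one> \<otimes> mon (exp_add (\<lambda>_. 0) \<beta>) \<oplus> \<zero>"
    by (simp add: mon_zero exp_add_def)
  then show ?case using one_base zero_Fil by blast
next
  case (step j \<gamma>)
  then obtain s p where s: "s \<in> R" "p \<in> Fil (int (exp_size n \<gamma> + exp_size n \<beta>) - 1)"
      "mon \<gamma> \<otimes> mon \<beta> = s \<otimes> mon (exp_add \<gamma> \<beta>) \<oplus> p"
    by auto
  obtain c d where c: "c \<in> R" "d \<in> R" "x j \<otimes> s = c \<otimes> x j \<oplus> d"
    using step(1) s(1) by (rule var_scalarE)
  let ?\<epsilon> = "exp_add \<gamma> \<beta>"
  obtain e q where e: "e \<in> R" "q \<in> Fil (int (exp_size n ?\<epsilon>))"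
      "x j \<otimes> mon ?\<epsilon> = e \<otimes> mon (?\<epsilon>(j := Suc (?\<epsilon> j))) \<oplus> q"
    using var_mon[OF exp_add_exponents[OF step(2) assms(2)] step(1)] by auto
  have upd: "?\<epsilon>(j := Suc (?\<epsilon> j)) = exp_add (\<gamma>(j := Suc (\<gamma> j))) \<beta>"
    by (auto simp: exp_add_def)
  have X: "x j \<in> carrier A" "p \<in> carrier A" "q \<in> carrier A"
    using vars_closed[OF step(1)] Fil_carrier[OF s(2)] Fil_carrier[OF e(2)] by auto
  have "mon (\<gamma>(j := Suc (\<gamma> j))) \<otimes> mon \<beta> = x j \<otimes> (mon \<gamma> \<otimes> mon \<beta>)"
    using X step by (simp add: m_assoc flip: var_mon_first)
  also have "\<dots> = (x j \<otimes> s) \<otimes> mon ?\<epsilon> \<oplus> x j \<otimes> p"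
    using s X by (simp add: r_distr m_assoc)
  also have "\<dots> = c \<otimes> (x j \<otimes> mon ?\<epsilon>) \<oplus> (d \<otimes> mon ?\<epsilon> \<oplus> x j \<otimes> p)"
    unfolding c(3) using c(1,2) X by (simp add: l_distr m_assoc a_assoc)
  also have "\<dots> = (c \<otimes> e) \<otimes> mon (exp_add (\<gamma>(j := Suc (\<gamma> j))) \<beta>) \<oplus>
      (c \<otimes> q \<oplus> (d \<otimes> mon ?\<epsilon> \<oplus> x j \<otimes> p))"
    unfolding e(3) upd using c(1,2) e(1) X by (simp add: r_distr m_assoc a_assoc)
  finally have "mon (\<gamma>(j := Suc (\<gamma> j))) \<otimes> mon \<beta> =
      (c \<otimes> e) \<otimes> mon (exp_add (\<gamma>(j := Suc (\<gamma> j))) \<beta>) \<oplus>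
      (c \<otimes> q \<oplus> (d \<otimes> mon ?\<epsilon> \<oplus> x j \<otimes> p))" .
  moreover have "c \<otimes> q \<oplus> (d \<otimes> mon ?\<epsilon> \<oplus> x j \<otimes> p) \<in>
      Fil (int (exp_size n (\<gamma>(j := Suc (\<gamma> j))) + exp_size n \<beta>) - 1)"
    using c(1,2) step(1,2) var_Fil[OF step(1) s(2)] e(2) assms(2)
    by (simp add: Fil_add Fil_smult term_Fil exp_size_upd exp_size_add del: fun_upd_apply)
  ultimately show ?case using c(1) e(1) by (meson mult_base)
qed

text \<open>The remainder lies one filtration step below \<open>exp_size n \<alpha>\<close> and has
  no coefficient at \<open>\<alpha>\<close>, so every admissible \<open>s\<close> is the coefficient
  there; existence is \<open>mon_scalar\<close>. For \<open>r = \<zero>\<close> no nonzero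
  \<open>s\<close> exists, and the description in \<open>sigma\<close> is void.\<close>

lemma sigma_eq:
  assumes \<alpha>: "\<alpha> \<in> exponents n" and r: "r \<in> R" "r \<noteq> \<zero>"
  shows "sigma \<alpha> r = coeff (mon \<alpha> \<otimes> r) \<alpha>"
  unfolding sigma_def
proof (rule the_equality)
  have s: "s = coeff (mon \<alpha> \<otimes> r) \<alpha>"
    if "s \<in> R" "p \<in> Fil (int (exp_size n \<alpha>) - 1)" "mon \<alpha> \<otimes> r = s \<otimes> mon \<alpha> \<oplus> p" for s p
  proof -
    have "p \<in> carrier A" "coeff p \<alpha> = \<zero>"
      using Fil_carrier[OF that(2)] Fil_coeff_zero[OF that(2), of \<alpha>] by auto
    then show ?thesis unfolding that(3) using that(1) \<alpha> by (simp add: coeff_add coeff_term)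
  qed
  obtain s p where *: "s \<in> R" "p \<in> Fil (int (exp_size n \<alpha>) - 1)"
      "mon \<alpha> \<otimes> r = s \<otimes> mon \<alpha> \<oplus> p" "s \<noteq> \<zero>"
    using mon_scalar[OF \<alpha> r(1)] r(2) by auto
  show "coeff (mon \<alpha> \<otimes> r) \<alpha> \<in> R - {\<zero>} \<and> (\<exists>p\<in>carrier A.
      mon \<alpha> \<otimes> r = coeff (mon \<alpha> \<otimes> r) \<alpha> \<otimes> mon \<alpha> \<oplus> p \<and> (p = \<zero> \<or> deg p < exp_size n \<alpha>))"
    using * low_iff[OF Fil_carrier[OF *(2)]] Fil_carrier[OF *(2)]
    unfolding s[OF *(1-3), symmetric] by blast
  show "s = coeff (mon \<alpha> \<otimes> r) \<alpha>" if "s \<in> R - {\<zero>} \<and> (\<exists>p\<in>carrier A.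
      mon \<alpha> \<otimes> r = s \<otimes> mon \<alpha> \<oplus> p \<and> (p = \<zero> \<or> deg p < exp_size n \<alpha>))" for s
    using that low_iff s by blast
qed

text \<open>The same argument at \<open>exp_add \<alpha> \<beta>\<close>, with existence from
  \<open>mon_mult_mon\<close>. Both constants are now coefficients of explicit products, a form that
  passes to \<open>Gr\<close> directly.\<close>

lemma struct_const_eq:
  assumes \<alpha>: "\<alpha> \<in> exponents n" and \<beta>: "\<beta> \<in> exponents n"
  shows "struct_const \<alpha> \<beta> = coeff (mon \<alpha> \<otimes> mon \<beta>) (exp_add \<alpha> \<beta>)"
  unfolding struct_const_def
proof (rule the_equality)
  let ?\<epsilon> = "exp_add \<alpha> \<beta>"
  let ?c = "coeff (mon \<alpha> \<otimes> mon \<beta>) ?\<epsilon>"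
  have s: "s = ?c"
    if "s \<in> R" "p \<in> Fil (int (exp_size n ?\<epsilon>) - 1)" "mon \<alpha> \<otimes> mon \<beta> = s \<otimes> mon ?\<epsilon> \<oplus> p" for s p
  proof -
    have "p \<in> carrier A" "coeff p ?\<epsilon> = \<zero>"
      using Fil_carrier[OF that(2)] Fil_coeff_zero[OF that(2), of ?\<epsilon>] by auto
    then show ?thesis unfolding that(3) using that(1) \<alpha> \<beta> by (simp add: coeff_add coeff_term)
  qed
  obtain s p where *: "s \<in> R" "p \<in> Fil (int (exp_size n ?\<epsilon>) - 1)"
      "mon \<alpha> \<otimes> mon \<beta> = s \<otimes> mon ?\<epsilon> \<oplus> p"
    using mon_mult_mon[OF \<alpha> \<beta>] by (auto simp: exp_size_add)
  show "?c \<in> R \<and> (\<exists>p\<in>carrier A. mon \<alpha> \<otimes> mon \<beta> = ?c \<otimes> mon ?\<epsilon> \<oplus> p \<and>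
      (p = \<zero> \<or> deg p < exp_size n ?\<epsilon>))"
    using * low_iff[OF Fil_carrier[OF *(2)]] Fil_carrier[OF *(2)]
    unfolding s[OF *, symmetric] by blast
  show "s = ?c" if "s \<in> R \<and> (\<exists>p\<in>carrier A. mon \<alpha> \<otimes> mon \<beta> = s \<otimes> mon ?\<epsilon> \<oplus> p \<and>
      (p = \<zero> \<or> deg p < exp_size n ?\<epsilon>))" for s
    using that low_iff s by blast
qed

end


section \<open>The associated graded ring\<close>

context pbw_data
begin

text \<open>The sequences in \<open>rees\<close> form the Rees ring of the filtration; \<open>gr_seq\<close> maps it onto \<^term>\<open>Gr\<close>.\<close>

definition rees :: "(nat \<Rightarrow> 'a) set"
  where "rees = {f. (\<forall>p. f p \<in> Fil (int p)) \<and> finite {p. f p \<noteq> \<zero>}}"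

definition gr_seq :: "(nat \<Rightarrow> 'a) \<Rightarrow> nat \<Rightarrow> 'a set"
  where "gr_seq f = (\<lambda>p. Fil (int p - 1) +> f p)"

end

context skew_PBW_extension
begin

lemma reesI: "(\<And>p. f p \<in> Fil (int p)) \<Longrightarrow> finite {p. f p \<noteq> \<zero>} \<Longrightarrow> f \<in> rees"
  by (simp add: rees_def)

lemma reesD:
  assumes "f \<in> rees"
  shows "f p \<in> Fil (int p)" "f p \<in> carrier A" "finite {p. f p \<noteq> \<zero>}"
  using assms Fil_carrier unfolding rees_def by blast+

section \<open>Cosets of the filtration\<close>

lemma Fil_additive_subgroup: "additive_subgroup (Fil p) A"
proof (intro additive_subgroupI add.subgroupI)
  show "Fil p \<subseteq> carrier A" using Fil_carrier by blast
  show "Fil p \<noteq> {}" using zero_Fil by blast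
qed (auto intro: Fil_add Fil_uminus simp flip: a_inv_def)

lemma Fil_abelian_subgroup: "abelian_subgroup (Fil p) A"
  by (intro abelian_subgroupI3 Fil_additive_subgroup) (rule abelian_group_axioms)

lemma mem_coset_iff:
  assumes "f \<in> carrier A"
  shows "g \<in> Fil p +> f \<longleftrightarrow> g \<in> carrier A \<and> g \<ominus> f \<in> Fil p"
proof
  assume g: "g \<in> Fil p +> f"
  then have "g \<in> carrier A"
    using assms Fil_carrier a_r_coset_subset_G[of "Fil p" f] by blast
  then show "g \<in> carrier A \<and> g \<ominus> f \<in> Fil p"
    using g abelian_subgroup.a_rcos_module_minus[OF Fil_abelian_subgroup ring_axioms assms] by blast
qed (use abelian_subgroup.a_rcos_module_minus[OF Fil_abelian_subgroup ring_axioms assms] in blast)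

lemma coset_self: "f \<in> carrier A \<Longrightarrow> f \<in> Fil p +> f"
  by (simp add: mem_coset_iff a_minus_def r_neg)

lemma coset_eq_iff:
  assumes "f \<in> carrier A" "g \<in> carrier A"
  shows "Fil p +> f = Fil p +> g \<longleftrightarrow> f \<ominus> g \<in> Fil p"
proof
  assume "Fil p +> f = Fil p +> g"
  then show "f \<ominus> g \<in> Fil p" using coset_self[OF assms(1)] mem_coset_iff[OF assms(2)] by blast
next
  assume "f \<ominus> g \<in> Fil p"
  then have "f \<in> Fil p +> g" using mem_coset_iff assms by blast
  then show "Fil p +> f = Fil p +> g"
    using abelian_subgroup.a_repr_independence'[OF Fil_abelian_subgroup] assms by blast
qed

lemma coset_zero [simp]: "Fil p +> \<zero> = Fil p"
  using Fil_carrier by (intro a_coset_add_zero) blast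

lemma gr_seq_eq_iff:
  assumes "f \<in> rees" "g \<in> rees"
  shows "gr_seq f = gr_seq g \<longleftrightarrow> (\<forall>p. f p \<ominus> g p \<in> Fil (int p - 1))"
  unfolding gr_seq_def fun_eq_iff using reesD(2)[OF assms(1)] reesD(2)[OF assms(2)]
  by (simp add: coset_eq_iff)

text \<open>Elements of \<open>Gr\<close> become classes of finitely supported sequences of
  representatives, so that calculations can take place in \<open>A\<close>.\<close>

lemma carrier_Gr: "carrier Gr = gr_seq ` rees"
proof (intro equalityI subsetI)
  fix u assume "u \<in> carrier Gr"
  then have u: "\<And>p. \<exists>f\<in>Fil (int p). u p = Fil (int p - 1) +> f" and fin: "finite {p. u p \<noteq> Fil (int p - 1)}"
    unfolding Gr_def by auto
  from u obtain f where f: "\<And>p. f p \<in> Fil (int p)" "\<And>p. u p = Fil (int p - 1) +> f p"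
    by metis
  \<comment> \<open>An arbitrary representative of a trivial coset need not vanish; taking
    \<open>\<zero>\<close> there makes the sequence finitely supported.\<close>
  let ?g = "\<lambda>p. if u p = Fil (int p - 1) then \<zero> else f p"
  have "?g \<in> rees"
    using f(1) by (intro reesI finite_subset[OF _ fin]) auto
  moreover have "u = gr_seq ?g"
    by (simp add: gr_seq_def f(2) fun_eq_iff)
  ultimately show "u \<in> gr_seq ` rees" by blast
next
  fix u assume "u \<in> gr_seq ` rees"
  then obtain f where f: "f \<in> rees" "u = gr_seq f" by blast
  have "finite {p. gr_seq f p \<noteq> Fil (int p - 1)}"
    by (rule finite_subset[OF _ reesD(3)[OF f(1)]]) (auto simp: gr_seq_def)
  moreover have "\<exists>g\<in>Fil (int p). gr_seq f p = Fil (int p - 1) +> g" for p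
    using reesD(1)[OF f(1)] by (auto simp: gr_seq_def)
  ultimately show "u \<in> carrier Gr"
    using f(2) unfolding Gr_def by auto
qed

section \<open>The Rees ring and the ring structure of \<open>Gr\<close>\<close>

lemma rees_zero [simp]: "(\<lambda>_. \<zero>) \<in> rees"
  by (rule reesI) auto

lemma rees_add: "f \<in> rees \<Longrightarrow> g \<in> rees \<Longrightarrow> (\<lambda>p. f p \<oplus> g p) \<in> rees"
proof (rule reesI)
  assume "f \<in> rees" "g \<in> rees"
  then show "finite {p. f p \<oplus> g p \<noteq> \<zero>}"
    by (intro finite_subset[of "{p. f p \<oplus> g p \<noteq> \<zero>}" "{p. f p \<noteq> \<zero>} \<union> {p. g p \<noteq> \<zero>}"])
      (auto simp: reesD(3))
qed (simp add: Fil_add reesD(1))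

lemma rees_uminus: "f \<in> rees \<Longrightarrow> (\<lambda>p. \<ominus> f p) \<in> rees"
proof (rule reesI)
  assume "f \<in> rees"
  then show "finite {p. \<ominus> f p \<noteq> \<zero>}"
    by (intro finite_subset[of "{p. \<ominus> f p \<noteq> \<zero>}" "{p. f p \<noteq> \<zero>}"]) (auto simp: reesD(3))
qed (simp add: Fil_uminus reesD(1))

text \<open>A sequence is read as the polynomial with coefficient \<open>f p\<close> at degree
  \<open>p\<close>. Convolution is then the polynomial product, which settles finiteness of supports
  in \<open>rees_mult\<close> and later the ring laws.\<close>

lemma rees_up: "f \<in> rees \<Longrightarrow> f \<in> up A"
proof (rule mem_upI)
  assume f: "f \<in> rees"
  then obtain N where "\<forall>p\<in>{p. f p \<noteq> \<zero>}. p \<le> N"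
    using reesD(3) finite_nat_set_iff_bounded_le by blast
  then show "\<exists>N. bound \<zero> N f" by (intro exI[of _ N] bound.intro) force
qed (rule reesD(2))

lemma rees_mult:
  assumes f: "f \<in> rees" and g: "g \<in> rees"
  shows "(\<lambda>k. \<Oplus>p\<in>{..k}. f p \<otimes> g (k - p)) \<in> rees"
proof (rule reesI)
  fix k
  show "(\<Oplus>p\<in>{..k}. f p \<otimes> g (k - p)) \<in> Fil (int k)"
  proof (rule Fil_finsum)
    fix p assume "p \<in> {..k}"
    then show "f p \<otimes> g (k - p) \<in> Fil (int k)"
      using Fil_mult[OF reesD(1)[OF f, of p] reesD(1)[OF g, of "k - p"]] by (simp add: of_nat_diff)
  qed
  obtain N where "bound \<zero> N (\<lambda>k. \<Oplus>p\<in>{..k}. f p \<otimes> g (k - p))"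
    using up_mult_closed[OF rees_up[OF f] rees_up[OF g]] bound_upD by blast
  then show "finite {k. (\<Oplus>p\<in>{..k}. f p \<otimes> g (k - p)) \<noteq> \<zero>}"
    unfolding finite_nat_set_iff_bounded_le bound_def using leI by blast
qed

lemma gr_add:
  assumes "f \<in> rees" "g \<in> rees"
  shows "gr_seq f \<oplus>\<^bsub>Gr\<^esub> gr_seq g = gr_seq (\<lambda>p. f p \<oplus> g p)"
  using reesD(2)[OF assms(1)] reesD(2)[OF assms(2)]
  by (simp add: Gr_def gr_seq_def abelian_subgroup.a_rcos_sum[OF Fil_abelian_subgroup])

text \<open>Writing the difference as \<open>(f' \<ominus> f) \<otimes> g' \<oplus> f \<otimes> (g'
  \<ominus> g)\<close> puts a factor of dropped degree into each summand: changing representatives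
  alters a product only below its top degree.\<close>

lemma Fil_mult_diff:
  assumes "f \<in> Fil p" "f' \<in> Fil p" "g \<in> Fil q" "g' \<in> Fil q"
    and "f' \<ominus> f \<in> Fil (p - 1)" "g' \<ominus> g \<in> Fil (q - 1)"
  shows "f' \<otimes> g' \<ominus> f \<otimes> g \<in> Fil (p + q - 1)"
proof -
  have carr: "f \<in> carrier A" "f' \<in> carrier A" "g \<in> carrier A" "g' \<in> carrier A"
    using assms Fil_carrier by auto
  have "f' \<otimes> g' \<ominus> f \<otimes> g = (f' \<ominus> f) \<otimes> g' \<oplus> f \<otimes> (g' \<ominus> g)"
    using carr by algebra
  moreover have "(f' \<ominus> f) \<otimes> g' \<in> Fil (p - 1 + q)" "f \<otimes> (g' \<ominus> g) \<in> Fil (p + (q - 1))"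
    using assms by (auto intro: Fil_mult)
  ultimately show ?thesis by (simp add: Fil_add algebra_simps)
qed

lemma add_minus_cancel_left: "a \<in> carrier A \<Longrightarrow> b \<in> carrier A \<Longrightarrow> a \<oplus> b \<ominus> a = b"
  by algebra

text \<open>By \<open>Fil_mult_diff\<close>, the union over all choices of representatives is a
  union of one and the same coset, over index sets that contain \<open>f\<close> and
  \<open>g\<close> and so are not empty.\<close>

lemma gr_mult:
  assumes f: "f \<in> rees" and g: "g \<in> rees"
  shows "gr_seq f \<otimes>\<^bsub>Gr\<^esub> gr_seq g = gr_seq (\<lambda>k. \<Oplus>p\<in>{..k}. f p \<otimes> g (k - p))"
proof
  fix k :: nat
  let ?s = "\<lambda>f g. \<Oplus>p\<in>{..k}. f p \<otimes> g (k - p)"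
  have eq: "Fil (int k - 1) +> ?s f' g' = Fil (int k - 1) +> ?s f g"
    if f': "\<forall>p. f' p \<in> gr_seq f p" and g': "\<forall>p. g' p \<in> gr_seq g p" for f' g'
  proof -
    have f'D: "f' p \<in> carrier A" "f' p \<ominus> f p \<in> Fil (int p - 1)" for p
      using f' mem_coset_iff[OF reesD(2)[OF f]] by (auto simp: gr_seq_def)
    have g'D: "g' p \<in> carrier A" "g' p \<ominus> g p \<in> Fil (int p - 1)" for p
      using g' mem_coset_iff[OF reesD(2)[OF g]] by (auto simp: gr_seq_def)
    have f'F: "f' p \<in> Fil (int p)" for p
      using Fil_add[OF reesD(1)[OF f] Fil_mono[OF f'D(2)], of p p] f'D(1)[of p] reesD(2)[OF f, of p]
      by (simp add: add_minus_cancel)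
    have g'F: "g' p \<in> Fil (int p)" for p
      using Fil_add[OF reesD(1)[OF g] Fil_mono[OF g'D(2)], of p p] g'D(1)[of p] reesD(2)[OF g, of p]
      by (simp add: add_minus_cancel)
    have carr: "f p \<in> carrier A" "g p \<in> carrier A" "f' p \<in> carrier A" "g' p \<in> carrier A" for p
      using reesD(2)[OF f] reesD(2)[OF g] f'D g'D by auto
    have "?s f' g' = (\<Oplus>p\<in>{..k}. f p \<otimes> g (k - p) \<oplus> (f' p \<otimes> g' (k - p) \<ominus> f p \<otimes> g (k - p)))"
      by (rule finsum_cong') (auto simp: carr add_minus_cancel)
    also have "\<dots> = ?s f g \<oplus> (\<Oplus>p\<in>{..k}. f' p \<otimes> g' (k - p) \<ominus> f p \<otimes> g (k - p))"
      by (rule finsum_addf) (auto simp: carr)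
    finally have "?s f' g' = ?s f g \<oplus> (\<Oplus>p\<in>{..k}. f' p \<otimes> g' (k - p) \<ominus> f p \<otimes> g (k - p))"
      (is "_ = _ \<oplus> ?d") .
    moreover have d: "?d \<in> Fil (int k - 1)"
    proof (rule Fil_finsum)
      fix p assume p: "p \<in> {..k}"
      then show "f' p \<otimes> g' (k - p) \<ominus> f p \<otimes> g (k - p) \<in> Fil (int k - 1)"
        using Fil_mult_diff[OF reesD(1)[OF f, of p] f'F reesD(1)[OF g, of "k - p"] g'F f'D(2) g'D(2)]
        by (simp add: of_nat_diff)
    qed
    moreover have s: "?s f g \<in> carrier A" "?s f' g' \<in> carrier A"
      using carr by (auto intro: finsum_closed)
    moreover have "?s f g \<oplus> ?d \<ominus> ?s f g = ?d"
      using s(1) Fil_carrier[OF d]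
      by (rule add_minus_cancel_left)
    ultimately show ?thesis
      by (simp add: coset_eq_iff)
  qed
  have "f p \<in> gr_seq f p" "g p \<in> gr_seq g p" for p
    using reesD(2)[OF f] reesD(2)[OF g] by (auto simp: gr_seq_def intro: coset_self)
  then have ne: "f \<in> {f'. \<forall>p. f' p \<in> gr_seq f p}" "g \<in> {g'. \<forall>p. g' p \<in> gr_seq g p}"
    by auto
  have "(gr_seq f \<otimes>\<^bsub>Gr\<^esub> gr_seq g) k = (\<Union>f'\<in>{f'. \<forall>p. f' p \<in> gr_seq f p}.
      \<Union>g'\<in>{g'. \<forall>p. g' p \<in> gr_seq g p}. Fil (int k - 1) +> ?s f' g')"
    by (simp add: Gr_def)
  also have "\<dots> = (\<Union>f'\<in>{f'. \<forall>p. f' p \<in> gr_seq f p}.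
      \<Union>g'\<in>{g'. \<forall>p. g' p \<in> gr_seq g p}. Fil (int k - 1) +> ?s f g)"
    by (intro SUP_cong refl eq) simp_all
  also have "\<dots> = Fil (int k - 1) +> ?s f g"
    using ne by blast
  finally show "(gr_seq f \<otimes>\<^bsub>Gr\<^esub> gr_seq g) k = gr_seq (\<lambda>k. \<Oplus>p\<in>{..k}. f p \<otimes> g (k - p)) k"
    by (simp only: gr_seq_def)
qed

lemma gr_class_eq_gr_seq: "gr_class p f = gr_seq (\<lambda>q. if q = p then f else \<zero>)"
  by (auto simp: gr_class_def gr_seq_def fun_eq_iff)

lemma gr_one: "\<one>\<^bsub>Gr\<^esub> = gr_seq (\<lambda>p. if p = 0 then \<one> else \<zero>)"
  by (auto simp: Gr_def gr_seq_def fun_eq_iff)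

lemma gr_zero: "\<zero>\<^bsub>Gr\<^esub> = gr_seq (\<lambda>_. \<zero>)"
  by (auto simp: Gr_def gr_seq_def)

lemma rees_class: "f \<in> Fil (int p) \<Longrightarrow> (\<lambda>q. if q = p then f else \<zero>) \<in> rees"
  by (rule reesI) auto

lemma rees_one: "(\<lambda>p. if p = 0 then \<one> else \<zero>) \<in> rees"
  by (rule rees_class) simp

text \<open>The Rees sequences form a subring of \<open>UP A\<close>, and \<open>gr_seq\<close>
  respects sum, product and one. The image of a ring under such a map is a ring, and here the image
  is all of \<open>Gr\<close>.\<close>

lemma ring_Gr: "ring Gr"
proof -
  interpret UP: UP_ring A "UP A" by unfold_locales auto
  have rees_sub: "subring rees (UP A)"
  proof (rule ring.subringI[OF UP.UP_ring])
    show "rees \<subseteq> carrier (UP A)" using rees_up by (auto simp: UP_def)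
    show "\<one>\<^bsub>UP A\<^esub> \<in> rees" using rees_one by (simp add: UP_def)
  next
    fix f assume f: "f \<in> rees"
    have "(\<lambda>p. \<ominus> f p) \<oplus>\<^bsub>UP A\<^esub> f = \<zero>\<^bsub>UP A\<^esub>"
      using rees_up[OF f] rees_up[OF rees_uminus[OF f]] reesD(2)[OF f] by (simp add: UP_def l_neg)
    then have "\<ominus>\<^bsub>UP A\<^esub> f = (\<lambda>p. \<ominus> f p)"
      using rees_up[OF f] rees_up[OF rees_uminus[OF f]] by (intro abelian_group.minus_equality ring.is_abelian_group UP.UP_ring) (auto simp: UP_def)
    then show "\<ominus>\<^bsub>UP A\<^esub> f \<in> rees" using rees_uminus[OF f] by simp
  next
    fix f g assume "f \<in> rees" "g \<in> rees"
    then show "f \<otimes>\<^bsub>UP A\<^esub> g \<in> rees" "f \<oplus>\<^bsub>UP A\<^esub> g \<in> rees"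
      using rees_mult[of f g] rees_add[of f g] rees_up by (auto simp: UP_def)
  qed
  let ?Rees = "(UP A)\<lparr>carrier := rees\<rparr>"
  have "gr_seq \<in> ring_hom ?Rees Gr"
    by (rule ring_hom_memI)
      (use rees_up in \<open>auto simp: UP_def carrier_Gr gr_add gr_mult gr_one\<close>)
  then have "ring (Gr\<lparr>carrier := gr_seq ` carrier ?Rees, zero := gr_seq \<zero>\<^bsub>?Rees\<^esub>\<rparr>)"
    by (rule ring.ring_hom_imp_img_ring[OF ring.subring_is_ring[OF UP.UP_ring rees_sub]])
  \<comment> \<open>The image theorem speaks of a record with carrier and zero replaced; both
    replacements agree with the fields of \<open>Gr\<close>.\<close>
  moreover have "Gr\<lparr>carrier := gr_seq ` carrier ?Rees, zero := gr_seq \<zero>\<^bsub>?Rees\<^esub>\<rparr> = Gr"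
  proof -
    have "Gr\<lparr>carrier := carrier Gr, zero := \<zero>\<^bsub>Gr\<^esub>\<rparr> = Gr" by simp
    then show ?thesis by (simp add: carrier_Gr gr_zero UP_def)
  qed
  ultimately show ?thesis by simp
qed

section \<open>Homogeneous classes and the monomials of \<open>Gr\<close>\<close>

lemma gr_class_closed: "f \<in> Fil (int p) \<Longrightarrow> gr_class p f \<in> carrier Gr"
  unfolding carrier_Gr gr_class_eq_gr_seq by (intro imageI rees_class)

lemma gr_class_zero [simp]: "gr_class p \<zero> = \<zero>\<^bsub>Gr\<^esub>"
  by (simp add: gr_class_eq_gr_seq gr_zero)

lemma gr_class_one: "gr_class 0 \<one> = \<one>\<^bsub>Gr\<^esub>"
  by (simp add: gr_class_eq_gr_seq gr_one)

lemma gr_class_add: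
  assumes "f \<in> Fil (int p)" "g \<in> Fil (int p)"
  shows "gr_class p f \<oplus>\<^bsub>Gr\<^esub> gr_class p g = gr_class p (f \<oplus> g)"
  unfolding gr_class_eq_gr_seq gr_add[OF rees_class[OF assms(1)] rees_class[OF assms(2)]]
  by (rule arg_cong[of _ _ gr_seq]) auto

lemma gr_class_uminus:
  assumes "f \<in> Fil (int p)"
  shows "\<ominus>\<^bsub>Gr\<^esub> gr_class p f = gr_class p (\<ominus> f)"
proof -
  interpret Gr: ring Gr by (rule ring_Gr)
  show ?thesis
    using assms Fil_carrier[OF assms]
    by (intro Gr.minus_equality) (simp_all add: gr_class_add gr_class_closed Fil_uminus l_neg)
qed

lemma gr_class_mult:
  assumes f: "f \<in> Fil (int p)" and g: "g \<in> Fil (int q)"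
  shows "gr_class p f \<otimes>\<^bsub>Gr\<^esub> gr_class q g = gr_class (p + q) (f \<otimes> g)"
proof -
  have carr: "f \<in> carrier A" "g \<in> carrier A" using f g Fil_carrier by auto
  have "(\<Oplus>i\<in>{..k}. (if i = p then f else \<zero>) \<otimes> (if k - i = q then g else \<zero>)) =
      (if k = p + q then f \<otimes> g else \<zero>)" for k
  proof (cases "p \<le> k")
    case True
    have "(\<Oplus>i\<in>{..k}. (if i = p then f else \<zero>) \<otimes> (if k - i = q then g else \<zero>)) =
        (\<Oplus>i\<in>{..k}. if p = i then f \<otimes> (if k - i = q then g else \<zero>) else \<zero>)"
      by (rule finsum_cong') (auto simp: carr)
    also have "\<dots> = f \<otimes> (if k - p = q then g else \<zero>)"
      using True carr by (intro finsum_singleton) auto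
    finally show ?thesis using True carr by auto
  next
    case False
    then have "(\<Oplus>i\<in>{..k}. (if i = p then f else \<zero>) \<otimes> (if k - i = q then g else \<zero>)) =
        (\<Oplus>i\<in>{..k}. \<zero>)"
      by (intro finsum_cong') (auto simp: carr)
    then show ?thesis using False by simp
  qed
  then show ?thesis
    unfolding gr_class_eq_gr_seq gr_mult[OF rees_class[OF f] rees_class[OF g]] by simp
qed

lemma gr_class_eq_iff:
  assumes "f \<in> Fil (int p)" "g \<in> Fil (int p)"
  shows "gr_class p f = gr_class p g \<longleftrightarrow> f \<ominus> g \<in> Fil (int p - 1)"
  unfolding gr_class_eq_gr_seq gr_seq_eq_iff[OF rees_class[OF assms(1)] rees_class[OF assms(2)]]
  by (auto simp: a_minus_def)

text \<open>In degree 0 the classes are taken modulo \<open>Fil (- 1)\<close>, which is zero, so no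
  two scalars are identified.\<close>

lemma gr_base_eq_iff: "r \<in> R \<Longrightarrow> s \<in> R \<Longrightarrow> gr_class 0 r = gr_class 0 s \<longleftrightarrow> r = s"
  by (simp add: gr_class_eq_iff r_right_minus_eq)

lemma gr_base_zero_iff: "r \<in> R \<Longrightarrow> gr_class 0 r = \<zero>\<^bsub>Gr\<^esub> \<longleftrightarrow> r = \<zero>"
  using gr_base_eq_iff[of r \<zero>] by simp

text \<open>A sum of homogeneous classes is sorted by degree: component \<open>p\<close> collects
  the terms with \<open>d \<alpha> = p\<close>. The explicit representatives make linear
  combinations in \<open>Gr\<close> comparable with those in \<open>A\<close>.\<close>

lemma gr_seq_finsum:
  assumes "finite S" "\<And>\<alpha>. \<alpha> \<in> S \<Longrightarrow> t \<alpha> \<in> Fil (int (d \<alpha>))"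
  shows "(\<lambda>p. \<Oplus>\<alpha>\<in>{\<alpha> \<in> S. d \<alpha> = p}. t \<alpha>) \<in> rees"
    and "(\<Oplus>\<^bsub>Gr\<^esub>\<alpha>\<in>S. gr_class (d \<alpha>) (t \<alpha>)) = gr_seq (\<lambda>p. \<Oplus>\<alpha>\<in>{\<alpha> \<in> S. d \<alpha> = p}. t \<alpha>)"
proof -
  interpret Gr: ring Gr by (rule ring_Gr)
  have rees: "(\<lambda>p. \<Oplus>\<alpha>\<in>{\<alpha> \<in> S. d \<alpha> = p}. t \<alpha>) \<in> rees"
    if "finite S" "\<And>\<alpha>. \<alpha> \<in> S \<Longrightarrow> t \<alpha> \<in> Fil (int (d \<alpha>))" for S
  proof (rule reesI)
    show "finite {p. (\<Oplus>\<alpha>\<in>{\<alpha> \<in> S. d \<alpha> = p}. t \<alpha>) \<noteq> \<zero>}"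
    proof (rule finite_subset[OF _ finite_imageI[OF that(1), of d]], clarify)
      fix p assume "(\<Oplus>\<alpha>\<in>{\<alpha> \<in> S. d \<alpha> = p}. t \<alpha>) \<noteq> \<zero>"
      then have "{\<alpha> \<in> S. d \<alpha> = p} \<noteq> {}" by (metis finsum_empty)
      then show "p \<in> d ` S" by blast
    qed
  qed (use that in \<open>auto intro: Fil_finsum\<close>)
  show "(\<lambda>p. \<Oplus>\<alpha>\<in>{\<alpha> \<in> S. d \<alpha> = p}. t \<alpha>) \<in> rees" using rees assms by simp
  show "(\<Oplus>\<^bsub>Gr\<^esub>\<alpha>\<in>S. gr_class (d \<alpha>) (t \<alpha>)) = gr_seq (\<lambda>p. \<Oplus>\<alpha>\<in>{\<alpha> \<in> S. d \<alpha> = p}. t \<alpha>)"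
    using assms
  proof (induction S rule: finite_induct)
    case empty
    then show ?case by (simp add: gr_zero)
  next
    case (insert a S)
    have t: "t \<alpha> \<in> carrier A" if "\<alpha> \<in> insert a S" for \<alpha>
      using insert.prems that Fil_carrier by blast
    have "(\<Oplus>\<^bsub>Gr\<^esub>\<alpha>\<in>insert a S. gr_class (d \<alpha>) (t \<alpha>)) =
        gr_class (d a) (t a) \<oplus>\<^bsub>Gr\<^esub> (\<Oplus>\<^bsub>Gr\<^esub>\<alpha>\<in>S. gr_class (d \<alpha>) (t \<alpha>))"
      using insert by (intro Gr.finsum_insert) (auto intro: gr_class_closed)
    also have "\<dots> = gr_seq (\<lambda>p. if p = d a then t a else \<zero>) \<oplus>\<^bsub>Gr\<^esub>
        gr_seq (\<lambda>p. \<Oplus>\<alpha>\<in>{\<alpha> \<in> S. d \<alpha> = p}. t \<alpha>)"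
      using insert by (simp add: gr_class_eq_gr_seq)
    also have "\<dots> = gr_seq (\<lambda>p. (if p = d a then t a else \<zero>) \<oplus> (\<Oplus>\<alpha>\<in>{\<alpha> \<in> S. d \<alpha> = p}. t \<alpha>))"
      using insert rees by (intro gr_add rees_class) auto
    also have "(\<lambda>p. (if p = d a then t a else \<zero>) \<oplus> (\<Oplus>\<alpha>\<in>{\<alpha> \<in> S. d \<alpha> = p}. t \<alpha>)) =
        (\<lambda>p. \<Oplus>\<alpha>\<in>{\<alpha> \<in> insert a S. d \<alpha> = p}. t \<alpha>)"
    proof
      fix p
      have sum: "(\<Oplus>\<alpha>\<in>{\<alpha> \<in> S. d \<alpha> = p}. t \<alpha>) \<in> carrier A"
        using t by (intro finsum_closed) auto
      show "(if p = d a then t a else \<zero>) \<oplus> (\<Oplus>\<alpha>\<in>{\<alpha> \<in> S. d \<alpha> = p}. t \<alpha>) =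
          (\<Oplus>\<alpha>\<in>{\<alpha> \<in> insert a S. d \<alpha> = p}. t \<alpha>)"
      proof (cases "p = d a")
        case True
        then have "{\<alpha> \<in> insert a S. d \<alpha> = p} = insert a {\<alpha> \<in> S. d \<alpha> = p}" by auto
        then show ?thesis
          using True insert.hyps t by simp
      next
        case False
        then have "{\<alpha> \<in> insert a S. d \<alpha> = p} = {\<alpha> \<in> S. d \<alpha> = p}" by auto
        then show ?thesis using False sum by simp
      qed
    qed
    finally show ?case .
  qed
qed

lemma var_eq_mon: "i < n \<Longrightarrow> x i = mon ((\<lambda>_. 0)(i := 1))"
  using var_mon_first[of i "\<lambda>_. 0"] vars_closed[of i] by (simp add: mon_zero del: fun_upd_apply)

lemma unit_exponent:
  assumes "i < n"
  shows "(\<lambda>_. 0)(i := 1) \<in> exponents n" "exp_size n ((\<lambda>_. 0)(i := 1)) = 1"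
  using assms exp_size_upd[of i n "\<lambda>_. 0"] by (auto simp: exponents_def exp_size_def)

lemma var_Fil1: "i < n \<Longrightarrow> x i \<in> Fil 1"
  using var_eq_mon[of i] mon_Fil[OF unit_exponent(1), of i 1] unit_exponent(2) by simp

text \<open>The support of \<open>x i\<close> is its unit exponent, of size 1, unless
  \<open>\<one> = \<zero>\<close>; then \<open>deg (x i)\<close> is a junk value, but the class of
  \<open>\<zero>\<close> vanishes in any degree.\<close>

lemma gr_vars_eq:
  assumes "i < n"
  shows "gr_vars i = gr_class 1 (x i)"
proof (cases "\<one> = \<zero>")
  case True
  then have "x i = \<zero>" using vars_closed[OF assms] by (metis l_one l_null)
  then show ?thesis by (simp add: gr_vars_def eta_def)
next
  case False
  then have "{\<alpha>. coeff (x i) \<alpha> \<noteq> \<zero>} = {(\<lambda>_. 0)(i := 1)}"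
    using coeff_mon[OF unit_exponent(1)[OF assms]] var_eq_mon[OF assms] by auto
  then have "deg (x i) = 1"
    using unit_exponent(2)[OF assms] by (simp add: deg_def)
  then show ?thesis by (simp add: gr_vars_def eta_def)
qed

lemma var_pow_Fil: "i < n \<Longrightarrow> x i [^] (k :: nat) \<in> Fil (int k)"
proof (induction k)
  case (Suc k)
  then show ?case using Fil_mult[OF Suc.IH var_Fil1] by (simp add: add.commute)
qed simp

lemma gr_vars_pow: "i < n \<Longrightarrow> gr_vars i [^]\<^bsub>Gr\<^esub> (k :: nat) = gr_class k (x i [^] k)"
proof (induction k)
  case 0
  interpret Gr: ring Gr by (rule ring_Gr)
  show ?case by (simp add: gr_class_one)
next
  case (Suc k)
  interpret Gr: ring Gr by (rule ring_Gr)
  show ?case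
    using Suc gr_class_mult[OF var_pow_Fil[of i k], of "x i" 1] var_Fil1[of i]
    by (simp add: gr_vars_eq)
qed

text \<open>Factor by factor through \<open>gr_class_mult\<close>. The induction runs over lists of
  variables and carries membership in \<open>Fil\<close>, which that rule demands of the remaining
  product.\<close>

lemma gr_mon: "pbw_data.mon Gr n gr_vars \<alpha> = gr_class (exp_size n \<alpha>) (mon \<alpha>)"
proof -
  let ?f = "\<lambda>is. foldr (\<lambda>i b. (x i [^] \<alpha> i) \<otimes> b) is \<one>"
  have "?f is \<in> Fil (int (sum_list (map \<alpha> is))) \<and>
      foldr (\<lambda>i b. (gr_vars i [^]\<^bsub>Gr\<^esub> \<alpha> i) \<otimes>\<^bsub>Gr\<^esub> b) is \<one>\<^bsub>Gr\<^esub> = gr_class (sum_list (map \<alpha> is)) (?f is)"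
    if "set is \<subseteq> {..<n}" for "is"
    using that
  proof (induction "is")
    case Nil
    then show ?case by (simp add: gr_class_one)
  next
    case (Cons i "is")
    then show ?case
      using Fil_mult[OF var_pow_Fil[of i "\<alpha> i"], of "?f is"]
        gr_class_mult[OF var_pow_Fil[of i "\<alpha> i"], of "?f is"]
      by (simp add: gr_vars_pow)
  qed
  from this[of "[0..<n]"] show ?thesis
    unfolding pbw_data.mon_def exp_size_def
    by (simp add: interv_sum_list_conv_sum_set_nat atLeast0LessThan)
qed

end


section \<open>The associated graded ring as a skew PBW extension\<close>

context skew_PBW_extension
begin

text \<open>\<open>gr_class 0\<close> maps \<open>R\<close> onto \<open>gr_base\<close> and only
  \<open>\<zero>\<close> to zero, so coefficient families correspond with equal supports.\<close>

lemma gr_coeff_families_iff: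
  "c' \<in> pbw_data.coeff_families Gr gr_base n \<longleftrightarrow> (\<exists>c\<in>coeff_families. c' = (\<lambda>\<alpha>. gr_class 0 (c \<alpha>)))"
proof
  assume "c' \<in> pbw_data.coeff_families Gr gr_base n"
  then have c': "\<And>\<alpha>. c' \<alpha> \<in> gr_class 0 ` R" "\<And>\<alpha>. \<alpha> \<notin> exponents n \<Longrightarrow> c' \<alpha> = \<zero>\<^bsub>Gr\<^esub>"
      "finite {\<alpha>. c' \<alpha> \<noteq> \<zero>\<^bsub>Gr\<^esub>}"
    unfolding pbw_data.coeff_families_def gr_base_def by blast+
  from c'(1) obtain c where c: "\<And>\<alpha>. c \<alpha> \<in> R" "\<And>\<alpha>. c' \<alpha> = gr_class 0 (c \<alpha>)"
    unfolding image_iff by metis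
  have "c \<in> coeff_families"
    using c' c(1) by (intro coeff_familiesI) (auto simp: c(2) gr_base_zero_iff)
  moreover have "c' = (\<lambda>\<alpha>. gr_class 0 (c \<alpha>))"
    using c(2) by (rule ext)
  ultimately show "\<exists>c\<in>coeff_families. c' = (\<lambda>\<alpha>. gr_class 0 (c \<alpha>))" by blast
next
  assume "\<exists>c\<in>coeff_families. c' = (\<lambda>\<alpha>. gr_class 0 (c \<alpha>))"
  then obtain c where c: "c \<in> coeff_families" "c' = (\<lambda>\<alpha>. gr_class 0 (c \<alpha>))" by blast
  show "c' \<in> pbw_data.coeff_families Gr gr_base n"
    unfolding pbw_data.coeff_families_def gr_base_def c(2)
    using coeff_familiesD[OF c(1)] by (simp add: gr_base_zero_iff)
qed

lemma homogeneous_part_families: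
  "c \<in> coeff_families \<Longrightarrow> (\<lambda>\<alpha>. if exp_size n \<alpha> = p then c \<alpha> else \<zero>) \<in> coeff_families"
  by (rule coeff_familiesI) (auto simp: coeff_familiesD intro: finite_subset[OF _ coeff_familiesD(3)])

lemma gr_lincomb:
  fixes c :: "(nat \<Rightarrow> nat) \<Rightarrow> 'a"
  defines "l \<equiv> \<lambda>p. lincomb (\<lambda>\<alpha>. if exp_size n \<alpha> = p then c \<alpha> else \<zero>)"
  assumes c: "c \<in> coeff_families"
  shows "l \<in> rees" and "pbw_data.lincomb Gr n gr_vars (\<lambda>\<alpha>. gr_class 0 (c \<alpha>)) = gr_seq l"
proof -
  interpret Gr: ring Gr by (rule ring_Gr)
  let ?S = "{\<alpha>. c \<alpha> \<noteq> \<zero>}"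
  have S: "finite ?S" "?S \<subseteq> exponents n" and cR: "\<And>\<alpha>. c \<alpha> \<in> R"
    using coeff_familiesD[OF c] by auto
  have t: "c \<alpha> \<otimes> mon \<alpha> \<in> Fil (int (exp_size n \<alpha>))" if "\<alpha> \<in> ?S" for \<alpha>
    using that S cR by (intro term_Fil) auto
  have l: "l = (\<lambda>p. \<Oplus>\<alpha>\<in>{\<alpha> \<in> ?S. exp_size n \<alpha> = p}. c \<alpha> \<otimes> mon \<alpha>)"
  proof
    fix p
    have "l p = (\<Oplus>\<alpha>\<in>{\<alpha> \<in> ?S. exp_size n \<alpha> = p}.
        (if exp_size n \<alpha> = p then c \<alpha> else \<zero>) \<otimes> mon \<alpha>)"
      unfolding l_def using S(1) by (intro lincomb_superset homogeneous_part_families c) auto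
    also have "\<dots> = (\<Oplus>\<alpha>\<in>{\<alpha> \<in> ?S. exp_size n \<alpha> = p}. c \<alpha> \<otimes> mon \<alpha>)"
      by (rule finsum_cong') (auto simp: cR)
    finally show "l p = (\<Oplus>\<alpha>\<in>{\<alpha> \<in> ?S. exp_size n \<alpha> = p}. c \<alpha> \<otimes> mon \<alpha>)" .
  qed
  show "l \<in> rees"
    unfolding l by (rule gr_seq_finsum(1)[OF S(1) t])
  have "pbw_data.lincomb Gr n gr_vars (\<lambda>\<alpha>. gr_class 0 (c \<alpha>)) =
      (\<Oplus>\<^bsub>Gr\<^esub>\<alpha>\<in>?S. gr_class 0 (c \<alpha>) \<otimes>\<^bsub>Gr\<^esub> gr_class (exp_size n \<alpha>) (mon \<alpha>))"
    unfolding pbw_data.lincomb_def gr_mon using cR by (simp add: gr_base_zero_iff)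
  also have "\<dots> = (\<Oplus>\<^bsub>Gr\<^esub>\<alpha>\<in>?S. gr_class (exp_size n \<alpha>) (c \<alpha> \<otimes> mon \<alpha>))"
  proof (rule Gr.finsum_cong')
    fix \<alpha> assume \<alpha>: "\<alpha> \<in> ?S"
    then have "mon \<alpha> \<in> Fil (int (exp_size n \<alpha>))" using S by (intro mon_Fil) auto
    then show "gr_class 0 (c \<alpha>) \<otimes>\<^bsub>Gr\<^esub> gr_class (exp_size n \<alpha>) (mon \<alpha>) =
        gr_class (exp_size n \<alpha>) (c \<alpha> \<otimes> mon \<alpha>)"
      using gr_class_mult[of "c \<alpha>" 0] cR by simp
  qed (use t gr_class_closed in auto)
  also have "\<dots> = gr_seq l"
    unfolding l by (rule gr_seq_finsum(2)[OF S(1) t])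
  finally show "pbw_data.lincomb Gr n gr_vars (\<lambda>\<alpha>. gr_class 0 (c \<alpha>)) = gr_seq l" .
qed

text \<open>Equality in \<open>Gr\<close> compares, for each \<open>p\<close>, the coefficients of
  size at least \<open>p\<close>. Those of larger size vanish on both sides; those of size
  \<open>p\<close> determine \<open>c\<close>. This yields uniqueness of coordinates, and existence
  together with \<open>rees_coeff_families\<close>.\<close>

lemma gr_seq_lincomb_iff:
  assumes f: "f \<in> rees" and c: "c \<in> coeff_families"
  shows "gr_seq f = pbw_data.lincomb Gr n gr_vars (\<lambda>\<alpha>. gr_class 0 (c \<alpha>)) \<longleftrightarrow>
    c = (\<lambda>\<alpha>. coeff (f (exp_size n \<alpha>)) \<alpha>)"
proof -
  let ?l = "\<lambda>p. lincomb (\<lambda>\<alpha>. if exp_size n \<alpha> = p then c \<alpha> else \<zero>)"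
  have l: "coeff (?l p) \<alpha> = (if exp_size n \<alpha> = p then c \<alpha> else \<zero>)" for p \<alpha>
    by (simp add: coeff_lincomb[OF homogeneous_part_families[OF c]])
  have lA: "?l p \<in> carrier A" for p
    by (rule lincomb_closed[OF homogeneous_part_families[OF c]])
  have cA: "c \<alpha> \<in> carrier A" for \<alpha>
    using coeff_familiesD(1)[OF c] by simp
  have fA: "f p \<in> carrier A" for p
    using reesD(2)[OF f] .
  have "gr_seq f = pbw_data.lincomb Gr n gr_vars (\<lambda>\<alpha>. gr_class 0 (c \<alpha>)) \<longleftrightarrow>
      (\<forall>p. f p \<ominus> ?l p \<in> Fil (int p - 1))"
    unfolding gr_lincomb(2)[OF c] by (rule gr_seq_eq_iff[OF f gr_lincomb(1)[OF c]])
  also have "\<dots> \<longleftrightarrow> (\<forall>p \<alpha>. int p \<le> int (exp_size n \<alpha>) \<longrightarrow> coeff (f p) \<alpha> \<ominus> coeff (?l p) \<alpha> = \<zero>)"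
    using fA lA by (auto simp: Fil_iff coeff_minus not_less not_le zle_diff1_eq) (meson not_less)+
  also have "\<dots> \<longleftrightarrow> (\<forall>p \<alpha>. p \<le> exp_size n \<alpha> \<longrightarrow> coeff (f p) \<alpha> = (if exp_size n \<alpha> = p then c \<alpha> else \<zero>))"
    unfolding l using fA cA by (simp add: r_right_minus_eq)
  also have "\<dots> \<longleftrightarrow> (\<forall>\<alpha>. c \<alpha> = coeff (f (exp_size n \<alpha>)) \<alpha>)"
  proof
    assume c: "\<forall>\<alpha>. c \<alpha> = coeff (f (exp_size n \<alpha>)) \<alpha>"
    have "coeff (f p) \<alpha> = \<zero>" if "p < exp_size n \<alpha>" for p \<alpha>
      using that reesD(1)[OF f, of p] by (intro Fil_coeff_zero[of _ "int p"]) auto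
    then show "\<forall>p \<alpha>. p \<le> exp_size n \<alpha> \<longrightarrow> coeff (f p) \<alpha> = (if exp_size n \<alpha> = p then c \<alpha> else \<zero>)"
      using c by auto
  qed auto
  finally show ?thesis by (simp add: fun_eq_iff)
qed

lemma rees_coeff_families:
  assumes f: "f \<in> rees"
  shows "(\<lambda>\<alpha>. coeff (f (exp_size n \<alpha>)) \<alpha>) \<in> coeff_families"
proof (rule coeff_familiesI)
  have "{\<alpha>. coeff (f (exp_size n \<alpha>)) \<alpha> \<noteq> \<zero>} \<subseteq> (\<Union>p\<in>{p. f p \<noteq> \<zero>}. {\<alpha>. coeff (f p) \<alpha> \<noteq> \<zero>})"
  proof
    fix \<alpha> assume "\<alpha> \<in> {\<alpha>. coeff (f (exp_size n \<alpha>)) \<alpha> \<noteq> \<zero>}"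
    then have "f (exp_size n \<alpha>) \<noteq> \<zero>" "coeff (f (exp_size n \<alpha>)) \<alpha> \<noteq> \<zero>"
      by (auto simp del: coeff_base)
    then show "\<alpha> \<in> (\<Union>p\<in>{p. f p \<noteq> \<zero>}. {\<alpha>. coeff (f p) \<alpha> \<noteq> \<zero>})" by blast
  qed
  then show "finite {\<alpha>. coeff (f (exp_size n \<alpha>)) \<alpha> \<noteq> \<zero>}"
    by (rule finite_subset) (use reesD[OF f] coeff_support_finite in blast)
qed (use reesD(2)[OF f] in \<open>simp_all add: coeff_outside\<close>)

text \<open>An equivalence, so that it gives both the basis property of \<open>Gr\<close> and the
  value of the definite description behind its \<open>coeff\<close>.\<close>

lemma gr_basis:
  assumes f: "f \<in> rees"
  shows "c' \<in> pbw_data.coeff_families Gr gr_base n \<and> gr_seq f = pbw_data.lincomb Gr n gr_vars c' \<longleftrightarrow>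
    c' = (\<lambda>\<alpha>. gr_class 0 (coeff (f (exp_size n \<alpha>)) \<alpha>))"
proof
  assume *: "c' \<in> pbw_data.coeff_families Gr gr_base n \<and> gr_seq f = pbw_data.lincomb Gr n gr_vars c'"
  then obtain c where c: "c \<in> coeff_families" "c' = (\<lambda>\<alpha>. gr_class 0 (c \<alpha>))"
    unfolding gr_coeff_families_iff by blast
  then have "c = (\<lambda>\<alpha>. coeff (f (exp_size n \<alpha>)) \<alpha>)"
    using * gr_seq_lincomb_iff[OF f c(1)] by simp
  then show "c' = (\<lambda>\<alpha>. gr_class 0 (coeff (f (exp_size n \<alpha>)) \<alpha>))" using c(2) by simp
next
  assume c': "c' = (\<lambda>\<alpha>. gr_class 0 (coeff (f (exp_size n \<alpha>)) \<alpha>))"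
  show "c' \<in> pbw_data.coeff_families Gr gr_base n \<and> gr_seq f = pbw_data.lincomb Gr n gr_vars c'"
    unfolding gr_coeff_families_iff c'
    using rees_coeff_families[OF f] gr_seq_lincomb_iff[OF f rees_coeff_families[OF f]] by fast
qed

lemma gr_coeff:
  assumes "f \<in> rees"
  shows "pbw_data.coeff Gr gr_base n gr_vars (gr_seq f) \<alpha> = gr_class 0 (coeff (f (exp_size n \<alpha>)) \<alpha>)"
  unfolding pbw_data.coeff_def gr_basis[OF assms] by simp

lemma gr_coeff_class:
  assumes "f \<in> Fil (int p)"
  shows "pbw_data.coeff Gr gr_base n gr_vars (gr_class p f) \<alpha> =
    (if exp_size n \<alpha> = p then gr_class 0 (coeff f \<alpha>) else \<zero>\<^bsub>Gr\<^esub>)"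
  unfolding gr_class_eq_gr_seq[of p f] gr_coeff[OF rees_class[OF assms]] by simp

text \<open>The defining relations lose their lower terms: the scalar remainder lies below degree 1
  and the affine remainder below degree 2. In \<open>Gr\<close> the variables thus commute with
  scalars and with each other exactly up to the same constants \<open>c\<close>, and the required
  remainders are zero.\<close>

lemma gr_skew_PBW_extension: "skew_PBW_extension Gr gr_base n gr_vars"
proof -
  interpret Gr: ring Gr by (rule ring_Gr)
  have base: "gr_class 0 r \<in> carrier Gr" if "r \<in> R" for r
    using gr_class_closed[of r 0] that by simp
  have vars: "gr_vars i \<in> carrier Gr" if "i < n" for i
    using gr_class_closed[of "x i" 1] var_Fil1[OF that] that by (simp add: gr_vars_eq)
  have zero_base': "\<zero>\<^bsub>Gr\<^esub> \<in> gr_base"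
    unfolding gr_base_def using gr_class_zero[of 0, symmetric] zero_base by (rule image_eqI)
  show ?thesis
  proof (intro skew_PBW_extension.intro skew_PBW_extension_axioms.intro ring_Gr)
    show "subring gr_base Gr"
    proof (rule Gr.subringI)
      show "gr_base \<subseteq> carrier Gr"
        using base by (auto simp: gr_base_def)
      show "\<one>\<^bsub>Gr\<^esub> \<in> gr_base"
        unfolding gr_base_def gr_class_one[symmetric] by simp
    next
      fix u assume "u \<in> gr_base"
      then show "\<ominus>\<^bsub>Gr\<^esub> u \<in> gr_base"
        by (auto simp: gr_base_def gr_class_uminus)
    next
      fix u v assume "u \<in> gr_base" "v \<in> gr_base"
      then show "u \<otimes>\<^bsub>Gr\<^esub> v \<in> gr_base" "u \<oplus>\<^bsub>Gr\<^esub> v \<in> gr_base"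
        by (auto simp: gr_base_def gr_class_mult gr_class_add)
    qed
    show "pbw_data.free_left_basis Gr gr_base n gr_vars"
      unfolding pbw_data.free_left_basis_def carrier_Gr by (auto simp: gr_basis)
  next
    fix i u assume i: "i < n" and "u \<in> gr_base - {\<zero>\<^bsub>Gr\<^esub>}"
    then obtain r where r: "r \<in> R" "r \<noteq> \<zero>" "u = gr_class 0 r"
      using gr_base_zero_iff unfolding gr_base_def by blast
    obtain c d where c: "c \<in> R" "d \<in> R" "x i \<otimes> r = c \<otimes> x i \<oplus> d" "c \<noteq> \<zero>"
      using var_scalarE[OF i r(1)] r(2) by metis
    have X: "x i \<in> Fil 1" "x i \<in> carrier A" using var_Fil1 vars_closed i by auto
    have F: "x i \<otimes> r \<in> Fil 1" "c \<otimes> x i \<in> Fil 1"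
      using Fil_mult[OF X(1), of r 0] Fil_smult[OF c(1) X(1)] r by auto
    have "gr_vars i \<otimes>\<^bsub>Gr\<^esub> u = gr_class 1 (x i \<otimes> r)"
      using gr_class_mult[of "x i" 1 r 0] X r i by (simp add: gr_vars_eq)
    \<comment> \<open>The representatives differ by \<open>d \<in> Fil 0\<close>, which is divided
      out in degree 1.\<close>
    also have "\<dots> = gr_class 1 (c \<otimes> x i)"
      using F c X by (simp add: gr_class_eq_iff add_minus_cancel_left)
    also have "\<dots> = gr_class 0 c \<otimes>\<^bsub>Gr\<^esub> gr_vars i"
      using gr_class_mult[of c 0 "x i" 1] X c i by (simp add: gr_vars_eq)
    finally have eq: "gr_vars i \<otimes>\<^bsub>Gr\<^esub> u = gr_class 0 c \<otimes>\<^bsub>Gr\<^esub> gr_vars i" .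
    have "gr_vars i \<otimes>\<^bsub>Gr\<^esub> u \<ominus>\<^bsub>Gr\<^esub> gr_class 0 c \<otimes>\<^bsub>Gr\<^esub> gr_vars i = gr_class 0 \<zero>"
      unfolding eq using base[OF c(1)] vars[OF i] by (simp add: Gr.r_neg Gr.minus_eq)
    then show "\<exists>c\<in>gr_base - {\<zero>\<^bsub>Gr\<^esub>}. gr_vars i \<otimes>\<^bsub>Gr\<^esub> u \<ominus>\<^bsub>Gr\<^esub> c \<otimes>\<^bsub>Gr\<^esub> gr_vars i \<in> gr_base"
      using c(1,4) gr_base_zero_iff[OF c(1)] zero_base' unfolding gr_base_def
      by (intro bexI[of _ "gr_class 0 c"]) (auto intro: imageI)
  next
    fix i j assume i: "i < n" and j: "j < n"
    obtain c where c: "c \<in> R - {\<zero>}" "x j \<otimes> x i \<ominus> c \<otimes> (x i \<otimes> x j) \<in> affine_span"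
      using var_var[OF i j] by blast
    then obtain r s where rs: "r \<in> R" "s \<in> {..<n} \<rightarrow> R"
        "x j \<otimes> x i \<ominus> c \<otimes> (x i \<otimes> x j) = r \<oplus> (\<Oplus>k\<in>{..<n}. s k \<otimes> x k)"
      unfolding affine_span_def by auto
    have X: "x k \<in> Fil 1" if "k < n" for k using var_Fil1 that .
    have XX: "x i \<otimes> x j \<in> Fil 2" "x j \<otimes> x i \<in> Fil 2"
      using Fil_mult[OF X X] i j by fastforce+
    have low: "x j \<otimes> x i \<ominus> c \<otimes> (x i \<otimes> x j) \<in> Fil 1"
    proof -
      have "s k \<otimes> x k \<in> Fil 1" if "k \<in> {..<n}" for k
        using that rs(2) X by (auto intro: Fil_smult)
      then show ?thesis
        unfolding rs(3) by (intro Fil_add base_Fil[OF rs(1)] Fil_finsum) auto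
    qed
    have "gr_vars j \<otimes>\<^bsub>Gr\<^esub> gr_vars i = gr_class 2 (x j \<otimes> x i)"
      using gr_class_mult[of "x j" 1 "x i" 1] X i j by (simp add: gr_vars_eq numeral_2_eq_2)
    also have "\<dots> = gr_class 2 (c \<otimes> (x i \<otimes> x j))"
      using XX c(1) low by (simp add: gr_class_eq_iff Fil_smult)
    also have "\<dots> = gr_class 0 c \<otimes>\<^bsub>Gr\<^esub> gr_class 2 (x i \<otimes> x j)"
      using gr_class_mult[of c 0 "x i \<otimes> x j" 2] XX c(1) by (simp add: numeral_2_eq_2)
    also have "gr_class 2 (x i \<otimes> x j) = gr_vars i \<otimes>\<^bsub>Gr\<^esub> gr_vars j"
      using gr_class_mult[of "x i" 1 "x j" 1] X i j by (simp add: gr_vars_eq numeral_2_eq_2)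
    finally have eq: "gr_vars j \<otimes>\<^bsub>Gr\<^esub> gr_vars i = gr_class 0 c \<otimes>\<^bsub>Gr\<^esub> (gr_vars i \<otimes>\<^bsub>Gr\<^esub> gr_vars j)" .
    have z: "gr_vars j \<otimes>\<^bsub>Gr\<^esub> gr_vars i \<ominus>\<^bsub>Gr\<^esub> gr_class 0 c \<otimes>\<^bsub>Gr\<^esub> (gr_vars i \<otimes>\<^bsub>Gr\<^esub> gr_vars j) = \<zero>\<^bsub>Gr\<^esub>"
      unfolding eq using base[of c] c(1) vars i j by (simp add: Gr.r_neg Gr.minus_eq)
    have sum0: "\<zero>\<^bsub>Gr\<^esub> \<oplus>\<^bsub>Gr\<^esub> (\<Oplus>\<^bsub>Gr\<^esub>k\<in>{..<n}. \<zero>\<^bsub>Gr\<^esub> \<otimes>\<^bsub>Gr\<^esub> gr_vars k) = \<zero>\<^bsub>Gr\<^esub>"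
    proof -
      have "(\<Oplus>\<^bsub>Gr\<^esub>k\<in>{..<n}. \<zero>\<^bsub>Gr\<^esub> \<otimes>\<^bsub>Gr\<^esub> gr_vars k) = (\<Oplus>\<^bsub>Gr\<^esub>k\<in>{..<n}. \<zero>\<^bsub>Gr\<^esub>)"
        using vars by (intro Gr.finsum_cong') auto
      then show ?thesis by simp
    qed
    have "\<zero>\<^bsub>Gr\<^esub> \<in> pbw_data.affine_span Gr gr_base n gr_vars"
      unfolding pbw_data.affine_span_def mem_Collect_eq
      by (rule exI[of _ "\<zero>\<^bsub>Gr\<^esub>"], rule exI[of _ "\<lambda>_. \<zero>\<^bsub>Gr\<^esub>"]) (simp add: sum0 zero_base')
    then show "\<exists>c\<in>gr_base - {\<zero>\<^bsub>Gr\<^esub>}. gr_vars j \<otimes>\<^bsub>Gr\<^esub> gr_vars i \<ominus>\<^bsub>Gr\<^esub>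
        c \<otimes>\<^bsub>Gr\<^esub> (gr_vars i \<otimes>\<^bsub>Gr\<^esub> gr_vars j) \<in> pbw_data.affine_span Gr gr_base n gr_vars"
      using c(1) gr_base_zero_iff[of c] z unfolding gr_base_def
      by (intro bexI[of _ "gr_class 0 c"]) auto
  qed (rule vars)
qed

section \<open>Transfer of the constants and of left ideals to \<open>Gr\<close>\<close>

lemma gr_sigma:
  assumes \<alpha>: "\<alpha> \<in> exponents n" and r: "r \<in> R" "r \<noteq> \<zero>"
  shows "pbw_data.sigma Gr gr_base n gr_vars \<alpha> (gr_class 0 r) = gr_class 0 (sigma \<alpha> r)"
proof -
  have F: "mon \<alpha> \<in> Fil (int (exp_size n \<alpha>))" "r \<in> Fil (int 0)"
    using mon_Fil \<alpha> r by auto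
  have "pbw_data.sigma Gr gr_base n gr_vars \<alpha> (gr_class 0 r) =
      pbw_data.coeff Gr gr_base n gr_vars (pbw_data.mon Gr n gr_vars \<alpha> \<otimes>\<^bsub>Gr\<^esub> gr_class 0 r) \<alpha>"
    using r \<alpha> gr_base_zero_iff[OF r(1)]
    by (intro skew_PBW_extension.sigma_eq[OF gr_skew_PBW_extension]) (auto simp: gr_base_def)
  also have "\<dots> = gr_class 0 (coeff (mon \<alpha> \<otimes> r) \<alpha>)"
    using Fil_mult[OF F] by (simp add: gr_mon gr_class_mult[OF F] gr_coeff_class)
  finally show ?thesis using sigma_eq[OF assms] by simp
qed

lemma gr_struct_const:
  assumes \<alpha>: "\<alpha> \<in> exponents n" and \<beta>: "\<beta> \<in> exponents n"
  shows "pbw_data.struct_const Gr gr_base n gr_vars \<alpha> \<beta> = gr_class 0 (struct_const \<alpha> \<beta>)"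
proof -
  have F: "mon \<alpha> \<in> Fil (int (exp_size n \<alpha>))" "mon \<beta> \<in> Fil (int (exp_size n \<beta>))"
    using mon_Fil \<alpha> \<beta> by auto
  have "pbw_data.struct_const Gr gr_base n gr_vars \<alpha> \<beta> = pbw_data.coeff Gr gr_base n gr_vars
      (pbw_data.mon Gr n gr_vars \<alpha> \<otimes>\<^bsub>Gr\<^esub> pbw_data.mon Gr n gr_vars \<beta>) (exp_add \<alpha> \<beta>)"
    by (rule skew_PBW_extension.struct_const_eq[OF gr_skew_PBW_extension \<alpha> \<beta>])
  also have "\<dots> = gr_class 0 (coeff (mon \<alpha> \<otimes> mon \<beta>) (exp_add \<alpha> \<beta>))"
    using Fil_mult[OF F] by (simp add: gr_mon gr_class_mult[OF F] gr_coeff_class exp_size_add)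
  finally show ?thesis using struct_const_eq[OF assms] by simp
qed

text \<open>Negatives come from multiplication by \<open>\<ominus> \<one> \<in> R\<close>. Without
  the restricted ring record on the right side, ideals can be moved along \<open>gr_class 0\<close>
  element by element.\<close>

lemma left_ideal_iff:
  "additive_subgroup I (A\<lparr>carrier := R\<rparr>) \<and> (\<forall>r\<in>R. \<forall>a\<in>I. r \<otimes> a \<in> I) \<longleftrightarrow>
    I \<subseteq> R \<and> \<zero> \<in> I \<and> (\<forall>a\<in>I. \<forall>b\<in>I. a \<oplus> b \<in> I) \<and> (\<forall>r\<in>R. \<forall>a\<in>I. r \<otimes> a \<in> I)"
  (is "?L \<longleftrightarrow> ?R")
proof
  assume L: ?L
  then interpret I: additive_subgroup I "A\<lparr>carrier := R\<rparr>" by blast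
  show ?R
    using L I.a_subset I.zero_closed I.a_closed by auto
next
  interpret B: ring "A\<lparr>carrier := R\<rparr>" by (rule subring_is_ring[OF base_subring])
  assume R: ?R
  have "\<ominus>\<^bsub>A\<lparr>carrier := R\<rparr>\<^esub> a \<in> I" if a: "a \<in> I" for a
  proof -
    have aR: "a \<in> R" using a R by blast
    have "(\<ominus> \<one>) \<otimes> a \<in> I" using R a by simp
    moreover have "(\<ominus> \<one>) \<otimes> a = \<ominus> a" using aR by (simp add: l_minus)
    moreover have "\<ominus>\<^bsub>A\<lparr>carrier := R\<rparr>\<^esub> a = \<ominus> a"
      using aR by (intro B.minus_equality) (auto simp: l_neg)
    ultimately show ?thesis by simp
  qed
  then have "additive_subgroup I (A\<lparr>carrier := R\<rparr>)"
    using R by (intro additive_subgroupI B.add.subgroupI) (auto simp flip: a_inv_def)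
  then show ?L using R by blast
qed

lemma left_ideal_genD:
  assumes "a \<in> left_ideal_gen S" "I \<subseteq> R" "\<zero> \<in> I" "\<forall>a\<in>I. \<forall>b\<in>I. a \<oplus> b \<in> I"
    "\<forall>r\<in>R. \<forall>a\<in>I. r \<otimes> a \<in> I" "S \<subseteq> I"
  shows "a \<in> I"
  using assms left_ideal_iff[of I] unfolding left_ideal_gen_def by simp

lemma left_ideal_genI:
  assumes "\<And>I. \<lbrakk>I \<subseteq> R; \<zero> \<in> I; \<forall>a\<in>I. \<forall>b\<in>I. a \<oplus> b \<in> I; \<forall>r\<in>R. \<forall>a\<in>I. r \<otimes> a \<in> I; S \<subseteq> I\<rbrakk>
    \<Longrightarrow> a \<in> I"
  shows "a \<in> left_ideal_gen S"
  unfolding left_ideal_gen_def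
proof (intro InterI)
  fix I assume I: "I \<in> {I. additive_subgroup I (A\<lparr>carrier := R\<rparr>) \<and>
    (\<forall>r\<in>R. \<forall>a\<in>I. r \<otimes> a \<in> I) \<and> S \<subseteq> I}"
  with left_ideal_iff[of I] show "a \<in> I" by (intro assms) simp_all
qed

text \<open>A generated ideal is an intersection, so each direction starts from an arbitrary ideal
  on the side to be proved: an ideal of \<open>R\<close> is replaced by its image in
  \<open>gr_base\<close>, an ideal of \<open>gr_base\<close> by its preimage in \<open>R\<close>.
  Injectivity of \<open>gr_class 0\<close> leads back from the image to
  \<open>r \<in> I\<close>.\<close>

lemma gr_left_ideal_gen:
  assumes S: "S \<subseteq> R" and r: "r \<in> R"
  shows "gr_class 0 r \<in> pbw_data.left_ideal_gen Gr gr_base (gr_class 0 ` S) \<longleftrightarrow> r \<in> left_ideal_gen S"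
proof -
  let ?h = "gr_class 0"
  note hom = gr_class_add[of _ 0, simplified] gr_class_mult[of _ 0 _ 0, simplified]
  show ?thesis
  proof
    assume *: "?h r \<in> pbw_data.left_ideal_gen Gr gr_base (?h ` S)"
    show "r \<in> left_ideal_gen S"
    proof (rule left_ideal_genI)
      fix I assume I: "I \<subseteq> R" "\<zero> \<in> I" "\<forall>a\<in>I. \<forall>b\<in>I. a \<oplus> b \<in> I" "\<forall>r\<in>R. \<forall>a\<in>I. r \<otimes> a \<in> I" "S \<subseteq> I"
      have IR: "a \<in> R" if "a \<in> I" for a using I(1) that by blast
      have "?h ` I \<subseteq> gr_base" using I(1) unfolding gr_base_def by blast
      moreover have "\<zero>\<^bsub>Gr\<^esub> \<in> ?h ` I" using I(2) gr_class_zero by (metis imageI)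
      moreover have "\<forall>a\<in>?h ` I. \<forall>b\<in>?h ` I. a \<oplus>\<^bsub>Gr\<^esub> b \<in> ?h ` I"
        using I(3) IR by (auto simp: hom)
      moreover have "\<forall>r\<in>gr_base. \<forall>a\<in>?h ` I. r \<otimes>\<^bsub>Gr\<^esub> a \<in> ?h ` I"
        using I(4) IR by (auto simp: hom gr_base_def)
      moreover have "?h ` S \<subseteq> ?h ` I" using I(5) by blast
      ultimately have "?h r \<in> ?h ` I"
        by (rule skew_PBW_extension.left_ideal_genD[OF gr_skew_PBW_extension *])
      then show "r \<in> I" using IR r gr_base_eq_iff by blast
    qed
  next
    assume *: "r \<in> left_ideal_gen S"
    show "?h r \<in> pbw_data.left_ideal_gen Gr gr_base (?h ` S)"
    proof (rule skew_PBW_extension.left_ideal_genI[OF gr_skew_PBW_extension])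
      fix I' assume I': "I' \<subseteq> gr_base" "\<zero>\<^bsub>Gr\<^esub> \<in> I'" "\<forall>a\<in>I'. \<forall>b\<in>I'. a \<oplus>\<^bsub>Gr\<^esub> b \<in> I'"
        "\<forall>r\<in>gr_base. \<forall>a\<in>I'. r \<otimes>\<^bsub>Gr\<^esub> a \<in> I'" "?h ` S \<subseteq> I'"
      let ?I = "{r \<in> R. ?h r \<in> I'}"
      have "\<forall>a\<in>?I. \<forall>b\<in>?I. a \<oplus> b \<in> ?I"
        using I'(3) by (auto simp flip: hom)
      moreover have "\<forall>r\<in>R. \<forall>a\<in>?I. r \<otimes> a \<in> ?I"
        using I'(4) by (auto simp: gr_base_def simp flip: hom(2))
      moreover have "S \<subseteq> ?I" "\<zero> \<in> ?I" "?I \<subseteq> R" using S I'(2,5) by auto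
      ultimately have "r \<in> ?I" by (intro left_ideal_genD[OF *]) assumption
      then show "?h r \<in> I'" by blast
    qed
  qed
qed

end


section \<open>Free modules and leading monomials\<close>

context ring
begin

lemma free_module_simps [simp]:
  "carrier (free_module R m) = {..<m} \<rightarrow>\<^sub>E carrier R"
  "\<zero>\<^bsub>free_module R m\<^esub> = (\<lambda>i\<in>{..<m}. \<zero>)"
  "f \<oplus>\<^bsub>free_module R m\<^esub> g = (\<lambda>i\<in>{..<m}. f i \<oplus> g i)"
  "a \<odot>\<^bsub>free_module R m\<^esub> f = (\<lambda>i\<in>{..<m}. a \<otimes> f i)"
  by (simp_all add: free_module_def)

lemma free_module_carrierD: "f \<in> {..<m} \<rightarrow>\<^sub>E carrier R \<Longrightarrow> i < m \<Longrightarrow> f i \<in> carrier R"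
  by auto

lemma free_module_eqI:
  "\<lbrakk>f \<in> {..<m} \<rightarrow>\<^sub>E carrier R; g \<in> {..<m} \<rightarrow>\<^sub>E carrier R; \<And>i. i < m \<Longrightarrow> f i = g i\<rbrakk> \<Longrightarrow> f = g"
  by (rule PiE_ext) auto

lemma free_module_l_inv:
  "f \<in> {..<m} \<rightarrow>\<^sub>E carrier R \<Longrightarrow>
    ((\<ominus> \<one>) \<odot>\<^bsub>free_module R m\<^esub> f) \<oplus>\<^bsub>free_module R m\<^esub> f = \<zero>\<^bsub>free_module R m\<^esub>"
  by (simp, rule restrict_ext) (simp add: free_module_carrierD l_minus l_neg)

lemma free_module_abelian_group: "abelian_group (free_module R m)"
proof (rule abelian_groupI)
  fix f assume f: "f \<in> carrier (free_module R m)"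
  then show "\<zero>\<^bsub>free_module R m\<^esub> \<oplus>\<^bsub>free_module R m\<^esub> f = f"
    by (intro free_module_eqI[of _ m]) (simp_all add: free_module_carrierD restrict_PiE_iff)
  have "(\<ominus> \<one>) \<odot>\<^bsub>free_module R m\<^esub> f \<in> carrier (free_module R m)"
    using f by (simp add: free_module_carrierD restrict_PiE_iff)
  then show "\<exists>g\<in>carrier (free_module R m). g \<oplus>\<^bsub>free_module R m\<^esub> f = \<zero>\<^bsub>free_module R m\<^esub>"
    using f free_module_l_inv[of f m] by (metis free_module_simps(1))
qed (simp_all add: free_module_carrierD restrict_PiE_iff a_ac cong: restrict_cong)

text \<open>Additive inverses are multiples by \<open>\<ominus> \<one>\<close>, so closure under
  sums and left multiples suffices. \<open>R\<close> is the scalar ring here; the lemma serves both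
  \<open>A\<close> and \<open>Gr\<close>.\<close>

lemma submodule_free_iff:
  "submodule M R (free_module R m) \<longleftrightarrow>
    M \<subseteq> {..<m} \<rightarrow>\<^sub>E carrier R \<and> (\<lambda>i\<in>{..<m}. \<zero>) \<in> M \<and>
    (\<forall>f\<in>M. \<forall>g\<in>M. (\<lambda>i\<in>{..<m}. f i \<oplus> g i) \<in> M) \<and>
    (\<forall>a\<in>carrier R. \<forall>f\<in>M. (\<lambda>i\<in>{..<m}. a \<otimes> f i) \<in> M)" (is "?L \<longleftrightarrow> ?R")
proof
  assume ?L
  then interpret submodule M R "free_module R m" .
  show ?R
    using subset one_closed m_closed smult_closed by simp
next
  interpret F: abelian_group "free_module R m" by (rule free_module_abelian_group)
  assume M: ?R
  have "\<ominus>\<^bsub>free_module R m\<^esub> f \<in> M" if f: "f \<in> M" for f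
  proof -
    have "f \<in> {..<m} \<rightarrow>\<^sub>E carrier R" using M f by blast
    then have "\<ominus>\<^bsub>free_module R m\<^esub> f = (\<ominus> \<one>) \<odot>\<^bsub>free_module R m\<^esub> f"
      by (intro F.minus_equality free_module_l_inv)
        (simp_all add: free_module_carrierD restrict_PiE_iff)
    then show ?thesis using M f by simp
  qed
  then have "subgroup M (add_monoid (free_module R m))"
    using M by (intro F.add.subgroupI) auto
  then show ?L
    using M by (simp add: submodule_def submodule_axioms_def)
qed

end

lemma linear_order_on_finite_greatest:
  assumes "finite S" "S \<noteq> {}" "S \<subseteq> B" "linear_order_on B r"
  shows "\<exists>X\<in>S. \<forall>Y\<in>S. (Y, X) \<in> r"
  using assms(1-3)
proof (induction S rule: finite_ne_induct)
  case (singleton X)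
  then show ?case
    using assms(4) by (auto simp: order_on_defs refl_on_def)
next
  case (insert X S)
  then obtain Z where Z: "Z \<in> S" "\<forall>Y\<in>S. (Y, Z) \<in> r" by auto
  have "trans r" and XZ: "(X, Z) \<in> r \<or> (Z, X) \<in> r" and "(X, X) \<in> r"
    using assms(4) insert.prems Z(1)
    by (cases "X = Z"; auto simp: order_on_defs refl_on_def total_on_def)+
  then show ?case
    using Z by (auto dest: transD)
qed

context pbw_data
begin

text \<open>Relational form of leading data. \<open>lm\<close> and \<open>lc\<close> are definite
  descriptions on monomial vectors; the pair \<open>\<alpha>\<close>, \<open>i\<close> is meaningful
  over \<open>A\<close> and over \<open>Gr\<close> alike, so statements are transferred by keeping
  the pair.\<close>

definition leads_at ::
    "nat \<Rightarrow> ((nat \<Rightarrow> 'a) \<times> (nat \<Rightarrow> 'a)) set \<Rightarrow> (nat \<Rightarrow> 'a) \<Rightarrow> (nat \<Rightarrow> nat) \<Rightarrow> nat \<Rightarrow> bool"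
  where "leads_at m ord f \<alpha> i \<longleftrightarrow> \<alpha> \<in> exponents n \<and> i < m \<and> coeff (f i) \<alpha> \<noteq> \<zero> \<and>
    (\<forall>\<beta>\<in>exponents n. \<forall>j<m. coeff (f j) \<beta> \<noteq> \<zero> \<longrightarrow> (vmon m \<beta> j, vmon m \<alpha> i) \<in> ord)"

lemma monomial_order_linear: "monomial_order m ord \<Longrightarrow> linear_order_on (Mon m) ord"
  by (simp add: monomial_order_def)

end

text \<open>Over the zero ring all monomials coincide.\<close>

locale nontrivial_skew_PBW_extension = skew_PBW_extension +
  assumes one_not_zero: "\<one> \<noteq> \<zero>"
begin

section \<open>Monomial vectors, leading data and degrees of vectors\<close>

lemma vmon_closed [simp]: "vmon m \<alpha> i \<in> {..<m} \<rightarrow>\<^sub>E carrier A"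
  by (auto simp: vmon_def)

text \<open>Exponent and position are recovered from entry \<open>i\<close>, whose coefficient at
  \<open>\<alpha>\<close> is \<open>\<one>\<close>, distinct from \<open>\<zero>\<close>. This gives
  \<open>vexp\<close> and \<open>vpos\<close> their intended values.\<close>

lemma vmon_eq_iff:
  assumes "\<alpha> \<in> exponents n" "\<beta> \<in> exponents n" "i < m" "j < m"
  shows "vmon m \<alpha> i = vmon m \<beta> j \<longleftrightarrow> \<alpha> = \<beta> \<and> i = j"
proof
  assume "vmon m \<alpha> i = vmon m \<beta> j"
  then have "vmon m \<alpha> i i = vmon m \<beta> j i" by simp
  then have "mon \<alpha> = (if i = j then mon \<beta> else \<zero>)"
    using assms by (simp add: vmon_def)
  then have "coeff (mon \<alpha>) \<alpha> = coeff (if i = j then mon \<beta> else \<zero>) \<alpha>"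
    by simp
  then show "\<alpha> = \<beta> \<and> i = j"
    using assms one_not_zero by (auto simp: coeff_mon split: if_splits)
qed auto

lemma vexp_vmon [simp]: "\<alpha> \<in> exponents n \<Longrightarrow> i < m \<Longrightarrow> vexp m (vmon m \<alpha> i) = \<alpha>"
  unfolding vexp_def by (rule the_equality) (auto simp: vmon_eq_iff)

lemma vpos_vmon [simp]: "\<alpha> \<in> exponents n \<Longrightarrow> i < m \<Longrightarrow> vpos m (vmon m \<alpha> i) = i"
  unfolding vpos_def by (rule the_equality) (auto simp: vmon_eq_iff)

lemma vcoeff_vmon [simp]:
  "\<alpha> \<in> exponents n \<Longrightarrow> i < m \<Longrightarrow> vcoeff m f (vmon m \<alpha> i) = coeff (f i) \<alpha>"
  by (simp add: vcoeff_def)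

lemma mdeg_vmon [simp]: "\<alpha> \<in> exponents n \<Longrightarrow> i < m \<Longrightarrow> mdeg m (vmon m \<alpha> i) = exp_size n \<alpha>"
  by (simp add: mdeg_def)

lemma vmonomials_eq:
  "vmonomials m f = {vmon m \<alpha> i | \<alpha> i. \<alpha> \<in> exponents n \<and> i < m \<and> coeff (f i) \<alpha> \<noteq> \<zero>}"
  unfolding vmonomials_def Mon_def by (auto simp: vcoeff_vmon) (metis vcoeff_vmon)

lemma vmonomials_finite:
  assumes f: "f \<in> {..<m} \<rightarrow>\<^sub>E carrier A"
  shows "finite (vmonomials m f)"
proof -
  have "vmonomials m f \<subseteq> (\<Union>i\<in>{..<m}. (\<lambda>\<alpha>. vmon m \<alpha> i) ` {\<alpha>. coeff (f i) \<alpha> \<noteq> \<zero>})"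
    unfolding vmonomials_eq by blast
  moreover have "finite \<dots>"
    using free_module_carrierD[OF f] coeff_support_finite by simp
  ultimately show ?thesis by (rule finite_subset)
qed

lemma vmonomials_nonempty:
  assumes f: "f \<in> {..<m} \<rightarrow>\<^sub>E carrier A" and nz: "f \<noteq> (\<lambda>i\<in>{..<m}. \<zero>)"
  shows "vmonomials m f \<noteq> {}"
proof -
  obtain i where i: "i < m" "f i \<noteq> \<zero>"
    using nz free_module_eqI[OF f, of "\<lambda>i\<in>{..<m}. \<zero>"] by auto
  note fi = free_module_carrierD[OF f i(1)]
  obtain \<alpha> where "coeff (f i) \<alpha> \<noteq> \<zero>"
    using coeff_nonzero[OF fi i(2)] by blast
  then show ?thesis
    using i(1) coeff_outside[OF fi, of \<alpha>] unfolding vmonomials_eq by blast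
qed

lemma leads_at_exists:
  assumes "linear_order_on (Mon m) ord"
    and "f \<in> {..<m} \<rightarrow>\<^sub>E carrier A" "f \<noteq> (\<lambda>i\<in>{..<m}. \<zero>)"
  obtains \<alpha> i where "leads_at m ord f \<alpha> i"
proof -
  obtain X where X: "X \<in> vmonomials m f" "\<forall>Y\<in>vmonomials m f. (Y, X) \<in> ord"
    using linear_order_on_finite_greatest[OF vmonomials_finite[OF assms(2)]
        vmonomials_nonempty[OF assms(2,3)] _ assms(1)]
    unfolding vmonomials_def by auto
  then show thesis
    using that unfolding leads_at_def vmonomials_eq by blast
qed

text \<open>Antisymmetry of the order makes the greatest monomial unique, so the description in
  \<open>lm\<close> is met only by the given pair.\<close>

lemma leads_atD:
  assumes ord: "linear_order_on (Mon m) ord" and lead: "leads_at m ord f \<alpha> i"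
  shows "lm m ord f = vmon m \<alpha> i" "lc m ord f = coeff (f i) \<alpha>"
    "vexp m (lm m ord f) = \<alpha>" "vpos m (lm m ord f) = i"
proof -
  have \<alpha>: "\<alpha> \<in> exponents n" "i < m" using lead unfolding leads_at_def by auto
  have "antisym ord" using ord by (simp add: order_on_defs)
  show lm: "lm m ord f = vmon m \<alpha> i"
    unfolding lm_def
  proof (rule the_equality)
    show *: "vmon m \<alpha> i \<in> vmonomials m f \<and> (\<forall>Y\<in>vmonomials m f. (Y, vmon m \<alpha> i) \<in> ord)"
      using lead unfolding leads_at_def vmonomials_eq by blast
    show "X = vmon m \<alpha> i" if "X \<in> vmonomials m f \<and> (\<forall>Y\<in>vmonomials m f. (Y, X) \<in> ord)" for X
      using that * antisymD[OF \<open>antisym ord\<close>] by blast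
  qed
  show "lc m ord f = coeff (f i) \<alpha>" "vexp m (lm m ord f) = \<alpha>" "vpos m (lm m ord f) = i"
    unfolding lc_def lm using \<alpha> by simp_all
qed

lemma vdeg_le_iff:
  assumes f: "f \<in> {..<m} \<rightarrow>\<^sub>E carrier A" and nz: "f \<noteq> (\<lambda>i\<in>{..<m}. \<zero>)"
  shows "vdeg m f \<le> k \<longleftrightarrow> (\<forall>i<m. f i \<in> Fil (int k))"
proof -
  have "vdeg m f \<le> k \<longleftrightarrow> (\<forall>X\<in>vmonomials m f. mdeg m X \<le> k)"
    unfolding vdeg_def using vmonomials_finite[OF f] vmonomials_nonempty[OF f nz]
    by (subst Max_le_iff) auto
  also have "\<dots> \<longleftrightarrow> (\<forall>i<m. \<forall>\<alpha>. coeff (f i) \<alpha> \<noteq> \<zero> \<longrightarrow> exp_size n \<alpha> \<le> k)"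
  proof
    assume *: "\<forall>X\<in>vmonomials m f. mdeg m X \<le> k"
    show "\<forall>i<m. \<forall>\<alpha>. coeff (f i) \<alpha> \<noteq> \<zero> \<longrightarrow> exp_size n \<alpha> \<le> k"
    proof (intro allI impI)
      fix i \<alpha> assume i: "i < m" "coeff (f i) \<alpha> \<noteq> \<zero>"
      then have "\<alpha> \<in> exponents n" using coeff_outside free_module_carrierD[OF f i(1)] by blast
      moreover from this have "vmon m \<alpha> i \<in> vmonomials m f"
        using i unfolding vmonomials_eq by blast
      ultimately show "exp_size n \<alpha> \<le> k" using * i(1) by fastforce
    qed
  qed (auto simp: vmonomials_eq)
  also have "\<dots> \<longleftrightarrow> (\<forall>i<m. f i \<in> Fil (int k))"
    using free_module_carrierD[OF f] by (simp add: Fil_iff)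
  finally show ?thesis .
qed

lemma vdeg_Fil:
  assumes "f \<in> {..<m} \<rightarrow>\<^sub>E carrier A" "i < m"
  shows "f i \<in> Fil (int (vdeg m f))"
  using vdeg_le_iff[OF assms(1), of "vdeg m f"] assms(2)
  by (cases "f = (\<lambda>i\<in>{..<m}. \<zero>)") auto

text \<open>The filtration of a set of vectors is induced entrywise by that of \<open>A\<close>, so
  the lemmas on \<open>Fil\<close> apply to it. For \<open>p < 0\<close> both sides leave only the
  zero vector.\<close>

lemma vFil_iff:
  assumes M: "M \<subseteq> {..<m} \<rightarrow>\<^sub>E carrier A" "(\<lambda>i\<in>{..<m}. \<zero>) \<in> M"
  shows "f \<in> vFil m M p \<longleftrightarrow> f \<in> M \<and> (\<forall>i<m. f i \<in> Fil p)"
proof (cases "f \<in> M \<and> f \<noteq> (\<lambda>i\<in>{..<m}. \<zero>)")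
  case True
  then have f: "f \<in> {..<m} \<rightarrow>\<^sub>E carrier A" using M by blast
  show ?thesis
  proof (cases "p < 0")
    case True
    then have "\<exists>i<m. f i \<notin> Fil p"
      using \<open>f \<in> M \<and> f \<noteq> _\<close> free_module_eqI[OF f, of "\<lambda>i\<in>{..<m}. \<zero>"] by auto
    then show ?thesis using True \<open>f \<in> M \<and> f \<noteq> _\<close> by (simp add: vFil_def)
  next
    case False
    then show ?thesis
      using True vdeg_le_iff[OF f, of "nat p"] by (simp add: vFil_def nat_le_iff le_nat_iff)
  qed
next
  case False
  then show ?thesis using M(2) by (auto simp: vFil_def)
qed

end


section \<open>The associated graded module\<close>

context pbw_data
begin

text \<open>Module analogue of \<open>rees\<close>. The first index of \<open>w\<close> is the
  degree and the second the entry; \<open>gr_vec\<close> interchanges them, because a vector over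
  \<open>Gr\<close> has sequences as entries.\<close>

definition vrees :: "nat \<Rightarrow> (nat \<Rightarrow> 'a) set \<Rightarrow> (nat \<Rightarrow> nat \<Rightarrow> 'a) set"
  where "vrees m M = {w. (\<forall>p. w p \<in> vFil m M (int p)) \<and> finite {p. w p \<noteq> (\<lambda>i\<in>{..<m}. \<zero>)}}"

definition gr_vec :: "nat \<Rightarrow> (nat \<Rightarrow> nat \<Rightarrow> 'a) \<Rightarrow> nat \<Rightarrow> nat \<Rightarrow> 'a set"
  where "gr_vec m w = (\<lambda>i\<in>{..<m}. gr_seq (\<lambda>p. w p i))"

end

context nontrivial_skew_PBW_extension
begin

lemma gr_nontrivial: "nontrivial_skew_PBW_extension Gr gr_base n gr_vars"
proof (intro nontrivial_skew_PBW_extension.intro nontrivial_skew_PBW_extension_axioms.intro)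
  show "\<one>\<^bsub>Gr\<^esub> \<noteq> \<zero>\<^bsub>Gr\<^esub>"
    using gr_base_zero_iff[of \<one>] one_not_zero by (simp add: gr_class_one)
qed (rule gr_skew_PBW_extension)

interpretation gr: nontrivial_skew_PBW_extension Gr gr_base n gr_vars
  by (rule gr_nontrivial)

lemma submodule_carrier: "submodule ({..<m} \<rightarrow>\<^sub>E carrier A) A (free_module A m)"
  unfolding submodule_free_iff by (simp add: restrict_PiE_iff free_module_carrierD)

context
  fixes m :: nat and M :: "(nat \<Rightarrow> 'a) set"
  assumes M: "submodule M A (free_module A m)"
begin

lemma submodule_carrierD: "f \<in> M \<Longrightarrow> f \<in> {..<m} \<rightarrow>\<^sub>E carrier A"
  using M unfolding submodule_free_iff by blast

lemma submodule_entry: "f \<in> M \<Longrightarrow> i < m \<Longrightarrow> f i \<in> carrier A"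
  using submodule_carrierD free_module_carrierD by blast

lemma submodule_zero: "(\<lambda>i\<in>{..<m}. \<zero>) \<in> M"
  using M unfolding submodule_free_iff by blast

lemma submodule_add: "f \<in> M \<Longrightarrow> g \<in> M \<Longrightarrow> (\<lambda>i\<in>{..<m}. f i \<oplus> g i) \<in> M"
  using M unfolding submodule_free_iff by blast

lemma submodule_smult: "a \<in> carrier A \<Longrightarrow> f \<in> M \<Longrightarrow> (\<lambda>i\<in>{..<m}. a \<otimes> f i) \<in> M"
  using M unfolding submodule_free_iff by blast

lemma submodule_sum:
  assumes "finite P" "\<And>p. p \<in> P \<Longrightarrow> a p \<in> carrier A" "\<And>p. p \<in> P \<Longrightarrow> f p \<in> M"
  shows "(\<lambda>i\<in>{..<m}. \<Oplus>p\<in>P. a p \<otimes> f p i) \<in> M"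
  using assms
proof (induction P rule: finite_induct)
  case empty
  show ?case unfolding finsum_empty by (rule submodule_zero)
next
  case (insert q P)
  let ?u = "\<lambda>i\<in>{..<m}. a q \<otimes> f q i" and ?v = "\<lambda>i\<in>{..<m}. \<Oplus>p\<in>P. a p \<otimes> f p i"
  have "(\<lambda>i\<in>{..<m}. ?u i \<oplus> ?v i) \<in> M"
    using insert by (intro submodule_add submodule_smult) auto
  also have "(\<lambda>i\<in>{..<m}. ?u i \<oplus> ?v i) = (\<lambda>i\<in>{..<m}. \<Oplus>p\<in>insert q P. a p \<otimes> f p i)"
  proof (rule restrict_ext)
    fix i assume i: "i \<in> {..<m}"
    have "(\<Oplus>p\<in>insert q P. a p \<otimes> f p i) = a q \<otimes> f q i \<oplus> (\<Oplus>p\<in>P. a p \<otimes> f p i)"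
      using insert submodule_entry i by (intro finsum_insert) auto
    then show "?u i \<oplus> ?v i = (\<Oplus>p\<in>insert q P. a p \<otimes> f p i)" using i by simp
  qed
  finally show ?case .
qed

lemma submodule_vFil_iff: "f \<in> vFil m M p \<longleftrightarrow> f \<in> M \<and> (\<forall>i<m. f i \<in> Fil p)"
  using submodule_carrierD submodule_zero by (intro vFil_iff) auto

lemma vreesD:
  assumes "w \<in> vrees m M"
  shows "w p \<in> M" "i < m \<Longrightarrow> w p i \<in> Fil (int p)" "finite {p. w p \<noteq> (\<lambda>i\<in>{..<m}. \<zero>)}"
  using assms unfolding vrees_def submodule_vFil_iff by auto

lemma vreesI:
  assumes "\<And>p. w p \<in> M" "\<And>p i. i < m \<Longrightarrow> w p i \<in> Fil (int p)"
    "finite {p. w p \<noteq> (\<lambda>i\<in>{..<m}. \<zero>)}"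
  shows "w \<in> vrees m M"
  using assms unfolding vrees_def submodule_vFil_iff by auto

lemma vrees_entry:
  assumes w: "w \<in> vrees m M" and i: "i < m"
  shows "(\<lambda>p. w p i) \<in> rees"
proof (rule reesI)
  show "finite {p. w p i \<noteq> \<zero>}"
    by (rule finite_subset[OF _ vreesD(3)[OF w]]) (use i in auto)
qed (rule vreesD(2)[OF w i])

text \<open>Entry \<open>i\<close> of a vector in \<open>vFil m M q\<close> lies in
  \<open>Fil q\<close> and is absorbed, while adding all of \<open>Fil q\<close> fills up the coset.
  The embedding of the graded module is thereby computed on representatives.\<close>

lemma gr_embed_coset:
  assumes f: "f \<in> M" and i: "i < m"
  shows "(\<lambda>f. f i) ` (vFil m M q +>\<^bsub>free_module A m\<^esub> f) <+> Fil q = Fil q +> f i" (is "?L = ?R")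
proof (intro equalityI subsetI)
  fix a assume "a \<in> ?L"
  then obtain h k where hk: "h \<in> vFil m M q" "k \<in> Fil q" "a = (h i \<oplus> f i) \<oplus> k"
    using i unfolding a_r_coset_def' set_add_def' by auto
  have h: "h i \<in> Fil q" using hk(1) i by (simp add: submodule_vFil_iff)
  have "a = (h i \<oplus> k) \<oplus> f i"
    using hk(3) Fil_carrier[OF h] Fil_carrier[OF hk(2)] submodule_entry[OF f i] by (simp add: a_ac)
  then show "a \<in> ?R"
    using Fil_add[OF h hk(2)] unfolding a_r_coset_def' by blast
next
  fix a assume "a \<in> ?R"
  then obtain k where k: "k \<in> Fil q" "a = k \<oplus> f i"
    unfolding a_r_coset_def' by blast
  have "(\<lambda>i\<in>{..<m}. \<zero>) \<in> vFil m M q"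
    using submodule_zero by (simp add: submodule_vFil_iff)
  then have "(\<lambda>i\<in>{..<m}. \<zero>) \<oplus>\<^bsub>free_module A m\<^esub> f \<in> vFil m M q +>\<^bsub>free_module A m\<^esub> f"
    unfolding a_r_coset_def' by blast
  then have "f i \<in> (\<lambda>f. f i) ` (vFil m M q +>\<^bsub>free_module A m\<^esub> f)"
    by (rule image_eqI[rotated]) (use i submodule_entry[OF f i] in simp)
  moreover have "a = f i \<oplus> k"
    using k Fil_carrier submodule_entry[OF f i] by (simp add: a_comm)
  ultimately show "a \<in> ?L" using k(1) unfolding set_add_def' by blast
qed

lemma gr_embed_cosets:
  assumes "\<And>p. w p \<in> M"
  shows "gr_embed m (\<lambda>p. vFil m M (int p - 1) +>\<^bsub>free_module A m\<^esub> w p) = gr_vec m w"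
  unfolding gr_embed_def gr_vec_def gr_seq_def
  by (intro restrict_ext ext gr_embed_coset assms) simp

lemma vFil_coset_zero: "vFil m M q +>\<^bsub>free_module A m\<^esub> (\<lambda>i\<in>{..<m}. \<zero>) = vFil m M q"
proof -
  have "h \<oplus>\<^bsub>free_module A m\<^esub> (\<lambda>i\<in>{..<m}. \<zero>) = h" if "h \<in> vFil m M q" for h
    using that submodule_carrierD[of h] submodule_vFil_iff
    by (intro free_module_eqI[of _ m]) (simp_all add: restrict_PiE_iff free_module_carrierD)
  then show ?thesis unfolding a_r_coset_def' by auto
qed

text \<open>Representatives are chosen componentwise, and \<open>gr_embed_cosets\<close> evaluates
  the embedding on them. This is the module analogue of \<open>carrier_Gr\<close>.\<close>

lemma GrM_eq: "GrM m M = gr_vec m ` vrees m M"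
proof (intro equalityI subsetI)
  fix U assume "U \<in> GrM m M"
  then obtain u where u: "\<And>p. \<exists>f\<in>vFil m M (int p). u p = vFil m M (int p - 1) +>\<^bsub>free_module A m\<^esub> f"
      "finite {p. u p \<noteq> vFil m M (int p - 1)}" and U: "U = gr_embed m u"
    unfolding GrM_def gr_sequences_def by auto
  from u(1) obtain w where w: "\<And>p. w p \<in> vFil m M (int p)"
      "\<And>p. u p = vFil m M (int p - 1) +>\<^bsub>free_module A m\<^esub> w p"
    by metis
  \<comment> \<open>The zero vector represents each trivial coset, so finitely many nontrivial
    cosets give finite support.\<close>
  define w' where "w' = (\<lambda>p. if u p = vFil m M (int p - 1) then (\<lambda>i\<in>{..<m}. \<zero>) else w p)"
  have "w' \<in> vrees m M"
  proof (rule vreesI)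
    show "finite {p. w' p \<noteq> (\<lambda>i\<in>{..<m}. \<zero>)}"
      by (rule finite_subset[OF _ u(2)]) (auto simp: w'_def)
  qed (use w(1) submodule_zero in \<open>auto simp: w'_def submodule_vFil_iff\<close>)
  moreover have "u = (\<lambda>p. vFil m M (int p - 1) +>\<^bsub>free_module A m\<^esub> w' p)"
    by (rule ext) (simp add: w'_def w(2) vFil_coset_zero del: free_module_simps)
  ultimately show "U \<in> gr_vec m ` vrees m M"
    unfolding U using gr_embed_cosets[of w'] vreesD(1) by blast
next
  fix U assume "U \<in> gr_vec m ` vrees m M"
  then obtain w where w: "w \<in> vrees m M" and U: "U = gr_vec m w" by blast
  let ?u = "\<lambda>p. vFil m M (int p - 1) +>\<^bsub>free_module A m\<^esub> w p"
  have "finite {p. ?u p \<noteq> vFil m M (int p - 1)}"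
    by (rule finite_subset[OF _ vreesD(3)[OF w]]) (auto simp: vFil_coset_zero)
  then have "?u \<in> gr_sequences m M"
    using w unfolding gr_sequences_def vrees_def by blast
  then show "U \<in> GrM m M"
    unfolding GrM_def U gr_embed_cosets[OF vreesD(1)[OF w], symmetric] by (rule imageI)
qed

lemma veta_eq:
  assumes "f \<in> M"
  shows "veta m M f = (\<lambda>i\<in>{..<m}. gr_class (vdeg m f) (f i))"
proof -
  let ?w = "\<lambda>q. if q = vdeg m f then f else (\<lambda>i\<in>{..<m}. \<zero>)"
  have "veta m M f = gr_embed m (\<lambda>p. vFil m M (int p - 1) +>\<^bsub>free_module A m\<^esub> ?w p)"
    unfolding veta_def by (rule arg_cong[of _ _ "gr_embed m"]) (auto simp: fun_eq_iff vFil_coset_zero)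
  also have "\<dots> = gr_vec m ?w"
    using assms submodule_zero by (intro gr_embed_cosets) auto
  also have "\<dots> = (\<lambda>i\<in>{..<m}. gr_class (vdeg m f) (f i))"
    unfolding gr_vec_def gr_class_eq_gr_seq
    by (intro restrict_ext arg_cong[of _ _ gr_seq]) (auto simp: fun_eq_iff)
  finally show ?thesis .
qed

lemma veta_in_GrM:
  assumes "f \<in> M"
  shows "veta m M f \<in> GrM m M"
proof -
  let ?w = "\<lambda>q. if q = vdeg m f then f else (\<lambda>i\<in>{..<m}. \<zero>)"
  have "?w \<in> vrees m M"
    using assms submodule_zero vdeg_Fil[OF submodule_carrierD[OF assms]] by (intro vreesI) auto
  moreover have "veta m M f = gr_vec m ?w"
    unfolding veta_eq[OF assms] gr_vec_def gr_class_eq_gr_seq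
    by (intro restrict_ext arg_cong[of _ _ gr_seq]) (auto simp: fun_eq_iff)
  ultimately show ?thesis unfolding GrM_eq by blast
qed

lemma veta_homogeneous: "f \<in> M \<Longrightarrow> homogeneous m (veta m M f)"
  unfolding homogeneous_def
  by (rule exI[of _ "vdeg m f"]) (simp add: veta_eq gr_class_def)

text \<open>The operations of \<open>Gr\<close> on classes are induced by sums and convolutions of
  representatives; \<open>M\<close> is closed under both, the latter by
  \<open>submodule_sum\<close>.\<close>

lemma submodule_GrM: "submodule (GrM m M) Gr (free_module Gr m)"
  unfolding gr.submodule_free_iff
proof (intro conjI ballI subsetI)
  fix U assume "U \<in> GrM m M"
  then show "U \<in> {..<m} \<rightarrow>\<^sub>E carrier Gr"
    unfolding GrM_eq using vrees_entry by (auto simp: gr_vec_def carrier_Gr restrict_PiE_iff)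
next
  have "(\<lambda>_. \<lambda>i\<in>{..<m}. \<zero>) \<in> vrees m M"
    using submodule_zero by (intro vreesI) auto
  moreover have "(\<lambda>i\<in>{..<m}. \<zero>\<^bsub>Gr\<^esub>) = gr_vec m (\<lambda>_. \<lambda>i\<in>{..<m}. \<zero>)"
    unfolding gr_vec_def gr_zero by (rule restrict_ext) simp
  ultimately show "(\<lambda>i\<in>{..<m}. \<zero>\<^bsub>Gr\<^esub>) \<in> GrM m M" unfolding GrM_eq by blast
next
  fix U V assume "U \<in> GrM m M" "V \<in> GrM m M"
  then obtain w w' where w: "w \<in> vrees m M" "w' \<in> vrees m M" and UV: "U = gr_vec m w" "V = gr_vec m w'"
    unfolding GrM_eq by blast
  let ?s = "\<lambda>p. \<lambda>i\<in>{..<m}. w p i \<oplus> w' p i"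
  have "?s \<in> vrees m M"
  proof (rule vreesI)
    have "{p. ?s p \<noteq> (\<lambda>i\<in>{..<m}. \<zero>)} \<subseteq> {p. w p \<noteq> (\<lambda>i\<in>{..<m}. \<zero>)} \<union> {p. w' p \<noteq> (\<lambda>i\<in>{..<m}. \<zero>)}"
    proof (rule subsetI, rule ccontr)
      fix p assume "p \<in> {p. ?s p \<noteq> (\<lambda>i\<in>{..<m}. \<zero>)}"
        and "p \<notin> {p. w p \<noteq> (\<lambda>i\<in>{..<m}. \<zero>)} \<union> {p. w' p \<noteq> (\<lambda>i\<in>{..<m}. \<zero>)}"
      then show False by (auto cong: restrict_cong)
    qed
    then show "finite {p. ?s p \<noteq> (\<lambda>i\<in>{..<m}. \<zero>)}"
      by (rule finite_subset) (simp add: vreesD(3)[OF w(1)] vreesD(3)[OF w(2)])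
  qed (use vreesD[OF w(1)] vreesD[OF w(2)] submodule_add in \<open>auto intro: Fil_add\<close>)
  moreover have "(\<lambda>i\<in>{..<m}. U i \<oplus>\<^bsub>Gr\<^esub> V i) = gr_vec m ?s"
    unfolding UV gr_vec_def
  proof (rule restrict_ext)
    fix i assume "i \<in> {..<m}"
    then show "(\<lambda>i\<in>{..<m}. gr_seq (\<lambda>p. w p i)) i \<oplus>\<^bsub>Gr\<^esub> (\<lambda>i\<in>{..<m}. gr_seq (\<lambda>p. w' p i)) i =
        gr_seq (\<lambda>p. ?s p i)"
      using gr_add[OF vrees_entry[OF w(1)] vrees_entry[OF w(2)]] by simp
  qed
  ultimately show "(\<lambda>i\<in>{..<m}. U i \<oplus>\<^bsub>Gr\<^esub> V i) \<in> GrM m M" unfolding GrM_eq by blast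
next
  fix a V assume "a \<in> carrier Gr" "V \<in> GrM m M"
  then obtain f w where f: "f \<in> rees" and w: "w \<in> vrees m M" and aV: "a = gr_seq f" "V = gr_vec m w"
    unfolding GrM_eq carrier_Gr by blast
  let ?s = "\<lambda>k. \<lambda>i\<in>{..<m}. \<Oplus>p\<in>{..k}. f p \<otimes> w (k - p) i"
  have s: "(\<lambda>k. \<Oplus>p\<in>{..k}. f p \<otimes> w (k - p) i) \<in> rees" if "i < m" for i
    using rees_mult[OF f vrees_entry[OF w that]] .
  have "?s \<in> vrees m M"
  proof (rule vreesI)
    \<comment> \<open>A vector differs from zero only if one of its \<open>m\<close> entries does,
      and each entry of the convolution is a finitely supported Rees sequence.\<close>
    have "{k. ?s k \<noteq> (\<lambda>i\<in>{..<m}. \<zero>)} \<subseteq>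
        (\<Union>i\<in>{..<m}. {k. (\<Oplus>p\<in>{..k}. f p \<otimes> w (k - p) i) \<noteq> \<zero>})"
    proof
      fix k assume "k \<in> {k. ?s k \<noteq> (\<lambda>i\<in>{..<m}. \<zero>)}"
      then have "\<exists>i<m. (\<Oplus>p\<in>{..k}. f p \<otimes> w (k - p) i) \<noteq> \<zero>"
        by (metis (mono_tags, lifting) lessThan_iff mem_Collect_eq restrict_ext)
      then show "k \<in> (\<Union>i\<in>{..<m}. {k. (\<Oplus>p\<in>{..k}. f p \<otimes> w (k - p) i) \<noteq> \<zero>})" by blast
    qed
    then show "finite {k. ?s k \<noteq> (\<lambda>i\<in>{..<m}. \<zero>)}"
      by (rule finite_subset) (use s reesD(3) in blast)
    show "?s k \<in> M" for k
      using f w by (intro submodule_sum) (auto simp: reesD(2) vreesD(1))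
    show "?s k i \<in> Fil (int k)" if "i < m" for k i
      using reesD(1)[OF s[OF that], of k] that by simp
  qed
  moreover have "(\<lambda>i\<in>{..<m}. a \<otimes>\<^bsub>Gr\<^esub> V i) = gr_vec m ?s"
    unfolding aV gr_vec_def
  proof (rule restrict_ext)
    fix i assume "i \<in> {..<m}"
    then show "gr_seq f \<otimes>\<^bsub>Gr\<^esub> (\<lambda>i\<in>{..<m}. gr_seq (\<lambda>p. w p i)) i = gr_seq (\<lambda>k. ?s k i)"
      using gr_mult[OF f vrees_entry[OF w]] by simp
  qed
  ultimately show "(\<lambda>i\<in>{..<m}. a \<otimes>\<^bsub>Gr\<^esub> V i) \<in> GrM m M" unfolding GrM_eq by blast
qed

end

section \<open>The induced order on the monomials over \<open>Gr\<close>\<close>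

lemma veta_vmon:
  assumes \<alpha>: "\<alpha> \<in> exponents n" and i: "i < m"
  shows "veta m (carrier (free_module A m)) (vmon m \<alpha> i) = gr.vmon m \<alpha> i"
proof -
  have "vmonomials m (vmon m \<alpha> i) = {vmon m \<alpha> i}"
  proof -
    have "coeff (vmon m \<alpha> i j) \<beta> \<noteq> \<zero> \<longleftrightarrow> j = i \<and> \<beta> = \<alpha>" if "j < m" for j \<beta>
      using that \<alpha> one_not_zero by (auto simp: vmon_def coeff_mon)
    then show ?thesis unfolding vmonomials_eq using \<alpha> i by auto
  qed
  then have "vdeg m (vmon m \<alpha> i) = exp_size n \<alpha>"
    unfolding vdeg_def using \<alpha> i by simp
  then show ?thesis
    using veta_eq[OF submodule_carrier, of "vmon m \<alpha> i" m]
    by (simp add: gr.vmon_def gr_mon vmon_def cong: restrict_cong)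
      (auto intro!: restrict_ext simp: gr_mon)
qed

text \<open>\<open>gr_order\<close> is an image under \<open>veta\<close>, so the direction back to
  \<open>ord\<close> needs that a monomial over \<open>Gr\<close> determines its exponent and
  position.\<close>

lemma gr_order_iff:
  assumes "linear_order_on (Mon m) ord"
    and "\<alpha> \<in> exponents n" "i < m" "\<beta> \<in> exponents n" "j < m"
  shows "(gr.vmon m \<beta> j, gr.vmon m \<alpha> i) \<in> gr_order m ord \<longleftrightarrow> (vmon m \<beta> j, vmon m \<alpha> i) \<in> ord"
proof
  assume "(vmon m \<beta> j, vmon m \<alpha> i) \<in> ord"
  moreover have "vmon m \<alpha> i \<in> Mon m" "vmon m \<beta> j \<in> Mon m"
    using assms(2-5) by (auto simp: Mon_def)
  ultimately show "(gr.vmon m \<beta> j, gr.vmon m \<alpha> i) \<in> gr_order m ord"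
    unfolding gr_order_def mem_Collect_eq veta_vmon[OF assms(2,3), symmetric]
      veta_vmon[OF assms(4,5), symmetric] by blast
next
  assume "(gr.vmon m \<beta> j, gr.vmon m \<alpha> i) \<in> gr_order m ord"
  then obtain X Y where XY: "X \<in> Mon m" "Y \<in> Mon m" "(Y, X) \<in> ord"
      "gr.vmon m \<beta> j = veta m (carrier (free_module A m)) Y"
      "gr.vmon m \<alpha> i = veta m (carrier (free_module A m)) X"
    unfolding gr_order_def by blast
  then obtain \<alpha>' i' \<beta>' j' where *: "X = vmon m \<alpha>' i'" "\<alpha>' \<in> exponents n" "i' < m"
      "Y = vmon m \<beta>' j'" "\<beta>' \<in> exponents n" "j' < m"
    unfolding Mon_def by blast
  then have "gr.vmon m \<beta> j = gr.vmon m \<beta>' j'" "gr.vmon m \<alpha> i = gr.vmon m \<alpha>' i'"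
    using XY by (simp_all only: veta_vmon)
  then show "(vmon m \<beta> j, vmon m \<alpha> i) \<in> ord"
    using XY(3) * assms(2-5) by (simp add: gr.vmon_eq_iff)
qed

text \<open>Each clause concerns monomials only, and \<open>gr_order_iff\<close> replaces them by
  those with the same exponents and positions over \<open>A\<close>. Sums and sizes of exponents are
  shared, so the clauses carry over.\<close>

lemma monomial_order_gr_order:
  assumes ord: "monomial_order m ord"
  shows "gr.monomial_order m (gr_order m ord)"
proof -
  note lin = monomial_order_linear[OF ord]
  note iff = gr_order_iff[OF lin]
  have sub: "gr_order m ord \<subseteq> gr.Mon m \<times> gr.Mon m"
    unfolding gr_order_def Mon_def gr.Mon_def using veta_vmon by fastforce
  have refl: "refl_on (gr.Mon m) (gr_order m ord)"
    unfolding refl_on_def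
  proof
    fix U assume "U \<in> gr.Mon m"
    then obtain \<alpha> i where *: "U = gr.vmon m \<alpha> i" "\<alpha> \<in> exponents n" "i < m"
      unfolding gr.Mon_def by blast
    then have "vmon m \<alpha> i \<in> Mon m" by (auto simp: Mon_def)
    then have "(vmon m \<alpha> i, vmon m \<alpha> i) \<in> ord"
      using lin by (simp add: order_on_defs refl_on_def)
    then show "(U, U) \<in> gr_order m ord" using * by (simp add: iff)
  qed
  have total: "total_on (gr.Mon m) (gr_order m ord)"
    unfolding total_on_def
  proof (intro ballI impI)
    fix U V assume "U \<in> gr.Mon m" "V \<in> gr.Mon m" "U \<noteq> V"
    then obtain \<alpha> i \<beta> j where *: "U = gr.vmon m \<alpha> i" "\<alpha> \<in> exponents n" "i < m"
        "V = gr.vmon m \<beta> j" "\<beta> \<in> exponents n" "j < m" "\<not> (\<alpha> = \<beta> \<and> i = j)"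
      unfolding gr.Mon_def by blast
    have "vmon m \<alpha> i \<in> Mon m" "vmon m \<beta> j \<in> Mon m" "vmon m \<alpha> i \<noteq> vmon m \<beta> j"
      using * by (auto simp: Mon_def vmon_eq_iff)
    then have "(vmon m \<alpha> i, vmon m \<beta> j) \<in> ord \<or> (vmon m \<beta> j, vmon m \<alpha> i) \<in> ord"
      using lin by (auto simp: order_on_defs total_on_def)
    then show "(U, V) \<in> gr_order m ord \<or> (V, U) \<in> gr_order m ord"
      using * by (simp add: iff)
  qed
  have antisym: "antisym (gr_order m ord)"
  proof (rule antisymI)
    fix U V assume UV: "(U, V) \<in> gr_order m ord" "(V, U) \<in> gr_order m ord"
    then obtain \<alpha> i \<beta> j where *: "U = gr.vmon m \<alpha> i" "\<alpha> \<in> exponents n" "i < m"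
        "V = gr.vmon m \<beta> j" "\<beta> \<in> exponents n" "j < m"
      using sub unfolding gr.Mon_def by blast
    have "antisym ord" using lin by (simp add: order_on_defs)
    then have "vmon m \<alpha> i = vmon m \<beta> j"
      using UV * by (simp add: iff antisym_def)
    then show "U = V" using * by (simp add: vmon_eq_iff)
  qed
  have trans: "trans (gr_order m ord)"
  proof (rule transI)
    fix U V W assume UVW: "(U, V) \<in> gr_order m ord" "(V, W) \<in> gr_order m ord"
    then obtain \<alpha> i \<beta> j \<gamma> k where *: "U = gr.vmon m \<alpha> i" "\<alpha> \<in> exponents n" "i < m"
        "V = gr.vmon m \<beta> j" "\<beta> \<in> exponents n" "j < m" "W = gr.vmon m \<gamma> k" "\<gamma> \<in> exponents n" "k < m"
      using sub unfolding gr.Mon_def by blast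
    have "trans ord" using lin by (simp add: order_on_defs)
    moreover have "(vmon m \<alpha> i, vmon m \<beta> j) \<in> ord" "(vmon m \<beta> j, vmon m \<gamma> k) \<in> ord"
      using UVW * by (simp_all add: iff)
    ultimately have "(vmon m \<alpha> i, vmon m \<gamma> k) \<in> ord" by (rule transD)
    then show "(U, W) \<in> gr_order m ord" using * by (simp add: iff)
  qed
  have deg: "(U, V) \<in> gr_order m ord \<and> U \<noteq> V"
    if UV: "V \<in> gr.Mon m" "U \<in> gr.Mon m" "gr.mdeg m V > gr.mdeg m U" for U V
  proof -
    obtain \<alpha> i \<beta> j where *: "U = gr.vmon m \<alpha> i" "\<alpha> \<in> exponents n" "i < m"
        "V = gr.vmon m \<beta> j" "\<beta> \<in> exponents n" "j < m"
      using UV unfolding gr.Mon_def by blast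
    then have "mdeg m (vmon m \<beta> j) > mdeg m (vmon m \<alpha> i)"
      using UV(3) by simp
    moreover have "vmon m \<alpha> i \<in> Mon m" "vmon m \<beta> j \<in> Mon m" using * by (auto simp: Mon_def)
    ultimately have "(vmon m \<alpha> i, vmon m \<beta> j) \<in> ord"
      using ord unfolding monomial_order_def by blast
    moreover have "U \<noteq> V" using UV(3) by auto
    ultimately show ?thesis using * by (simp add: iff)
  qed
  have "linear_order_on (gr.Mon m) (gr_order m ord)"
    using sub refl total antisym trans by (simp add: order_on_defs)
  moreover have "\<forall>\<alpha>\<in>exponents n. \<forall>\<beta>\<in>exponents n. \<forall>i<m.
      (gr.vmon m \<alpha> i, gr.vmon m (exp_add \<beta> \<alpha>) i) \<in> gr_order m ord"
    using ord unfolding monomial_order_def by (simp add: iff)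
  moreover have "\<forall>\<alpha>\<in>exponents n. \<forall>\<beta>\<in>exponents n. \<forall>\<gamma>\<in>exponents n. \<forall>i<m. \<forall>j<m.
      (gr.vmon m \<alpha> i, gr.vmon m \<beta> j) \<in> gr_order m ord \<longrightarrow>
      (gr.vmon m (exp_add \<gamma> \<alpha>) i, gr.vmon m (exp_add \<gamma> \<beta>) j) \<in> gr_order m ord"
    using ord unfolding monomial_order_def by (simp add: iff)
  ultimately show ?thesis
    unfolding gr.monomial_order_def using deg by blast
qed

section \<open>Comparison of leading data and reducibility\<close>

lemma gr_vec_coeff:
  assumes "submodule M A (free_module A m)" "w \<in> vrees m M" "i < m"
  shows "gr.coeff (gr_vec m w i) \<alpha> = gr_class 0 (coeff (w (exp_size n \<alpha>) i) \<alpha>)"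
  using gr_coeff[OF vrees_entry[OF assms]] assms(3) by (simp add: gr_vec_def)

text \<open>The coefficient of the class at \<open>\<beta>\<close> comes from component
  \<open>exp_size n \<beta>\<close>, so the leading monomial singles out the component
  \<open>exp_size n \<alpha>\<close>. Within that vector, exponents of equal size are compared in
  \<open>Gr\<close>, smaller ones lose by degree, and larger ones do not occur.\<close>

lemma gr_vec_leads_at:
  assumes M: "submodule M A (free_module A m)" and w: "w \<in> vrees m M"
    and ord: "monomial_order m ord" and lead: "gr.leads_at m (gr_order m ord) (gr_vec m w) \<alpha> i"
  shows "leads_at m ord (w (exp_size n \<alpha>)) \<alpha> i"
proof -
  let ?f = "w (exp_size n \<alpha>)"
  have \<alpha>: "\<alpha> \<in> exponents n" "i < m" using lead unfolding gr.leads_at_def by auto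
  have f: "?f j \<in> carrier A" if "j < m" for j
    using submodule_entry[OF M vreesD(1)[OF M w] that] .
  have top: "coeff (w (exp_size n \<beta>) j) \<beta> \<noteq> \<zero> \<longleftrightarrow> gr.coeff (gr_vec m w j) \<beta> \<noteq> \<zero>\<^bsub>Gr\<^esub>" if "j < m" for j \<beta>
    using gr_vec_coeff[OF M w that] submodule_entry[OF M vreesD(1)[OF M w] that]
    by (simp add: gr_base_zero_iff)
  have "(vmon m \<beta> j, vmon m \<alpha> i) \<in> ord"
    if \<beta>: "\<beta> \<in> exponents n" "j < m" "coeff (?f j) \<beta> \<noteq> \<zero>" for \<beta> j
  proof (cases "exp_size n \<beta> = exp_size n \<alpha>")
    case True
    then have "gr.coeff (gr_vec m w j) \<beta> \<noteq> \<zero>\<^bsub>Gr\<^esub>" using top[of j \<beta>] \<beta> by simp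
    then have "(gr.vmon m \<beta> j, gr.vmon m \<alpha> i) \<in> gr_order m ord"
      using lead \<beta> unfolding gr.leads_at_def by blast
    then show ?thesis
      using gr_order_iff[OF monomial_order_linear[OF ord] \<alpha> \<beta>(1,2)] by simp
  next
    case False
    then have "exp_size n \<beta> < exp_size n \<alpha>"
      using Fil_coeff_zero[OF vreesD(2)[OF M w \<beta>(2), of "exp_size n \<alpha>"], of \<beta>] \<beta>(3) by fastforce
    then have "mdeg m (vmon m \<alpha> i) > mdeg m (vmon m \<beta> j)" using \<alpha> \<beta> by simp
    moreover have "vmon m \<alpha> i \<in> Mon m" "vmon m \<beta> j \<in> Mon m" using \<alpha> \<beta> by (auto simp: Mon_def)
    ultimately show ?thesis
      using ord unfolding monomial_order_def by blast
  qed
  moreover have "coeff (?f i) \<alpha> \<noteq> \<zero>"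
    using lead top[OF \<alpha>(2), of \<alpha>] unfolding gr.leads_at_def by blast
  ultimately show ?thesis using \<alpha> unfolding leads_at_def by blast
qed

text \<open>A monomial of larger degree would lie strictly above the leading one, against
  antisymmetry. Hence the part that \<open>veta\<close> keeps contains the leading monomial.\<close>

lemma leads_at_size:
  assumes ord: "monomial_order m ord" and f: "f \<in> {..<m} \<rightarrow>\<^sub>E carrier A"
    and lead: "leads_at m ord f \<alpha> i"
  shows "exp_size n \<alpha> = vdeg m f"
proof -
  have \<alpha>: "\<alpha> \<in> exponents n" "i < m" "coeff (f i) \<alpha> \<noteq> \<zero>" using lead unfolding leads_at_def by auto
  have "exp_size n \<beta> \<le> exp_size n \<alpha>" if "j < m" "coeff (f j) \<beta> \<noteq> \<zero>" for j \<beta>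
  proof (rule ccontr)
    assume *: "\<not> exp_size n \<beta> \<le> exp_size n \<alpha>"
    have \<beta>: "\<beta> \<in> exponents n"
      using coeff_outside[OF free_module_carrierD[OF f that(1)]] that(2) by blast
    have "vmon m \<alpha> i \<in> Mon m" "vmon m \<beta> j \<in> Mon m" using \<alpha> \<beta> that by (auto simp: Mon_def)
    moreover have "mdeg m (vmon m \<beta> j) > mdeg m (vmon m \<alpha> i)" using * \<alpha> \<beta> that by simp
    ultimately have "(vmon m \<alpha> i, vmon m \<beta> j) \<in> ord" "vmon m \<alpha> i \<noteq> vmon m \<beta> j"
      using ord unfolding monomial_order_def by blast+
    moreover have "(vmon m \<beta> j, vmon m \<alpha> i) \<in> ord"
      using lead \<beta> that unfolding leads_at_def by blast
    moreover have "antisym ord"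
      using monomial_order_linear[OF ord] by (simp add: order_on_defs)
    ultimately show False by (auto dest: antisymD)
  qed
  then have "\<forall>j<m. f j \<in> Fil (int (exp_size n \<alpha>))"
    using free_module_carrierD[OF f] by (auto simp: Fil_iff)
  moreover have nz: "f \<noteq> (\<lambda>i\<in>{..<m}. \<zero>)" using \<alpha> by auto
  ultimately have "vdeg m f \<le> exp_size n \<alpha>" using vdeg_le_iff[OF f nz] by blast
  moreover have "exp_size n \<alpha> \<le> vdeg m f"
    using vdeg_Fil[OF f \<alpha>(2)] \<alpha>(3) by (auto simp: Fil_iff)
  ultimately show ?thesis by simp
qed

lemma veta_coeff:
  assumes "submodule M A (free_module A m)" "f \<in> M" "i < m"
  shows "gr.coeff (veta m M f i) \<alpha> =
    (if exp_size n \<alpha> = vdeg m f then gr_class 0 (coeff (f i) \<alpha>) else \<zero>\<^bsub>Gr\<^esub>)"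
  using gr_coeff_class[OF vdeg_Fil[OF submodule_carrierD[OF assms(1,2)] assms(3)]] assms
  by (simp add: veta_eq)

text \<open>\<open>veta\<close> keeps exactly the coefficients of top size, so it adds no monomial,
  and by \<open>leads_at_size\<close> it retains the leading one.\<close>

lemma veta_leads_at:
  assumes M: "submodule M A (free_module A m)" and ord: "monomial_order m ord"
    and f: "f \<in> M" and lead: "leads_at m ord f \<alpha> i"
  shows "gr.leads_at m (gr_order m ord) (veta m M f) \<alpha> i"
    and "gr.coeff (veta m M f i) \<alpha> = gr_class 0 (coeff (f i) \<alpha>)"
proof -
  have \<alpha>: "\<alpha> \<in> exponents n" "i < m" "coeff (f i) \<alpha> \<noteq> \<zero>" using lead unfolding leads_at_def by auto
  show c: "gr.coeff (veta m M f i) \<alpha> = gr_class 0 (coeff (f i) \<alpha>)"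
    using leads_at_size[OF ord submodule_carrierD[OF M f] lead] \<alpha>(2)
    by (simp add: veta_coeff[OF M f])
  have "(gr.vmon m \<beta> j, gr.vmon m \<alpha> i) \<in> gr_order m ord"
    if \<beta>: "\<beta> \<in> exponents n" "j < m" "gr.coeff (veta m M f j) \<beta> \<noteq> \<zero>\<^bsub>Gr\<^esub>" for \<beta> j
  proof -
    have "coeff (f j) \<beta> \<noteq> \<zero>"
      using \<beta>(2,3) by (auto simp: veta_coeff[OF M f] split: if_splits)
    then show ?thesis
      using lead \<beta> gr_order_iff[OF monomial_order_linear[OF ord] \<alpha>(1,2) \<beta>(1,2)]
      unfolding leads_at_def by blast
  qed
  moreover have "gr.coeff (veta m M f i) \<alpha> \<noteq> \<zero>\<^bsub>Gr\<^esub>"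
    unfolding c using \<alpha>(2,3) submodule_entry[OF M f] by (simp add: gr_base_zero_iff)
  ultimately show "gr.leads_at m (gr_order m ord) (veta m M f) \<alpha> i"
    using \<alpha>(1,2) unfolding gr.leads_at_def by blast
qed

text \<open>\<open>u\<close> is any vector over \<open>Gr\<close> with the leading data of
  \<open>f\<close>, so the lemma serves for \<open>u = veta m M f\<close> as well as for a
  nonhomogeneous \<open>u\<close>. With the same multipliers \<open>\<gamma>\<close>, the ideal
  generators over \<open>Gr\<close> are the images of those over \<open>A\<close>, and
  \<open>gr_left_ideal_gen\<close> compares the ideals.\<close>

lemma reducible_gr_iff:
  assumes M: "submodule M A (free_module A m)" and ord: "monomial_order m ord"
    and G: "G \<subseteq> M - {\<lambda>i\<in>{..<m}. \<zero>}"
    and f: "leads_at m ord f \<alpha> i" "f \<in> M"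
    and u: "gr.leads_at m (gr_order m ord) u \<alpha> i" "gr.coeff (u i) \<alpha> = gr_class 0 (coeff (f i) \<alpha>)"
  shows "gr.reducible m (gr_order m ord) (veta m M ` G) u \<longleftrightarrow> reducible m ord G f"
proof -
  note lin = monomial_order_linear[OF ord]
  note gr_lin = gr.monomial_order_linear[OF monomial_order_gr_order[OF ord]]
  let ?lmf = "lm m ord" and ?lmg = "gr.lm m (gr_order m ord)"
  let ?lcf = "lc m ord" and ?lcg = "gr.lc m (gr_order m ord)"
  have \<alpha>: "\<alpha> \<in> exponents n" "i < m" using f(1) unfolding leads_at_def by auto
  have f_lead: "vexp m (?lmf f) = \<alpha>" "vpos m (?lmf f) = i" "?lcf f = coeff (f i) \<alpha>"
    using leads_atD[OF lin f(1)] by auto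
  have u_lead: "gr.vexp m (?lmg u) = \<alpha>" "gr.vpos m (?lmg u) = i" "?lcg u = gr_class 0 (?lcf f)"
    using gr.leads_atD[OF gr_lin u(1)] u(2) f_lead(3) by auto
  have g_lead: "gr.vexp m (?lmg (veta m M g)) = vexp m (?lmf g) \<and>
      gr.vpos m (?lmg (veta m M g)) = vpos m (?lmf g) \<and>
      ?lcg (veta m M g) = gr_class 0 (?lcf g) \<and>
      vexp m (?lmf g) \<in> exponents n \<and> ?lcf g \<in> R \<and> ?lcf g \<noteq> \<zero>" if g: "g \<in> G" for g
  proof -
    have gM: "g \<in> M" "g \<noteq> (\<lambda>i\<in>{..<m}. \<zero>)" using g G by auto
    obtain \<beta> j where lead: "leads_at m ord g \<beta> j"
      using leads_at_exists[OF lin submodule_carrierD[OF M gM(1)] gM(2)] .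
    then have \<beta>: "\<beta> \<in> exponents n" "j < m" "coeff (g j) \<beta> \<noteq> \<zero>" unfolding leads_at_def by auto
    show ?thesis
      using leads_atD[OF lin lead] gr.leads_atD[OF gr_lin veta_leads_at(1)[OF M ord gM(1) lead]]
        veta_leads_at(2)[OF M ord gM(1) lead] \<beta> submodule_entry[OF M gM(1) \<beta>(2)] by simp
  qed
  define T where "T = (\<lambda>\<gamma> g. sigma \<gamma> (?lcf g) \<otimes> struct_const \<gamma> (vexp m (?lmf g)))"
  define T' where "T' = (\<lambda>\<gamma> v. gr.sigma \<gamma> (?lcg v) \<otimes>\<^bsub>Gr\<^esub> gr.struct_const \<gamma> (gr.vexp m (?lmg v)))"
  have T: "T \<gamma> g \<in> R \<and> T' \<gamma> (veta m M g) = gr_class 0 (T \<gamma> g)"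
    if "g \<in> G" "\<gamma> \<in> exponents n" for \<gamma> g
  proof -
    have "sigma \<gamma> (?lcf g) \<in> R" "struct_const \<gamma> (vexp m (?lmf g)) \<in> R"
      using g_lead[OF that(1)] that(2) by (simp_all add: sigma_eq struct_const_eq)
    then show ?thesis
      using g_lead[OF that(1)] that(2) gr_class_mult[of _ 0 _ 0]
      by (simp add: T_def T'_def gr_sigma gr_struct_const)
  qed
  have ideal: "?lcg u \<in> gr.left_ideal_gen {T' \<gamma> v | \<gamma> v. v \<in> veta m M ` H \<and> \<gamma> \<in> exponents n \<and>
        exp_add \<gamma> (gr.vexp m (?lmg v)) = gr.vexp m (?lmg u)} \<longleftrightarrow>
      ?lcf f \<in> left_ideal_gen {T \<gamma> g | \<gamma> g. g \<in> H \<and> \<gamma> \<in> exponents n \<and>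
        exp_add \<gamma> (vexp m (?lmf g)) = vexp m (?lmf f)}" (is "_ \<in> gr.left_ideal_gen ?S' \<longleftrightarrow> _ \<in> left_ideal_gen ?S")
    if H: "H \<subseteq> G" for H
  proof -
    have "?S' = gr_class 0 ` ?S"
    proof (intro equalityI subsetI)
      fix a assume "a \<in> ?S'"
      then obtain \<gamma> g where *: "a = T' \<gamma> (veta m M g)" "g \<in> H" "\<gamma> \<in> exponents n"
          "exp_add \<gamma> (gr.vexp m (?lmg (veta m M g))) = gr.vexp m (?lmg u)" by blast
      moreover have "g \<in> G" using H *(2) by blast
      ultimately have "a = gr_class 0 (T \<gamma> g)" "exp_add \<gamma> (vexp m (?lmf g)) = vexp m (?lmf f)"
        using T g_lead by (auto simp: f_lead u_lead)
      then show "a \<in> gr_class 0 ` ?S" using * by blast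
    next
      fix a assume "a \<in> gr_class 0 ` ?S"
      then obtain \<gamma> g where *: "a = gr_class 0 (T \<gamma> g)" "g \<in> H" "\<gamma> \<in> exponents n"
          "exp_add \<gamma> (vexp m (?lmf g)) = vexp m (?lmf f)" by blast
      moreover have "g \<in> G" using H *(2) by blast
      ultimately have "a = T' \<gamma> (veta m M g)"
          "exp_add \<gamma> (gr.vexp m (?lmg (veta m M g))) = gr.vexp m (?lmg u)"
        using T g_lead by (auto simp: f_lead u_lead)
      then show "a \<in> ?S'" using * by blast
    qed
    moreover have "?S \<subseteq> R" using T H by blast
    moreover have "?lcf f \<in> R"
      using submodule_entry[OF M f(2) \<alpha>(2)] by (simp add: f_lead)
    ultimately show ?thesis
      unfolding u_lead(3) using gr_left_ideal_gen by simp
  qed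
  have dvd: "gr.mdvd m (?lmg (veta m M g)) (?lmg u) \<longleftrightarrow> mdvd m (?lmf g) (?lmf f)" if "g \<in> G" for g
    using g_lead[OF that] by (simp add: gr.mdvd_def mdvd_def f_lead u_lead)
  \<comment> \<open>Subsets of an image are images of subsets, so the choice of divisors over
    \<open>Gr\<close> becomes a choice of \<open>H \<subseteq> G\<close>, even when several elements
    of \<open>G\<close> share a class.\<close>
  have "gr.reducible m (gr_order m ord) (veta m M ` G) u \<longleftrightarrow>
      (\<exists>H\<subseteq>G. (\<forall>v\<in>veta m M ` H. gr.mdvd m (?lmg v) (?lmg u)) \<and>
        ?lcg u \<in> gr.left_ideal_gen {T' \<gamma> v | \<gamma> v. v \<in> veta m M ` H \<and> \<gamma> \<in> exponents n \<and>
        exp_add \<gamma> (gr.vexp m (?lmg v)) = gr.vexp m (?lmg u)})"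
    unfolding gr.reducible_def T'_def subset_image_iff by blast
  also have "\<dots> \<longleftrightarrow> (\<exists>H\<subseteq>G. (\<forall>g\<in>H. mdvd m (?lmf g) (?lmf f)) \<and>
      ?lcf f \<in> left_ideal_gen {T \<gamma> g | \<gamma> g. g \<in> H \<and> \<gamma> \<in> exponents n \<and>
        exp_add \<gamma> (vexp m (?lmf g)) = vexp m (?lmf f)})"
  proof (intro ex_cong1 conj_cong refl)
    fix H assume "H \<subseteq> G"
    then show "(\<forall>v\<in>veta m M ` H. gr.mdvd m (?lmg v) (?lmg u)) \<longleftrightarrow> (\<forall>g\<in>H. mdvd m (?lmf g) (?lmf f))"
      using dvd by blast
  qed (rule ideal)
  also have "\<dots> \<longleftrightarrow> reducible m ord G f"
    unfolding reducible_def T_def ..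
  finally show ?thesis .
qed

text \<open>If all top classes vanish, every entry lies one filtration step lower, which contradicts
  that \<open>vdeg m f\<close> is the degree.\<close>

lemma veta_nonzero:
  assumes M: "submodule M A (free_module A m)" and f: "f \<in> M"
  shows "veta m M f = (\<lambda>i\<in>{..<m}. \<zero>\<^bsub>Gr\<^esub>) \<longleftrightarrow> f = (\<lambda>i\<in>{..<m}. \<zero>)"
proof
  assume eta: "veta m M f = (\<lambda>i\<in>{..<m}. \<zero>\<^bsub>Gr\<^esub>)"
  show "f = (\<lambda>i\<in>{..<m}. \<zero>)"
  proof (rule ccontr)
    assume nz: "f \<noteq> (\<lambda>i\<in>{..<m}. \<zero>)"
    note fF = submodule_carrierD[OF M f]
    have zero: "gr_class (vdeg m f) (f i) = gr_class (vdeg m f) \<zero>" if "i < m" for i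
      using fun_cong[OF eta, of i] that by (simp add: veta_eq[OF M f])
    have low: "f i \<in> Fil (int (vdeg m f) - 1)" if "i < m" for i
      using zero[OF that] gr_class_eq_iff[OF vdeg_Fil[OF fF that] zero_Fil]
        free_module_carrierD[OF fF that] by (simp add: a_minus_def)
    obtain i where "i < m" "f i \<noteq> \<zero>"
      using nz free_module_eqI[OF fF, of "\<lambda>i\<in>{..<m}. \<zero>"] by auto
    \<comment> \<open>In degree 0 the next lower step is \<open>Fil (- 1)\<close>, which is zero,
      but \<open>f i\<close> is not; from here on \<open>vdeg m f - 1\<close> is a genuine
      predecessor.\<close>
    then have "vdeg m f \<noteq> 0" using low[of i] by (intro notI) simp
    then have "int (vdeg m f) - 1 = int (vdeg m f - 1)" by simp
    then have "vdeg m f \<le> vdeg m f - 1"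
      using low vdeg_le_iff[OF fF nz, of "vdeg m f - 1"] by (simp only:) blast
    then show False using \<open>vdeg m f \<noteq> 0\<close> by simp
  qed
next
  assume "f = (\<lambda>i\<in>{..<m}. \<zero>)"
  then show "veta m M f = (\<lambda>i\<in>{..<m}. \<zero>\<^bsub>Gr\<^esub>)"
    unfolding veta_eq[OF M f] by (intro restrict_ext) simp
qed

text \<open>Each clause of the definition has its own match: the order, the submodule, absence of
  the zero vector, and reducibility of all nonzero elements.\<close>

lemma groebner_basis_gr_iff:
  assumes M: "submodule M A (free_module A m)" and M0: "M \<noteq> {\<lambda>i\<in>{..<m}. \<zero>}"
    and ord: "monomial_order m ord" and G: "finite G" "G \<subseteq> M"
  shows "gr.groebner_basis m (gr_order m ord) (GrM m M) (veta m M ` G) \<longleftrightarrow> groebner_basis m ord M G"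
proof -
  let ?z = "\<lambda>i\<in>{..<m}. \<zero>" and ?z' = "\<lambda>i\<in>{..<m}. \<zero>\<^bsub>Gr\<^esub>"
  note lin = monomial_order_linear[OF ord]
  note gr_lin = gr.monomial_order_linear[OF monomial_order_gr_order[OF ord]]
  have GrM0: "GrM m M \<noteq> {?z'}"
  proof -
    obtain f where f: "f \<in> M" "f \<noteq> ?z" using M0 submodule_zero[OF M] by blast
    then show ?thesis using veta_in_GrM[OF M f(1)] veta_nonzero[OF M f(1)] by auto
  qed
  have G0: "veta m M ` G \<subseteq> GrM m M - {?z'} \<longleftrightarrow> G \<subseteq> M - {?z}"
  proof -
    have "veta m M g \<in> GrM m M - {?z'} \<longleftrightarrow> g \<in> M - {?z}" if "g \<in> G" for g
    proof -
      have "g \<in> M" using that G(2) by blast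
      then show ?thesis
        unfolding Diff_iff singleton_iff using veta_in_GrM[OF M] veta_nonzero[OF M] by simp
    qed
    then show ?thesis unfolding image_subset_iff subset_eq by simp
  qed
  \<comment> \<open>Leading data exist only for nonzero vectors, so reducibility is compared once
    \<open>G\<close> is known to omit zero; the preceding equivalence \<open>G0\<close> provides
    this from either side.\<close>
  have red: "(\<forall>u\<in>GrM m M - {?z'}. gr.reducible m (gr_order m ord) (veta m M ` G) u) \<longleftrightarrow>
      (\<forall>f\<in>M - {?z}. reducible m ord G f)" if G0: "G \<subseteq> M - {?z}"
  proof (intro iffI ballI)
    fix f assume *: "\<forall>u\<in>GrM m M - {?z'}. gr.reducible m (gr_order m ord) (veta m M ` G) u"
      and f: "f \<in> M - {?z}"
    then have fM: "f \<in> M" "f \<noteq> ?z" by auto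
    obtain \<alpha> i where lead: "leads_at m ord f \<alpha> i"
      using leads_at_exists[OF lin submodule_carrierD[OF M fM(1)] fM(2)] .
    have "gr.reducible m (gr_order m ord) (veta m M ` G) (veta m M f)"
      using * veta_in_GrM[OF M fM(1)] veta_nonzero[OF M fM(1)] fM(2) by blast
    then show "reducible m ord G f"
      using reducible_gr_iff[OF M ord G0 lead fM(1) veta_leads_at[OF M ord fM(1) lead]] by blast
  next
    fix u assume *: "\<forall>f\<in>M - {?z}. reducible m ord G f" and u: "u \<in> GrM m M - {?z'}"
    then obtain w where w: "w \<in> vrees m M" "u = gr_vec m w"
      unfolding GrM_eq[OF M] by blast
    have "GrM m M \<subseteq> {..<m} \<rightarrow>\<^sub>E carrier Gr"
      using submodule_GrM[OF M] unfolding gr.submodule_free_iff by (rule conjunct1)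
    then have u': "u \<in> {..<m} \<rightarrow>\<^sub>E carrier Gr" "u \<noteq> ?z'"
      using u by auto
    obtain \<alpha> i where lead': "gr.leads_at m (gr_order m ord) u \<alpha> i"
      using gr.leads_at_exists[OF gr_lin u'] .
    then have i: "i < m" unfolding gr.leads_at_def by blast
    \<comment> \<open>The component that carries the leading monomial of \<open>u\<close>. Its
      nonzero coefficient at \<open>\<alpha>\<close> makes it a nonzero element of \<open>M\<close>,
      although it may have lower terms that \<open>u\<close> does not see.\<close>
    let ?f = "w (exp_size n \<alpha>)"
    have fM: "?f \<in> M" using vreesD(1)[OF M w(1)] .
    have lead: "leads_at m ord ?f \<alpha> i"
      using gr_vec_leads_at[OF M w(1) ord] lead' w(2) by blast
    then have "?f \<noteq> ?z" unfolding leads_at_def by auto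
    then have "reducible m ord G ?f" using * fM by blast
    then show "gr.reducible m (gr_order m ord) (veta m M ` G) u"
      using reducible_gr_iff[OF M ord G0 lead fM lead'] gr_vec_coeff[OF M w(1) i] w(2) by blast
  qed
  show ?thesis
    unfolding gr.groebner_basis_def groebner_basis_def free_module_simps(2) gr.free_module_simps(2)
    using M M0 ord G monomial_order_gr_order[OF ord] submodule_GrM[OF M] GrM0 G0 red by auto
qed

end

theorem theorem4p6:
  fixes A :: "('a, 'b) ring_scheme"
    and R :: "'a set"
    and n m :: nat
    and x :: "nat \<Rightarrow> 'a"
    and ord :: "((nat \<Rightarrow> 'a) \<times> (nat \<Rightarrow> 'a)) set"
    and M :: "(nat \<Rightarrow> 'a) set"
    and J :: "'j set"
  assumes "skew_PBW_extension A R n x"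
    and "m \<ge> 1"
    and "pbw_data.monomial_order A n x m ord"
    and "submodule M A (free_module A m)"
    and "M \<noteq> {\<zero>\<^bsub>free_module A m\<^esub>}"
    and "finite J"
  shows "(\<forall>G g. pbw_data.gr_groebner_basis A R n x m (pbw_data.gr_order A R n x m ord)
                  (pbw_data.GrM A R n x m M) (G ` J) \<and>
                (\<forall>j\<in>J. pbw_data.homogeneous A R n x m (G j)) \<and>
                (\<forall>j\<in>J. g j \<in> M \<and> pbw_data.veta A R n x m M (g j) = G j)
            \<longrightarrow> pbw_data.groebner_basis A R n x m ord M (g ` J))
       \<and> (\<forall>g. pbw_data.groebner_basis A R n x m ord M (g ` J)
            \<longrightarrow> pbw_data.gr_groebner_basis A R n x m (pbw_data.gr_order A R n x m ord)
                  (pbw_data.GrM A R n x m M) ((\<lambda>i. pbw_data.veta A R n x m M (g i)) ` J) \<and>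
                (\<forall>i\<in>J. pbw_data.homogeneous A R n x m (pbw_data.veta A R n x m M (g i))))"
proof -
  interpret skew_PBW_extension A R n x by fact
  have M0: "M \<noteq> {\<lambda>i\<in>{..<m}. \<zero>\<^bsub>A\<^esub>}"
    using assms(5) by simp
  \<comment> \<open>Over the zero ring the free module has a single element, so its only submodule
    is zero, contrary to \<open>M0\<close>.\<close>
  interpret nontrivial_skew_PBW_extension A R n x
  proof
    show "\<one>\<^bsub>A\<^esub> \<noteq> \<zero>\<^bsub>A\<^esub>"
    proof
      assume "\<one>\<^bsub>A\<^esub> = \<zero>\<^bsub>A\<^esub>"
      then have "carrier A = {\<zero>\<^bsub>A\<^esub>}" by (rule one_zeroD)
      then have "{..<m} \<rightarrow>\<^sub>E carrier A = {\<lambda>i\<in>{..<m}. \<zero>\<^bsub>A\<^esub>}" by (simp add: PiE_over_singleton_iff)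
      then show False
        using assms(4) M0 unfolding submodule_free_iff by auto
    qed
  qed
  note iff = groebner_basis_gr_iff[OF assms(4) M0 assms(3)]
  show ?thesis
  proof (intro conjI allI impI ballI)
    fix G g
    assume *: "gr_groebner_basis m (gr_order m ord) (GrM m M) (G ` J) \<and>
      (\<forall>j\<in>J. homogeneous m (G j)) \<and> (\<forall>j\<in>J. g j \<in> M \<and> veta m M (g j) = G j)"
    then have "G ` J = veta m M ` g ` J" "g ` J \<subseteq> M"
      unfolding image_image by (auto intro: image_cong)
    then show "groebner_basis m ord M (g ` J)"
      using * iff[of "g ` J"] assms(6) by simp
  next
    fix g assume *: "groebner_basis m ord M (g ` J)"
    then have "g ` J \<subseteq> M" unfolding groebner_basis_def by blast
    then show "gr_groebner_basis m (gr_order m ord) (GrM m M) ((\<lambda>i. veta m M (g i)) ` J)"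
      using * iff[of "g ` J"] assms(6) by (simp add: image_image)
  next
    fix g i assume "groebner_basis m ord M (g ` J)" "i \<in> J"
    then have "g i \<in> M" unfolding groebner_basis_def by blast
    then show "homogeneous m (veta m M (g i))"
      by (rule veta_homogeneous[OF assms(4)])
  qed
qed

end
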